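(* Let $h\in(0,1)$, $\rho>0$, $\delta>0$ and let $z_\delta\in L^2(\Omega)$ be the given data. The strictly convex minimization problem $$\min_{(Q,f,g)\in\mathcal{H}_{ad}}\Upsilon^{\rho,h}_\delta(Q,f,g):=\mathcal{J}^h_\delta(Q,f,g)+\rho\mathcal{R}(Q,f,g)$$ attains a unique minimizer. Furthermore, an element $\Gamma:=(Q,f,g)\in\mathcal{H}_{ad}$ is the unique minimizer of this problem if and only if the system $$Q(x)=P_{\mathcal{K}}\left(\frac{1}{2\rho}\Big(\nabla\mathcal{U}^h_\Gamma(x)\otimes\nabla\mathcal{U}^h_\Gamma(x)-\nabla\bar\Pi^hz_\delta(x)\otimes\nabla\bar\Pi^hz_\delta(x)\Big)\right)\quad\text{for a.e. }x\in\Omega,$$ $$f(x)=\frac1\rho\Big(\bar\Pi^hz_\delta(x)-\mathcal{U}^h_\Gamma(x)\Big)\quad\text{for a.e. }x\in\Omega,$$ $$g(x)=\frac1\rho\,\gamma\Big(\bar\Pi^hz_\delta-\mathcal{U}^h_\Gamma\Big)(x)\quad\text{for a.e. }x\in\partial\Omega$$ holds.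
   Context: Domain: $\Omega\subset\mathbb{R}^d$, $1\le d\le 3$, is an open bounded connected domain with polygonal boundary $\partial\Omega$. $(\cdot,\cdot)$ and $\langle\cdot,\cdot\rangle$ are the scalar products of $L^2(\Omega)$ and $L^2(\partial\Omega)$; $\gamma:H^1(\Omega)\to H^{1/2}(\partial\Omega)$ is the Dirichlet trace operator; $H^1_\diamond(\Omega)=\{u\in H^1(\Omega): \int_{\partial\Omega}\gamma u=0\}$. Matrices: $\mathcal{S}_d$ is the space of real symmetric $d\times d$ matrices with inner product $M\cdot N=\mathrm{trace}(MN)$ and norm $\|M\|_{\mathcal{S}_d}=(M\cdot M)^{1/2}$. For $1\le p\le\infty$, $\mathbf{L}^p_{\rm sym}(\Omega)$ is the set of $H=(h_{ij})\in L^p(\Omega)^{d\times d}$ with $H(x)\in\mathcal{S}_d$ a.e.; $\|H\|^2_{\mathbf{L}^2_{\rm sym}(\Omega)}=\sum_{i,j}\|h_{ij}\|^2_{L^2(\Omega)}$. Given constants $\overline q\ge\underline q>0$, let $\mathcal{K}=\{M\in\mathcal{S}_d: \underline q|\xi|^2\le M\xi\cdot\xi\le\overline q|\xi|^2\text{ for all }\xi\in\mathbb{R}^d\}$ and let $P_{\mathcal{K}}:\mathcal{S}_d\to\mathcal{K}$ be the orthogonal projection, characterised by $(A-P_{\mathcal{K}}(A))\cdot(B-P_{\mathcal{K}}(A))\le0$ for all $A\in\mathcal{S}_d$, $B\in\mathcal{K}$. For $\xi,\eta\in\mathbb{R}^d$, $\xi\otimes\eta\in\mathcal{S}_d$ is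 the matrix with entries $(\xi\otimes\eta)_{ij}=\frac12(\xi_i\eta_j+\xi_j\eta_i)$. Admissible set: $\mathcal{H}_{ad}=\mathcal{Q}_{ad}\times L^2(\Omega)\times L^2(\partial\Omega)$ with $\mathcal{Q}_{ad}=\{Q\in\mathbf{L}^\infty_{\rm sym}(\Omega): \underline q|\xi|^2\le Q(x)\xi\cdot\xi\le\overline q|\xi|^2 \text{ for all }\xi\in\mathbb{R}^d,\text{ a.e. }x\in\Omega\}$. Penalty: $\mathcal{R}(Q,f,g)=\|Q\|^2_{\mathbf{L}^2_{\rm sym}(\Omega)}+\|f\|^2_{L^2(\Omega)}+\|g\|^2_{L^2(\partial\Omega)}$. Discretization: $(\mathcal{T}^h)_{0<h<1}$ is a family of regular, quasi-uniform triangulations of $\overline\Omega$ with mesh size $h$, such that each vertex of $\partial\Omega$ is a node. $\mathcal{P}_1$ denotes polynomials of degree at most 1. $\mathcal{V}^h_1=\{\varphi^h\in C(\overline\Omega)\cap H^1_\diamond(\Omega): \varphi^h|_T\in\mathcal{P}_1(T)\ \forall T\in\mathcal{T}^h\}$. For $\Gamma=(Q,f,g)\in\mathcal{H}_{ad}$, $\mathcal{U}^h_\Gamma=\mathcal{U}^h_{Q,f,g}\in\mathcal{V}^h_1$ is the unique solution of $\int_\Omega Q\nabla\mathcal{U}^h_\Gamma\cdot\nabla\varphi^h=(f,\varphi^h)+\langle g,\gamma\varphi^h\rangle$ for all $\varphi^h\in\mathcal{V}^h_1$. $\Pi^h:L^1(\Omega)\to\{\varphi^h\in C(\overline\Omega):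 \varphi^h|_T\in\mathcal{P}_1(T)\ \forall T\in\mathcal{T}^h\}$ is Clément's (linear) mollification interpolation operator, and $\bar\Pi^hz_\delta:=\Pi^hz_\delta-|\partial\Omega|^{-1}\langle1,\gamma\Pi^hz_\delta\rangle\in\mathcal{V}^h_1$, so that $\nabla\bar\Pi^hz_\delta=\nabla\Pi^hz_\delta$. Cost functional: $\mathcal{J}^h_\delta(Q,f,g)=\int_\Omega Q\nabla(\mathcal{U}^h_{Q,f,g}-\Pi^hz_\delta)\cdot\nabla(\mathcal{U}^h_{Q,f,g}-\Pi^hz_\delta)$. *)

theory Defs
  imports "HOL-Analysis.Analysis"
begin

section \<open>Domain, surface measure and Lebesgue spaces\<close>

text \<open>
  The Hausdorff measure of integer dimension \<open>k\<close>, normalised so that it agrees with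
  \<open>k\<close>-dimensional area on flat pieces. The empty set gets size 0 separately because
  \<open>0 ^ 0 = 1\<close>, which for \<open>k = 0\<close> is exactly what is needed for the (counting) measure of a point.
  Covers consist of bounded sets because the library's diameter is meaningless on unbounded ones.
\<close>

definition hausdorff_size :: "nat \<Rightarrow> 'a::metric_space set \<Rightarrow> ennreal" where
  "hausdorff_size k C =
     (if C = {} then 0 else ennreal (unit_ball_vol (real k) * (diameter C / 2) ^ k))"

definition hausdorff_pre :: "nat \<Rightarrow> real \<Rightarrow> 'a::metric_space set \<Rightarrow> ennreal" where
  "hausdorff_pre k \<epsilon> A =
     (INF C\<in>{C :: nat \<Rightarrow> 'a set. A \<subseteq> (\<Union>i. C i) \<and> (\<forall>i. bounded (C i) \<and> diameter (C i) \<le> \<epsilon>)}.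
        \<Sum>i. hausdorff_size k (C i))"

definition hausdorff_measure :: "nat \<Rightarrow> 'a::metric_space measure" where
  "hausdorff_measure k =
     measure_of UNIV (sets borel) (\<lambda>A. SUP \<epsilon>\<in>{0<..}. hausdorff_pre k \<epsilon> A)"

definition surface_measure :: "(real^'n) set \<Rightarrow> (real^'n) measure" where
  "surface_measure \<Omega> = restrict_space (hausdorff_measure (CARD('n) - 1)) (frontier \<Omega>)"

definition polygonal_domain :: "(real^'n) set \<Rightarrow> bool" where
  "polygonal_domain \<Omega> \<longleftrightarrow>
     open \<Omega> \<and> bounded \<Omega> \<and> connected \<Omega> \<and> \<Omega> \<noteq> {} \<and>
     (\<exists>\<F>. finite \<F> \<and> frontier \<Omega> = \<Union>\<F> \<and>
          (\<forall>F\<in>\<F>. polytope F \<and> aff_dim F = int CARD('n) - 1))"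

text \<open>
  A boundary point is a vertex iff the boundary is not translation invariant in any direction near it
  (corners for \<open>d = 2\<close>, corners but not edge points for \<open>d = 3\<close>, end points for \<open>d = 1\<close>).
\<close>

definition boundary_vertex :: "(real^'n) set \<Rightarrow> real^'n \<Rightarrow> bool" where
  "boundary_vertex \<Omega> v \<longleftrightarrow> v \<in> frontier \<Omega> \<and>
     \<not> (\<exists>w \<epsilon>. w \<noteq> 0 \<and> \<epsilon> > 0 \<and>
          (\<forall>x t. x \<in> ball v \<epsilon> \<and> x + t *\<^sub>R w \<in> ball v \<epsilon> \<longrightarrow>
             (x \<in> frontier \<Omega> \<longleftrightarrow> x + t *\<^sub>R w \<in> frontier \<Omega>)))"

text \<open>
  Elements of Lebesgue spaces are represented by functions; two of them are the same element iff they
  agree almost everywhere.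
\<close>

definition L2 :: "'a measure \<Rightarrow> ('a \<Rightarrow> 'b::euclidean_space) set" where
  "L2 M = {f. f \<in> borel_measurable M \<and> integrable M (\<lambda>x. (norm (f x))\<^sup>2)}"

definition Linf :: "'a measure \<Rightarrow> ('a \<Rightarrow> 'b::euclidean_space) set" where
  "Linf M = {f. f \<in> borel_measurable M \<and> (\<exists>C. AE x in M. norm (f x) \<le> C)}"

definition L2_normsq :: "'a measure \<Rightarrow> ('a \<Rightarrow> real) \<Rightarrow> real" where
  "L2_normsq M f = (LINT x|M. (f x)\<^sup>2)"


section \<open>Sobolev space and trace\<close>

definition test_function :: "(real^'n) set \<Rightarrow> (real^'n \<Rightarrow> real) \<Rightarrow> (real^'n \<Rightarrow> real^'n) \<Rightarrow> bool" where
  "test_function \<Omega> \<phi> D\<phi> \<longleftrightarrow>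
     (\<forall>x. GDERIV \<phi> x :> D\<phi> x) \<and> continuous_on UNIV D\<phi> \<and>
     (\<exists>K. compact K \<and> K \<subseteq> \<Omega> \<and> (\<forall>x. x \<notin> K \<longrightarrow> \<phi> x = 0))"

text \<open>
  Testing with compactly supported functions of class \<open>C\<^sup>1\<close> gives the same notion as testing with
  compactly supported smooth functions, by mollification.
\<close>

definition has_weak_gradient ::
    "(real^'n) set \<Rightarrow> (real^'n \<Rightarrow> real) \<Rightarrow> (real^'n \<Rightarrow> real^'n) \<Rightarrow> bool" where
  "has_weak_gradient \<Omega> u G \<longleftrightarrow>
     (\<forall>\<phi> D\<phi>. test_function \<Omega> \<phi> D\<phi> \<longrightarrow>
        (\<forall>i. (LINT x|lebesgue_on \<Omega>. u x * D\<phi> x $ i) = - (LINT x|lebesgue_on \<Omega>. G x $ i * \<phi> x)))"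

definition H1 :: "(real^'n) set \<Rightarrow> (real^'n \<Rightarrow> real) set" where
  "H1 \<Omega> = {u \<in> L2 (lebesgue_on \<Omega>). \<exists>G\<in>L2 (lebesgue_on \<Omega>). has_weak_gradient \<Omega> u G}"

text \<open>The weak gradient of a function in \<open>H1 \<Omega>\<close>; it is unique up to null sets.\<close>

definition grad :: "(real^'n) set \<Rightarrow> (real^'n \<Rightarrow> real) \<Rightarrow> real^'n \<Rightarrow> real^'n" where
  "grad \<Omega> u = (SOME G. G \<in> L2 (lebesgue_on \<Omega>) \<and> has_weak_gradient \<Omega> u G)"

definition H1_norm :: "(real^'n) set \<Rightarrow> (real^'n \<Rightarrow> real) \<Rightarrow> real" where
  "H1_norm \<Omega> u =
     sqrt (L2_normsq (lebesgue_on \<Omega>) u + (LINT x|lebesgue_on \<Omega>. (norm (grad \<Omega> u x))\<^sup>2))"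

text \<open>
  The Dirichlet trace operator, by its usual characterisation: the bounded linear operator from
  \<open>H1 \<Omega>\<close> to \<open>L2\<close> of the boundary which restricts functions continuous up to the boundary.
\<close>

definition trace_operator ::
    "(real^'n) set \<Rightarrow> ((real^'n \<Rightarrow> real) \<Rightarrow> real^'n \<Rightarrow> real) \<Rightarrow> bool" where
  "trace_operator \<Omega> \<gamma> \<longleftrightarrow>
     (\<forall>u\<in>H1 \<Omega>. \<gamma> u \<in> L2 (surface_measure \<Omega>)) \<and>
     (\<forall>u\<in>H1 \<Omega>. \<forall>v\<in>H1 \<Omega>. \<forall>a b. AE x in surface_measure \<Omega>.
        \<gamma> (\<lambda>y. a * u y + b * v y) x = a * \<gamma> u x + b * \<gamma> v x) \<and>
     (\<exists>C. \<forall>u\<in>H1 \<Omega>. sqrt (L2_normsq (surface_measure \<Omega>) (\<gamma> u)) \<le> C * H1_norm \<Omega> u) \<and>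
     (\<forall>u\<in>H1 \<Omega>. continuous_on (closure \<Omega>) u \<longrightarrow> (AE x in surface_measure \<Omega>. \<gamma> u x = u x))"

definition H1_diamond ::
    "(real^'n) set \<Rightarrow> ((real^'n \<Rightarrow> real) \<Rightarrow> real^'n \<Rightarrow> real) \<Rightarrow> (real^'n \<Rightarrow> real) set" where
  "H1_diamond \<Omega> \<gamma> = {u \<in> H1 \<Omega>. (LINT x|surface_measure \<Omega>. \<gamma> u x) = 0}"


section \<open>Symmetric matrices\<close>

definition sym_matrices :: "(real^'n^'n) set" where
  "sym_matrices = {M. transpose M = M}"

definition mat_inner :: "real^'n^'n \<Rightarrow> real^'n^'n \<Rightarrow> real" where
  "mat_inner M N = trace (M ** N)"

definition spectral_bounds :: "real \<Rightarrow> real \<Rightarrow> real^'n^'n \<Rightarrow> bool" where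
  "spectral_bounds ql qu M \<longleftrightarrow>
     (\<forall>\<xi>. ql * (norm \<xi>)\<^sup>2 \<le> (M *v \<xi>) \<bullet> \<xi> \<and> (M *v \<xi>) \<bullet> \<xi> \<le> qu * (norm \<xi>)\<^sup>2)"

definition K_set :: "real \<Rightarrow> real \<Rightarrow> (real^'n^'n) set" where
  "K_set ql qu = {M \<in> sym_matrices. spectral_bounds ql qu M}"

definition P_K :: "real \<Rightarrow> real \<Rightarrow> real^'n^'n \<Rightarrow> real^'n^'n" where
  "P_K ql qu A =
     (THE P. P \<in> K_set ql qu \<and> (\<forall>B\<in>K_set ql qu. mat_inner (A - P) (B - P) \<le> 0))"

definition sym_tensor :: "real^'n \<Rightarrow> real^'n \<Rightarrow> real^'n^'n" where
  "sym_tensor \<xi> \<eta> = (\<chi> i j. (\<xi> $ i * \<eta> $ j + \<xi> $ j * \<eta> $ i) / 2)"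

definition Linf_sym :: "(real^'n) set \<Rightarrow> (real^'n \<Rightarrow> real^'n^'n) set" where
  "Linf_sym \<Omega> = {H. (\<forall>i j. (\<lambda>x. H x $ i $ j) \<in> Linf (lebesgue_on \<Omega>)) \<and>
                    (AE x in lebesgue_on \<Omega>. H x \<in> sym_matrices)}"


section \<open>Admissible triples and penalty\<close>

type_synonym 'n triple =
  "(real^'n \<Rightarrow> real^'n^'n) \<times> (real^'n \<Rightarrow> real) \<times> (real^'n \<Rightarrow> real)"

definition Q_ad :: "(real^'n) set \<Rightarrow> real \<Rightarrow> real \<Rightarrow> (real^'n \<Rightarrow> real^'n^'n) set" where
  "Q_ad \<Omega> ql qu = {Q \<in> Linf_sym \<Omega>. AE x in lebesgue_on \<Omega>. spectral_bounds ql qu (Q x)}"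

definition H_ad :: "(real^'n) set \<Rightarrow> real \<Rightarrow> real \<Rightarrow> 'n triple set" where
  "H_ad \<Omega> ql qu = Q_ad \<Omega> ql qu \<times> L2 (lebesgue_on \<Omega>) \<times> L2 (surface_measure \<Omega>)"

definition penalty :: "(real^'n) set \<Rightarrow> 'n triple \<Rightarrow> real" where
  "penalty \<Omega> = (\<lambda>(Q, f, g).
     (\<Sum>i\<in>UNIV. \<Sum>j\<in>UNIV. L2_normsq (lebesgue_on \<Omega>) (\<lambda>x. Q x $ i $ j))
     + L2_normsq (lebesgue_on \<Omega>) f + L2_normsq (surface_measure \<Omega>) g)"

definition ae_equal :: "(real^'n) set \<Rightarrow> 'n triple \<Rightarrow> 'n triple \<Rightarrow> bool" where
  "ae_equal \<Omega> = (\<lambda>(Q, f, g) (Q', f', g').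
     (AE x in lebesgue_on \<Omega>. Q x = Q' x) \<and> (AE x in lebesgue_on \<Omega>. f x = f' x) \<and>
     (AE x in surface_measure \<Omega>. g x = g' x))"

definition convex_comb :: "real \<Rightarrow> 'n::finite triple \<Rightarrow> 'n triple \<Rightarrow> 'n triple" where
  "convex_comb t = (\<lambda>(Q, f, g) (Q', f', g').
     ((\<lambda>x. (1 - t) *\<^sub>R Q x + t *\<^sub>R Q' x), (\<lambda>x. (1 - t) * f x + t * f' x),
      (\<lambda>x. (1 - t) * g x + t * g' x)))"


section \<open>Finite elements\<close>

text \<open>
  The mesh size \<open>h\<close> enters as an upper bound for the element diameters; together with the
  quasi-uniformity bound below this also covers families whose largest diameter is exactly \<open>h\<close>.
\<close>

definition nodes :: "(real^'n) set set \<Rightarrow> (real^'n) set" where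
  "nodes \<T> = {v. \<exists>T\<in>\<T>. v extreme_point_of T}"

definition triangulates :: "(real^'n) set set \<Rightarrow> (real^'n) set \<Rightarrow> bool" where
  "triangulates \<T> \<Omega> \<longleftrightarrow>
     triangulation \<T> \<and> (\<forall>T\<in>\<T>. int CARD('n) simplex T) \<and> \<Union>\<T> = closure \<Omega>"

definition triangulation_family :: "(real^'n) set \<Rightarrow> (real \<Rightarrow> (real^'n) set set) \<Rightarrow> bool" where
  "triangulation_family \<Omega> Th \<longleftrightarrow>
     (\<forall>h\<in>{0<..<1}. triangulates (Th h) \<Omega> \<and> (\<forall>T\<in>Th h. diameter T \<le> h) \<and>
        {v. boundary_vertex \<Omega> v} \<subseteq> nodes (Th h)) \<and>
     (\<exists>\<kappa>>0. \<forall>h\<in>{0<..<1}. \<forall>T\<in>Th h. \<exists>x. cball x (diameter T / \<kappa>) \<subseteq> T) \<and>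
     (\<exists>\<tau>>0. \<forall>h\<in>{0<..<1}. \<forall>T\<in>Th h. \<tau> * h \<le> diameter T)"

definition P1 :: "(real^'n \<Rightarrow> real) set" where
  "P1 = {p. \<exists>a b. \<forall>x. p x = a \<bullet> x + b}"

definition P1_space :: "(real^'n) set \<Rightarrow> (real^'n) set set \<Rightarrow> (real^'n \<Rightarrow> real) set" where
  "P1_space \<Omega> \<T> =
     {\<phi>. continuous_on (closure \<Omega>) \<phi> \<and> (\<forall>T\<in>\<T>. \<exists>p\<in>P1. \<forall>x\<in>T. \<phi> x = p x)}"

definition V1 ::
    "(real^'n) set \<Rightarrow> ((real^'n \<Rightarrow> real) \<Rightarrow> real^'n \<Rightarrow> real) \<Rightarrow> (real^'n) set set \<Rightarrow> (real^'n \<Rightarrow> real) set" where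
  "V1 \<Omega> \<gamma> \<T> = P1_space \<Omega> \<T> \<inter> H1_diamond \<Omega> \<gamma>"

text \<open>
  Functions in \<open>P1_space\<close> and \<open>V1\<close> matter only on the closure of \<open>\<Omega>\<close>. The discrete solution and
  the interpolant below are unique there; the choice operator fixes arbitrary values elsewhere.
\<close>

definition fe_solution ::
    "(real^'n) set \<Rightarrow> ((real^'n \<Rightarrow> real) \<Rightarrow> real^'n \<Rightarrow> real) \<Rightarrow> (real^'n) set set \<Rightarrow>
     'n triple \<Rightarrow> real^'n \<Rightarrow> real" where
  "fe_solution \<Omega> \<gamma> \<T> = (\<lambda>(Q, f, g). SOME u. u \<in> V1 \<Omega> \<gamma> \<T> \<and>
     (\<forall>\<phi>\<in>V1 \<Omega> \<gamma> \<T>.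
        (LINT x|lebesgue_on \<Omega>. (Q x *v grad \<Omega> u x) \<bullet> grad \<Omega> \<phi> x)
        = (LINT x|lebesgue_on \<Omega>. f x * \<phi> x) + (LINT x|surface_measure \<Omega>. g x * \<gamma> \<phi> x)))"

text \<open>
  Clement's linear interpolation operator: the value at a node \<open>a\<close> is that of the \<open>L2\<close>-projection
  of \<open>v\<close> onto the affine functions on the union of the elements containing \<open>a\<close>.
\<close>

definition patch :: "(real^'n) set set \<Rightarrow> real^'n \<Rightarrow> (real^'n) set" where
  "patch \<T> a = \<Union>{T \<in> \<T>. a \<in> T}"

definition clement ::
    "(real^'n) set \<Rightarrow> (real^'n) set set \<Rightarrow> (real^'n \<Rightarrow> real) \<Rightarrow> real^'n \<Rightarrow> real" where
  "clement \<Omega> \<T> v = (SOME w. w \<in> P1_space \<Omega> \<T> \<and>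
     (\<forall>a\<in>nodes \<T>. \<exists>p\<in>P1.
        (\<forall>q\<in>P1. (LINT x|lebesgue_on (patch \<T> a \<inter> \<Omega>). (v x - p x) * q x) = 0) \<and> w a = p a))"

definition clement_bar ::
    "(real^'n) set \<Rightarrow> ((real^'n \<Rightarrow> real) \<Rightarrow> real^'n \<Rightarrow> real) \<Rightarrow> (real^'n) set set \<Rightarrow>
     (real^'n \<Rightarrow> real) \<Rightarrow> real^'n \<Rightarrow> real" where
  "clement_bar \<Omega> \<gamma> \<T> v = (\<lambda>x. clement \<Omega> \<T> v x -
     (LINT y|surface_measure \<Omega>. \<gamma> (clement \<Omega> \<T> v) y) / measure (surface_measure \<Omega>) (frontier \<Omega>))"


section \<open>The minimization problem\<close>

definition cost ::
    "(real^'n) set \<Rightarrow> ((real^'n \<Rightarrow> real) \<Rightarrow> real^'n \<Rightarrow> real) \<Rightarrow> (real^'n) set set \<Rightarrow>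
     (real^'n \<Rightarrow> real) \<Rightarrow> 'n triple \<Rightarrow> real" where
  "cost \<Omega> \<gamma> \<T> v = (\<lambda>(Q, f, g).
     let e = (\<lambda>x. fe_solution \<Omega> \<gamma> \<T> (Q, f, g) x - clement \<Omega> \<T> v x)
     in (LINT x|lebesgue_on \<Omega>. (Q x *v grad \<Omega> e x) \<bullet> grad \<Omega> e x))"

definition Upsilon ::
    "(real^'n) set \<Rightarrow> ((real^'n \<Rightarrow> real) \<Rightarrow> real^'n \<Rightarrow> real) \<Rightarrow> (real^'n) set set \<Rightarrow>
     real \<Rightarrow> (real^'n \<Rightarrow> real) \<Rightarrow> 'n triple \<Rightarrow> real" where
  "Upsilon \<Omega> \<gamma> \<T> \<rho> v \<Gamma> = cost \<Omega> \<gamma> \<T> v \<Gamma> + \<rho> * penalty \<Omega> \<Gamma>"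

definition strictly_convex_problem ::
    "(real^'n) set \<Rightarrow> 'n triple set \<Rightarrow> ('n triple \<Rightarrow> real) \<Rightarrow> bool" where
  "strictly_convex_problem \<Omega> A F \<longleftrightarrow>
     (\<forall>\<Gamma>\<in>A. \<forall>\<Gamma>'\<in>A. \<forall>t\<in>{0<..<1}. convex_comb t \<Gamma> \<Gamma>' \<in> A \<and>
        (\<not> ae_equal \<Omega> \<Gamma> \<Gamma>' \<longrightarrow> F (convex_comb t \<Gamma> \<Gamma>') < (1 - t) * F \<Gamma> + t * F \<Gamma>'))"

definition unique_minimizer ::
    "(real^'n) set \<Rightarrow> 'n triple set \<Rightarrow> ('n triple \<Rightarrow> real) \<Rightarrow> 'n triple \<Rightarrow> bool" where
  "unique_minimizer \<Omega> A F \<Gamma> \<longleftrightarrow>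
     \<Gamma> \<in> A \<and> (\<forall>\<Gamma>'\<in>A. F \<Gamma> \<le> F \<Gamma>') \<and>
     (\<forall>\<Gamma>'\<in>A. (\<forall>\<Gamma>''\<in>A. F \<Gamma>' \<le> F \<Gamma>'') \<longrightarrow> ae_equal \<Omega> \<Gamma>' \<Gamma>)"

end

theory Submission
  imports Defs
begin

text \<open>
  The optimality system is a saddle point condition. Let \<open>P\<close> be the mean-free interpolant of
  the data and put, for a control \<open>\<Gamma> = (Q, f, g)\<close> and a discrete function \<open>\<phi>\<close>,
  \<open>L(\<Gamma>, \<phi>) = 2 (f, \<phi> - P) + 2 \<langle>g, \<gamma>(\<phi> - P)\<rangle> - \<integral> Q \<nabla>\<phi> \<bullet> \<nabla>\<phi> + \<integral> Q \<nabla>P \<bullet> \<nabla>P + \<rho> R(\<Gamma>)\<close>.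

  For fixed \<open>\<Gamma>\<close> this is a concave quadratic function of \<open>\<phi>\<close>; expanding
  \<open>\<integral> Q \<nabla>(U - \<phi>) \<bullet> \<nabla>(U - \<phi>) \<ge> 0\<close> shows that it is maximal at the discrete state
  \<open>U\<close> of \<open>\<Gamma>\<close>, where its value is the functional to be minimized (\<open>Lag_le_solution\<close>,
  \<open>Lag_solution\<close>). For fixed \<open>\<phi>\<close>, completing the square under the integrals shows that it is
  minimal at the control given by the right-hand sides of the optimality system with \<open>\<phi>\<close> in place
  of \<open>U\<close> (\<open>Lag_opt_le\<close>). So a control satisfies the system iff it forms, together with its own
  state, a saddle point of \<open>L\<close>.

  The three claims follow. The functional is a maximum over \<open>\<phi>\<close> of functions that are affine in
  \<open>\<Gamma>\<close> apart from the strictly convex penalty, hence strictly convex, so that minimizers are unique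
  up to null sets. A control that satisfies the system is a minimizer, since minimizing \<open>L\<close> at the
  fixed state bounds the functional of every other control from below. A saddle point exists because
  the dual function, the minimum of \<open>L\<close> over all controls, is upper semicontinuous and tends to
  \<open>-\<infinity>\<close> on a finite-dimensional space: it has a maximizer, and comparing this point with nearby
  ones shows that it is the state of its own minimizing control
  (\<open>finite_dimensional_saddle_point\<close>). With uniqueness, every minimizer then satisfies the
  system. The same lemma with a single control gives the existence of discrete states.

  What has to be supplied is the meaning of the objects. The Hausdorff measure is a measure on the
  Borel sets, and the boundary has positive area (\<open>surface_measure_positive\<close>); it has finite area,
  because the trace of the constant 1 is square integrable. Weak gradients are unique up to null sets
  (\<open>weak_gradient_unique\<close>), and continuous piecewise affine functions have their elementwise
  gradients as weak gradients (\<open>P1_space_has_weak_gradient\<close>). A piecewise affine function with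
  vanishing gradient is constant on the connected domain, so the energy is an inner product on the
  mean-free functions. Nodal interpolation and projection onto affine functions on the patches give
  the Clement interpolant (\<open>clement_in_P1_space\<close>). An energy orthonormal basis of the discrete
  space (\<open>V_orthonormal_basis\<close>) turns everything into a problem about coefficient vectors, in
  which values, gradients and traces depend linearly on the coefficients at every point and not only
  up to null sets.
\<close>

section \<open>Hausdorff measure\<close>

lemma ennreal_suminf_tail_le:
  fixes a :: "nat \<Rightarrow> ennreal" and e :: real
  assumes fin: "suminf a \<noteq> top" and e: "e > 0"
  shows "\<exists>n. (\<Sum>k. a (k + n)) \<le> ennreal e"
proof -
  have lim: "(\<lambda>n. (\<Sum>k<n. a k) + ennreal e) \<longlonglongrightarrow> suminf a + ennreal e"
    by (intro tendsto_add summable_LIMSEQ tendsto_const) auto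
  have "suminf a < suminf a + ennreal e"
    using fin e by (simp add: ennreal_less_zero_iff less_top)
  from order_tendstoD(1)[OF lim this] obtain n where n: "suminf a < (\<Sum>k<n. a k) + ennreal e"
    by (auto simp: eventually_sequentially)
  have split: "suminf a = (\<Sum>k. a (k + n)) + (\<Sum>k<n. a k)"
    by (rule suminf_offset) auto
  have "(\<Sum>k<n. a k) \<noteq> top"
    using fin split by (auto simp: ennreal_add_eq_top)
  moreover have "(\<Sum>k<n. a k) + (\<Sum>k. a (k + n)) \<le> (\<Sum>k<n. a k) + ennreal e"
    using n split by (metis add.commute less_imp_le)
  ultimately show ?thesis
    by (metis ennreal_add_left_cancel_le infinity_ennreal_def)
qed

text \<open>
  The Caratheodory criterion for metric outer measures. The part of \<open>X\<close> outside the closed set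
  \<open>F\<close> is exhausted by the sets \<open>Y n\<close> of points at distance at least \<open>1 / (n + 1)\<close> from
  \<open>F\<close>, on which additivity holds by assumption. What is missing is covered by the shells \<open>R k\<close>
  with \<open>k \<ge> n\<close>. Shells whose indices differ by at least two are separated, so the even ones and
  the odd ones each have total size at most \<open>\<mu> X\<close>: the series over all shells converges, and its
  tails vanish.
\<close>

lemma closed_in_lambda_system_metric:
  fixes \<mu> :: "'a::metric_space set \<Rightarrow> ennreal"
  assumes om: "outer_measure_space UNIV \<mu>"
    and metric: "\<And>A B d. d > 0 \<Longrightarrow> (\<And>a b. a \<in> A \<Longrightarrow> b \<in> B \<Longrightarrow> d \<le> dist a b) \<Longrightarrow> \<mu> A + \<mu> B \<le> \<mu> (A \<union> B)"
    and F: "closed F"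
  shows "F \<in> lambda_system UNIV UNIV \<mu>"
proof -
  interpret sa: sigma_algebra UNIV "UNIV :: 'a set set"
    using sigma_algebra_Pow[of "UNIV :: 'a set"] by simp
  have pos: "positive UNIV \<mu>" and inc: "increasing UNIV \<mu>" and csub: "countably_subadditive UNIV \<mu>"
    using om by (auto simp: outer_measure_space_def)
  have mono: "\<mu> A \<le> \<mu> B" if "A \<subseteq> B" for A B
    using inc that by (auto simp: increasing_def)
  have empty: "\<mu> {} = 0" using pos by (rule positiveD1)
  have sub: "\<mu> (A \<union> B) \<le> \<mu> A + \<mu> B" if "A \<inter> B = {}" for A B
    using sa.countably_subadditive_subadditive[OF pos csub] that by (auto simp: subadditive_def)
  have "\<mu> (X \<inter> F) + \<mu> (X - F) = \<mu> X" for X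
  proof (cases "F = {} \<or> \<mu> X = top")
    case True
    then show ?thesis
    proof
      assume "F = {}" then show ?thesis by (simp add: empty)
    next
      assume "\<mu> X = top"
      moreover have "\<mu> X \<le> \<mu> (X \<inter> F) + \<mu> (X - F)"
        using sub[of "X \<inter> F" "X - F"] by (simp add: Int_Diff_Un Int_Diff_disjoint)
      ultimately show ?thesis by (simp add: top_unique)
    qed
  next
    case False
    then have ne: "F \<noteq> {}" and fin: "\<mu> X \<noteq> top" by auto
    define f where "f x = infdist x F" for x
    have f_lip: "\<bar>f x - f y\<bar> \<le> dist x y" for x y
      unfolding f_def by (rule infdist_triangle_abs)
    have f0: "f x = 0 \<longleftrightarrow> x \<in> F" and fnn: "f x \<ge> 0" for x
      using in_closed_iff_infdist_zero[OF F ne] by (auto simp: f_def infdist_nonneg)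
    define R where "R k = {x \<in> X. 1 / (real k + 2) \<le> f x \<and> f x < 1 / (real k + 1)}" for k
    define Y where "Y n = {x \<in> X. 1 / (real n + 1) \<le> f x}" for n
    have half: "(\<Sum>i<n. \<mu> (R (2 * i + r))) \<le> \<mu> (\<Union>i<n. R (2 * i + r))" for n r
    proof (induction n)
      case 0
      then show ?case by (simp add: empty)
    next
      case (Suc n)
      let ?A = "\<Union>i<n. R (2 * i + r)" and ?B = "R (2 * n + r)"
      have "\<mu> ?A + \<mu> ?B \<le> \<mu> (?A \<union> ?B)"
      proof (cases "n = 0")
        case True
        then show ?thesis by (simp add: empty)
      next
        case n: False
        define p where "p = real (2 * n + r)"
        have p: "p > 0" using n by (simp add: p_def)
        show ?thesis
        proof (rule metric)
          show "1 / p - 1 / (p + 1) > 0"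
            using p by (simp add: field_simps add_pos_pos)
          fix a b assume "a \<in> ?A" "b \<in> ?B"
          then obtain i where i: "i < n" "1 / (real (2 * i + r) + 2) \<le> f a"
            and b: "f b < 1 / (p + 1)"
            by (auto simp: R_def p_def)
          have "real (2 * i + r) + 2 \<le> p" using i(1) by (simp add: p_def)
          then have "1 / p \<le> 1 / (real (2 * i + r) + 2)" using p by (intro divide_left_mono) auto
          then show "1 / p - 1 / (p + 1) \<le> dist a b"
            using i(2) b f_lip[of a b] by linarith
        qed
      qed
      also have "?A \<union> ?B = (\<Union>i<Suc n. R (2 * i + r))"
        by (auto simp: lessThan_Suc)
      finally show ?case
        using Suc.IH by (simp add: add_right_mono order_trans[OF add_right_mono])
    qed
    have halfX: "(\<Sum>i<n. \<mu> (R (2 * i + r))) \<le> \<mu> X" for n r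
      by (rule order_trans[OF half mono]) (auto simp: R_def)
    have "suminf (\<lambda>k. \<mu> (R k)) \<le> \<mu> X + \<mu> X"
      unfolding suminf_eq_SUP
    proof (rule SUP_least)
      fix n
      \<comment> \<open>Splitting into even and odd shells makes the sets of each sum pairwise separated.\<close>
      have "(\<Sum>k<n. \<mu> (R k)) \<le> (\<Sum>k<2 * n. \<mu> (R k))"
        by (rule sum_mono2) auto
      also have "\<dots> = (\<Sum>i<n. \<mu> (R (2 * i))) + (\<Sum>i<n. \<mu> (R (2 * i + 1)))"
        by (induction n) (auto simp: algebra_simps)
      also have "\<dots> \<le> \<mu> X + \<mu> X"
        using halfX[where n = n and r = 0] halfX[where n = n and r = 1] by (intro add_mono) simp_all
      finally show "(\<Sum>k<n. \<mu> (R k)) \<le> \<mu> X + \<mu> X" .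
    qed
    then have sumfin: "suminf (\<lambda>k. \<mu> (R k)) \<noteq> top"
      using fin by (auto simp: top_unique ennreal_add_eq_top)
    have le: "\<mu> (X \<inter> F) + \<mu> (X - F) \<le> \<mu> X"
    proof (rule ennreal_le_epsilon)
      fix e :: real assume e: "e > 0"
      obtain n where n: "(\<Sum>k. \<mu> (R (k + n))) \<le> ennreal e"
        using ennreal_suminf_tail_le[OF sumfin e] by blast
      have disj: "disjoint_family (\<lambda>k. R (k + n))"
      proof -
        have "R i \<inter> R j = {}" if "i < j" for i j
        proof -
          have "real j + 1 \<ge> real i + 2" using that by simp
          then have "1 / (real j + 1) \<le> 1 / (real i + 2)" by (intro divide_left_mono) auto
          then show ?thesis by (auto simp: R_def)
        qed
        then have "i \<noteq> j \<Longrightarrow> R i \<inter> R j = {}" for i j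
          by (metis inf_commute linorder_neqE_nat)
        then show ?thesis by (auto simp: disjoint_family_on_def)
      qed
      have cover: "X - F \<subseteq> Y n \<union> (\<Union>k. R (k + n))"
      proof
        fix x assume x: "x \<in> X - F"
        then have fx: "f x > 0" using f0[of x] fnn[of x] by fastforce
        show "x \<in> Y n \<union> (\<Union>k. R (k + n))"
        proof (cases "1 / (real n + 1) \<le> f x")
          case True
          then show ?thesis using x by (auto simp: Y_def)
        next
          case False
          \<comment> \<open>The index of the shell of \<open>x\<close> is one less than the first \<open>m\<close> with \<open>x \<in> Y m\<close>.\<close>
          define P where "P m \<longleftrightarrow> 1 / (real m + 1) \<le> f x" for m
          obtain m where "1 / f x < real m" using reals_Archimedean2 by blast
          then have "P m" using fx by (simp add: P_def field_simps)
          then have "P (LEAST m. P m)" by (rule LeastI)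
          moreover have "(LEAST m. P m) > n"
          proof (rule ccontr)
            assume "\<not> n < (LEAST m. P m)"
            then have "1 / (real n + 1) \<le> 1 / (real (LEAST m. P m) + 1)"
              by (intro divide_left_mono) auto
            then show False using \<open>P (LEAST m. P m)\<close> False by (simp add: P_def)
          qed
          ultimately obtain j where j: "(LEAST m. P m) = Suc j" "j \<ge> n" "P (Suc j)"
            by (metis less_imp_Suc_add le_add1 add_Suc)
          have "\<not> P j" using not_less_Least[of j P] j(1) by simp
          then have "x \<in> R (j - n + n)" using x j by (auto simp: R_def P_def add.commute)
          then show ?thesis by blast
        qed
      qed
      have "\<mu> (X - F) \<le> \<mu> (Y n \<union> ((\<Union>k. R (k + n)) ))"
        by (rule mono[OF cover])
      also have "\<dots> \<le> \<mu> (Y n) + \<mu> (\<Union>k. R (k + n))"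
      proof (rule sub)
        have "R (k + n) \<inter> Y n = {}" for k
        proof -
          have "1 / (real (k + n) + 1) \<le> 1 / (real n + 1)" by (intro divide_left_mono) auto
          then show ?thesis by (auto simp: R_def Y_def)
        qed
        then show "Y n \<inter> (\<Union>k. R (k + n)) = {}" by blast
      qed
      also have "\<mu> (\<Union>k. R (k + n)) \<le> (\<Sum>k. \<mu> (R (k + n)))"
        using csub disj unfolding countably_subadditive_def by blast
      finally have 1: "\<mu> (X - F) \<le> \<mu> (Y n) + ennreal e"
        using n by (meson add_left_mono order_trans)
      have "\<mu> (X \<inter> F) + \<mu> (Y n) \<le> \<mu> (X \<inter> F \<union> Y n)"
      proof (rule metric)
        show "1 / (real n + 1) > 0" by simp
        fix a b assume "a \<in> X \<inter> F" "b \<in> Y n"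
        then show "1 / (real n + 1) \<le> dist a b"
          using f_lip[of a b] f0[of a] by (auto simp: Y_def)
      qed
      also have "\<dots> \<le> \<mu> X" by (rule mono) (auto simp: Y_def)
      finally show "\<mu> (X \<inter> F) + \<mu> (X - F) \<le> \<mu> X + ennreal e"
        using add_left_mono[OF 1, of "\<mu> (X \<inter> F)"] by (metis add.assoc add_right_mono order_trans)
    qed
    moreover have "\<mu> X \<le> \<mu> (X \<inter> F) + \<mu> (X - F)"
      using sub[of "X \<inter> F" "X - F"] by (simp add: Int_Diff_Un Int_Diff_disjoint)
    ultimately show ?thesis by simp
  qed
  then show ?thesis by (simp add: sa.lambda_system_eq)
qed

lemma hausdorff_size_empty [simp]: "hausdorff_size k {} = 0"
  by (simp add: hausdorff_size_def)

lemma hausdorff_pre_le: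
  assumes "A \<subseteq> (\<Union>i. C i)" "\<And>i. bounded (C i)" "\<And>i. diameter (C i) \<le> \<epsilon>"
  shows "hausdorff_pre k \<epsilon> A \<le> (\<Sum>i. hausdorff_size k (C i))"
  unfolding hausdorff_pre_def using assms by (intro INF_lower) auto

lemma hausdorff_pre_mono: "A \<subseteq> B \<Longrightarrow> hausdorff_pre k \<epsilon> A \<le> hausdorff_pre k \<epsilon> B"
  unfolding hausdorff_pre_def by (intro INF_superset_mono) auto

lemma hausdorff_pre_antimono: "\<epsilon> \<le> \<epsilon>' \<Longrightarrow> hausdorff_pre k \<epsilon>' A \<le> hausdorff_pre k \<epsilon> A"
  unfolding hausdorff_pre_def by (intro INF_superset_mono) (auto intro: order_trans)

lemma hausdorff_pre_empty: "\<epsilon> > 0 \<Longrightarrow> hausdorff_pre k \<epsilon> {} = 0"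
  using hausdorff_pre_le[of "{}" "\<lambda>_. {}" \<epsilon> k] by simp

lemma hausdorff_pre_UN_le:
  fixes A :: "nat \<Rightarrow> 'a::metric_space set"
  shows "hausdorff_pre k \<epsilon> (\<Union>n. A n) \<le> (\<Sum>n. hausdorff_pre k \<epsilon> (A n))"
proof (rule ennreal_le_epsilon)
  fix e :: real assume e: "e > 0" and fin: "(\<Sum>n. hausdorff_pre k \<epsilon> (A n)) < top"
  have "\<exists>C. A n \<subseteq> (\<Union>i. C i) \<and> (\<forall>i. bounded (C i) \<and> diameter (C i) \<le> \<epsilon>) \<and>
      (\<Sum>i. hausdorff_size k (C i)) \<le> hausdorff_pre k \<epsilon> (A n) + ennreal (e * (1/2) ^ Suc n)" for n
  proof -
    have "hausdorff_pre k \<epsilon> (A n) \<noteq> \<infinity>"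
      using fin ennreal_suminf_lessD[of "\<lambda>n. hausdorff_pre k \<epsilon> (A n)" top n] by auto
    from INF_approx_ennreal[OF _ _ this, of "e * (1/2) ^ Suc n", OF _ hausdorff_pre_def] e
    show ?thesis by (auto intro: less_imp_le)
  qed
  then obtain C where C: "\<And>n. A n \<subseteq> (\<Union>i. C n i)" "\<And>n i. bounded (C n i)"
      "\<And>n i. diameter (C n i) \<le> \<epsilon>"
      "\<And>n. (\<Sum>i. hausdorff_size k (C n i)) \<le> hausdorff_pre k \<epsilon> (A n) + ennreal (e * (1/2) ^ Suc n)"
    by metis
  have "hausdorff_pre k \<epsilon> (\<Union>n. A n) \<le>
      (\<Sum>j. hausdorff_size k (case_prod C (prod_decode j)))"
  proof (rule hausdorff_pre_le)
    show "(\<Union>n. A n) \<subseteq> (\<Union>j. case_prod C (prod_decode j))"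
    proof
      fix x assume "x \<in> (\<Union>n. A n)"
      then obtain n i where "x \<in> C n i" using C(1) by blast
      then have "x \<in> case_prod C (prod_decode (prod_encode (n, i)))" by simp
      then show "x \<in> (\<Union>j. case_prod C (prod_decode j))" by (rule UN_I[OF UNIV_I])
    qed
  qed (simp_all add: case_prod_beta C)
  also have "\<dots> = (\<Sum>n. \<Sum>i. hausdorff_size k (C n i))"
    by (rule suminf_ennreal_2dimen[of _ "\<lambda>x. hausdorff_size k (case_prod C x)"]) auto
  also have "\<dots> \<le> (\<Sum>n. hausdorff_pre k \<epsilon> (A n) + ennreal (e * (1/2) ^ Suc n))"
    by (rule suminf_le) (rule C(4), auto)
  also have "\<dots> = (\<Sum>n. hausdorff_pre k \<epsilon> (A n)) + (\<Sum>n. ennreal e * ennreal ((1/2) ^ Suc n))"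
    using e by (subst suminf_add) (auto simp del: ennreal_suminf_cmult simp add: ennreal_mult[symmetric])
  also have "\<dots> = (\<Sum>n. hausdorff_pre k \<epsilon> (A n)) + e"
    unfolding ennreal_suminf_cmult
    by (subst suminf_ennreal_eq[OF zero_le_power power_half_series]) auto
  finally show "hausdorff_pre k \<epsilon> (\<Union>n. A n) \<le> (\<Sum>n. hausdorff_pre k \<epsilon> (A n)) + e" .
qed

text \<open>
  A set of diameter less than the distance of \<open>A\<close> and \<open>B\<close> meets at most one of them, so every
  fine cover of the union splits into a cover of \<open>A\<close> and a cover of \<open>B\<close>.
\<close>

lemma hausdorff_pre_separated:
  assumes sep: "\<And>a b. a \<in> A \<Longrightarrow> b \<in> B \<Longrightarrow> d \<le> dist a b" and \<epsilon>: "0 < \<epsilon>" "\<epsilon> < d"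
  shows "hausdorff_pre k \<epsilon> A + hausdorff_pre k \<epsilon> B \<le> hausdorff_pre k \<epsilon> (A \<union> B)"
  unfolding hausdorff_pre_def[of k \<epsilon> "A \<union> B"]
proof (rule INF_greatest)
  fix C :: "nat \<Rightarrow> 'a set"
  assume "C \<in> {C. A \<union> B \<subseteq> (\<Union>i. C i) \<and> (\<forall>i. bounded (C i) \<and> diameter (C i) \<le> \<epsilon>)}"
  then have C: "A \<union> B \<subseteq> (\<Union>i. C i)" "\<And>i. bounded (C i)" "\<And>i. diameter (C i) \<le> \<epsilon>" by auto
  define CA where "CA i = (if C i \<inter> A = {} then {} else C i)" for i
  define CB where "CB i = (if C i \<inter> B = {} then {} else C i)" for i
  have "A \<subseteq> (\<Union>i. CA i)" "B \<subseteq> (\<Union>i. CB i)"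
    unfolding CA_def CB_def using C(1) by fastforce+
  note cov = this
  have "hausdorff_pre k \<epsilon> A \<le> (\<Sum>i. hausdorff_size k (CA i))"
    using C(2,3) \<epsilon> cov(1) by (intro hausdorff_pre_le) (auto simp: CA_def)
  moreover have "hausdorff_pre k \<epsilon> B \<le> (\<Sum>i. hausdorff_size k (CB i))"
    using C(2,3) \<epsilon> cov(2) by (intro hausdorff_pre_le) (auto simp: CB_def)
  ultimately have "hausdorff_pre k \<epsilon> A + hausdorff_pre k \<epsilon> B
      \<le> (\<Sum>i. hausdorff_size k (CA i)) + (\<Sum>i. hausdorff_size k (CB i))"
    by (rule add_mono)
  also have "\<dots> = (\<Sum>i. hausdorff_size k (CA i) + hausdorff_size k (CB i))"
    by (rule suminf_add) auto
  also have "\<dots> \<le> (\<Sum>i. hausdorff_size k (C i))"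
  proof (intro suminf_le)
    fix i
    have "C i \<inter> A = {} \<or> C i \<inter> B = {}"
    proof (rule ccontr)
      assume "\<not> ?thesis"
      then obtain a b where "a \<in> C i" "b \<in> C i" "d \<le> dist a b" using sep by blast
      then show False using diameter_bounded_bound[OF C(2)[of i], of a b] C(3)[of i] \<epsilon> by simp
    qed
    then show "hausdorff_size k (CA i) + hausdorff_size k (CB i) \<le> hausdorff_size k (C i)"
      by (auto simp: CA_def CB_def)
  qed auto
  finally show "hausdorff_pre k \<epsilon> A + hausdorff_pre k \<epsilon> B \<le> (\<Sum>i. hausdorff_size k (C i))" .
qed

lemma hausdorff_outer_measure_space:
  "outer_measure_space UNIV (\<lambda>A::'a::metric_space set. SUP \<epsilon>\<in>{0<..}. hausdorff_pre k \<epsilon> A)"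
  unfolding outer_measure_space_def
proof (intro conjI)
  show "positive UNIV (\<lambda>A::'a set. SUP \<epsilon>\<in>{0<..}. hausdorff_pre k \<epsilon> A)"
    by (auto simp: positive_def hausdorff_pre_empty)
  show "increasing UNIV (\<lambda>A::'a set. SUP \<epsilon>\<in>{0<..}. hausdorff_pre k \<epsilon> A)"
    by (auto simp: increasing_def intro!: SUP_mono hausdorff_pre_mono)
  show "countably_subadditive UNIV (\<lambda>A::'a set. SUP \<epsilon>\<in>{0<..}. hausdorff_pre k \<epsilon> A)"
    unfolding countably_subadditive_def
    by (auto intro!: SUP_least order_trans[OF hausdorff_pre_UN_le] suminf_le SUP_upper)
qed

lemma hausdorff_metric_additive:
  fixes A B :: "'a::metric_space set"
  assumes "d > 0" "\<And>a b. a \<in> A \<Longrightarrow> b \<in> B \<Longrightarrow> d \<le> dist a b"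
  shows "(SUP \<epsilon>\<in>{0<..}. hausdorff_pre k \<epsilon> A) + (SUP \<epsilon>\<in>{0<..}. hausdorff_pre k \<epsilon> B)
    \<le> (SUP \<epsilon>\<in>{0<..}. hausdorff_pre k \<epsilon> (A \<union> B))"
proof -
  have "(SUP \<epsilon>\<in>{0<..}. hausdorff_pre k \<epsilon> A) + (SUP \<epsilon>\<in>{0<..}. hausdorff_pre k \<epsilon> B)
      = (SUP \<epsilon>\<in>{0<..}. hausdorff_pre k \<epsilon> A + hausdorff_pre k \<epsilon> B)"
  proof (rule SUP_add_directed_ennreal[symmetric])
    fix i j :: real assume "i \<in> {0<..}" "j \<in> {0<..}"
    then show "\<exists>l\<in>{0<..}. hausdorff_pre k i A + hausdorff_pre k j B
        \<le> hausdorff_pre k l A + hausdorff_pre k l B"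
      by (intro bexI[of _ "min i j"] add_mono hausdorff_pre_antimono) auto
  qed
  also have "\<dots> \<le> (SUP \<epsilon>\<in>{0<..}. hausdorff_pre k \<epsilon> (A \<union> B))"
  proof (rule SUP_mono)
    fix \<epsilon> :: real assume \<epsilon>: "\<epsilon> \<in> {0<..}"
    define \<eta> where "\<eta> = min \<epsilon> (d / 2)"
    have \<eta>: "0 < \<eta>" "\<eta> < d" "\<eta> \<le> \<epsilon>" using \<epsilon> assms(1) by (auto simp: \<eta>_def)
    have "hausdorff_pre k \<epsilon> A + hausdorff_pre k \<epsilon> B \<le> hausdorff_pre k \<eta> A + hausdorff_pre k \<eta> B"
      using \<eta> by (intro add_mono hausdorff_pre_antimono)
    also have "\<dots> \<le> hausdorff_pre k \<eta> (A \<union> B)"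
      using assms(2) \<eta> by (intro hausdorff_pre_separated)
    finally show "\<exists>\<eta>\<in>{0<..}. hausdorff_pre k \<epsilon> A + hausdorff_pre k \<epsilon> B \<le> hausdorff_pre k \<eta> (A \<union> B)"
      using \<eta> by auto
  qed
  finally show ?thesis .
qed

text \<open>
  The value of \<^const>\<open>measure_of\<close> is only meaningful once its argument is countably
  additive on the Borel sets, which is what the Caratheodory construction provides.
\<close>

lemma emeasure_hausdorff_measure:
  fixes A :: "'a::metric_space set"
  assumes A: "A \<in> sets borel"
  shows "emeasure (hausdorff_measure k) A = (SUP \<epsilon>\<in>{0<..}. hausdorff_pre k \<epsilon> A)"
proof -
  let ?\<mu> = "\<lambda>A::'a set. SUP \<epsilon>\<in>{0<..}. hausdorff_pre k \<epsilon> A"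
  let ?L = "lambda_system UNIV UNIV ?\<mu>"
  interpret sa: sigma_algebra UNIV "UNIV :: 'a set set"
    using sigma_algebra_Pow[of "UNIV :: 'a set"] by simp
  have L: "measure_space UNIV ?L ?\<mu>"
    by (rule sa.caratheodory_lemma[OF hausdorff_outer_measure_space])
  then have sL: "sigma_algebra UNIV ?L" by (simp add: measure_space_def)
  have "Collect closed \<subseteq> ?L"
    by (auto intro!: closed_in_lambda_system_metric hausdorff_outer_measure_space hausdorff_metric_additive)
  then have "sigma_sets UNIV (Collect closed) \<subseteq> ?L"
    using sigma_algebra.sigma_sets_subset[OF sL] by blast
  then have sub: "sets (borel :: 'a measure) \<subseteq> ?L"
    by (simp add: borel_eq_closed)
  have "sigma_algebra UNIV (sets (borel :: 'a measure))"
    using sets.sigma_algebra_axioms[of "borel :: 'a measure"] by simp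
  then have "measure_space UNIV (sets (borel :: 'a measure)) ?\<mu>"
    using measure_down[OF L _ sub] by blast
  then show ?thesis
    unfolding hausdorff_measure_def using A
    by (intro emeasure_measure_of_sigma) (auto simp: measure_space_def)
qed

lemma space_hausdorff_measure [simp]: "space (hausdorff_measure k) = UNIV"
  by (simp add: hausdorff_measure_def)

lemma sets_hausdorff_measure [simp, measurable_cong]: "sets (hausdorff_measure k) = sets borel"
  unfolding hausdorff_measure_def
  by (metis sets.space_closed sets_measure_of sets.sigma_sets_eq space_borel)


lemma frontier_meets_parallel_line:
  fixes \<Omega> :: "(real^'n) set"
  assumes bnd: "bounded \<Omega>" and x: "x \<in> \<Omega>"
  shows "\<exists>y\<in>frontier \<Omega>. \<forall>j. j \<noteq> k \<longrightarrow> y $ j = x $ j"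
proof -
  obtain R where R: "\<And>y. y \<in> \<Omega> \<Longrightarrow> norm y \<le> R" using bnd by (auto simp: bounded_iff)
  define e :: "real^'n" where "e = axis k 1"
  define T where "T = R + norm x + 1"
  define S where "S = closed_segment x (x + T *\<^sub>R e)"
  have "R \<ge> 0" using R[OF x] norm_ge_zero[of x] by linarith
  then have "norm (T *\<^sub>R e) = T" by (simp add: e_def T_def)
  then have "norm (x + T *\<^sub>R e) > R"
    using norm_triangle_ineq4[of "x + T *\<^sub>R e" x] by (simp add: T_def)
  then have "x + T *\<^sub>R e \<in> S - \<Omega>" using R by (force simp: S_def)
  moreover have "x \<in> S \<inter> \<Omega>" using x by (simp add: S_def)
  ultimately have "S \<inter> frontier \<Omega> \<noteq> {}"
    by (intro connected_Int_frontier) (auto simp: S_def)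
  then obtain y where y: "y \<in> S" "y \<in> frontier \<Omega>" by blast
  then obtain s where "y = (1 - s) *\<^sub>R x + s *\<^sub>R (x + T *\<^sub>R e)"
    by (auto simp: S_def closed_segment_def)
  then have "\<forall>j. j \<noteq> k \<longrightarrow> y $ j = x $ j"
    by (simp add: e_def axis_def algebra_simps)
  then show ?thesis using y by blast
qed

text \<open>
  Every line through a point of the bounded set \<open>\<Omega>\<close> in a fixed coordinate direction hits the
  boundary. So if the sets \<open>C i\<close> cover the boundary, the boxes with base of half-width
  \<open>diameter (C i)\<close> around a point of \<open>C i\<close> and with height \<open>2 * R\<close> in that direction
  cover \<open>\<Omega>\<close>, and the volume of each box is a constant multiple of the size of \<open>C i\<close>.
\<close>

lemma emeasure_le_hausdorff_pre_frontier:
  fixes \<Omega> :: "(real^'n) set"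
  assumes opn: "open \<Omega>" and R: "R > 0" "\<And>x. x \<in> \<Omega> \<Longrightarrow> norm x \<le> R"
  shows "emeasure lborel \<Omega> \<le>
    ennreal (2 * R * 4 ^ (CARD('n) - 1) / unit_ball_vol (real (CARD('n) - 1)))
      * hausdorff_pre (CARD('n) - 1) \<epsilon> (frontier \<Omega>)"
proof -
  define d where "d = CARD('n) - 1"
  define c where "c = 2 * R * 4 ^ d / unit_ball_vol (real d)"
  have ubv: "unit_ball_vol (real d) > 0" by simp
  have c: "c > 0" using R(1) ubv by (simp add: c_def)
  obtain k :: 'n where True by blast
  have bnd: "bounded \<Omega>" using R(2) by (auto simp: bounded_iff)
  have "emeasure lborel \<Omega> / ennreal c \<le> hausdorff_pre d \<epsilon> (frontier \<Omega>)"
    unfolding hausdorff_pre_def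
  proof (rule INF_greatest)
    fix C :: "nat \<Rightarrow> (real^'n) set"
    assume "C \<in> {C. frontier \<Omega> \<subseteq> (\<Union>i. C i) \<and> (\<forall>i. bounded (C i) \<and> diameter (C i) \<le> \<epsilon>)}"
    then have C: "frontier \<Omega> \<subseteq> (\<Union>i. C i)" "\<And>i. bounded (C i)" by auto
    define p where "p i = (SOME x. x \<in> C i)" for i
    define D where "D i = diameter (C i)" for i
    define lo :: "nat \<Rightarrow> real^'n" where "lo i = (\<chi> j. if j = k then - R else p i $ j - D i)" for i
    define hi :: "nat \<Rightarrow> real^'n" where "hi i = (\<chi> j. if j = k then R else p i $ j + D i)" for i
    define B where "B i = (if C i = {} then {} else cbox (lo i) (hi i))" for i
    have D: "D i \<ge> 0" for i using C(2) by (simp add: D_def diameter_ge_0)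
    have cover: "\<Omega> \<subseteq> (\<Union>i. B i)"
    proof
      fix x assume x: "x \<in> \<Omega>"
      obtain y where y: "y \<in> frontier \<Omega>" "\<And>j. j \<noteq> k \<Longrightarrow> y $ j = x $ j"
        using frontier_meets_parallel_line[OF bnd x, of k] by blast
      then obtain i where i: "y \<in> C i" using C(1) by blast
      then have p: "p i \<in> C i" unfolding p_def by (rule someI)
      have "\<bar>x $ j - p i $ j\<bar> \<le> D i" if "j \<noteq> k" for j
      proof -
        have "\<bar>x $ j - p i $ j\<bar> = \<bar>(y - p i) $ j\<bar>" using y(2)[OF that] by simp
        also have "\<dots> \<le> norm (y - p i)" by (rule component_le_norm_cart)
        also have "\<dots> \<le> D i"
          using diameter_bounded_bound[OF C(2) i p] by (simp add: D_def dist_norm)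
        finally show ?thesis .
      qed
      moreover have "\<bar>x $ k\<bar> \<le> R"
        using component_le_norm_cart[of x k] R(2)[OF x] by linarith
      ultimately have "lo i $ j \<le> x $ j \<and> x $ j \<le> hi i $ j" for j
        by (cases "j = k") (auto simp: lo_def hi_def abs_le_iff algebra_simps dest: spec[of _ j])
      then have "x \<in> cbox (lo i) (hi i)" by (simp add: mem_box_cart)
      then show "x \<in> (\<Union>i. B i)" using i by (auto simp: B_def)
    qed
    have size: "emeasure lborel (B i) = ennreal c * hausdorff_size d (C i)" for i
    proof (cases "C i = {}")
      case True
      then show ?thesis by (simp add: B_def)
    next
      case False
      have ne: "cbox (lo i) (hi i) \<noteq> {}"
        using R(1) D[of i] by (auto simp: interval_ne_empty_cart lo_def hi_def)
      have "emeasure lborel (B i) = ennreal (measure lborel (cbox (lo i) (hi i)))"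
        using False emeasure_lborel_cbox_finite[of "lo i" "hi i"]
        by (simp add: B_def emeasure_eq_ennreal_measure less_top)
      also have "measure lborel (cbox (lo i) (hi i)) = (\<Prod>j\<in>UNIV. hi i $ j - lo i $ j)"
        using ne by (rule content_cbox_cart)
      also have "\<dots> = (hi i $ k - lo i $ k) * (\<Prod>j\<in>UNIV - {k}. hi i $ j - lo i $ j)"
        by (rule prod.remove) auto
      also have "(\<Prod>j\<in>UNIV - {k}. hi i $ j - lo i $ j) = (\<Prod>j\<in>UNIV - {k}. 2 * D i)"
        by (rule prod.cong) (auto simp: lo_def hi_def)
      also have "\<dots> = (2 * D i) ^ d" by (simp add: d_def card_Diff_singleton)
      also have "hi i $ k - lo i $ k = 2 * R" by (simp add: lo_def hi_def)
      also have "2 * R * (2 * D i) ^ d = c * (unit_ball_vol (real d) * (D i / 2) ^ d)"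
      proof -
        have "(2 * D i) ^ d = 4 ^ d * (D i / 2) ^ d"
          by (subst power_mult_distrib[symmetric]) simp
        then show ?thesis using ubv less_imp_neq[OF ubv] by (simp add: c_def)
      qed
      also have "ennreal \<dots> = ennreal c * hausdorff_size d (C i)"
        using False c D[of i] ubv by (simp add: hausdorff_size_def D_def ennreal_mult)
      finally show ?thesis .
    qed
    have "emeasure lborel \<Omega> \<le> emeasure lborel (\<Union>i. B i)"
      by (rule emeasure_mono[OF cover]) (auto simp: B_def)
    also have "\<dots> \<le> (\<Sum>i. emeasure lborel (B i))"
      by (rule emeasure_subadditive_countably) (auto simp: B_def)
    also have "\<dots> = ennreal c * (\<Sum>i. hausdorff_size d (C i))"
      by (simp add: size)
    finally show "emeasure lborel \<Omega> / ennreal c \<le> (\<Sum>i. hausdorff_size d (C i))"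
      using c by (subst divide_le_posI_ennreal) (auto simp: mult.commute)
  qed
  then have "ennreal c * (emeasure lborel \<Omega> / ennreal c) \<le> ennreal c * hausdorff_pre d \<epsilon> (frontier \<Omega>)"
    by (rule mult_left_mono) simp
  also have "ennreal c * (emeasure lborel \<Omega> / ennreal c) = emeasure lborel \<Omega>"
    using c by (simp add: ennreal_times_divide mult_divide_eq_ennreal mult.commute[of "ennreal c"])
  finally show ?thesis by (simp add: c_def d_def)
qed

lemma surface_measure_positive:
  fixes \<Omega> :: "(real^'n) set"
  assumes opn: "open \<Omega>" and bnd: "bounded \<Omega>" and ne: "\<Omega> \<noteq> {}"
  shows "emeasure (surface_measure \<Omega>) (frontier \<Omega>) > 0"
proof -
  obtain R where R: "R > 0" "\<And>x. x \<in> \<Omega> \<Longrightarrow> norm x \<le> R"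
    using bnd by (auto simp: bounded_pos)
  have "\<Omega> \<notin> null_sets lborel"
    using open_not_negligible[OF opn ne] opn by (simp add: negligible_iff_null_sets null_sets_completion_iff)
  then have pos: "emeasure lborel \<Omega> \<noteq> 0"
    using opn by (auto simp: null_sets_def)
  have "hausdorff_pre (CARD('n) - 1) 1 (frontier \<Omega>) \<noteq> 0"
    using emeasure_le_hausdorff_pre_frontier[OF opn R, of 1] pos by auto
  moreover have "hausdorff_pre (CARD('n) - 1) 1 (frontier \<Omega>) \<le> emeasure (surface_measure \<Omega>) (frontier \<Omega>)"
    by (simp add: surface_measure_def emeasure_restrict_space emeasure_hausdorff_measure)
      (rule SUP_upper, simp)
  ultimately show ?thesis by (metis not_gr_zero le_zero_eq)
qed

lemma space_surface_measure [simp]: "space (surface_measure \<Omega>) = frontier \<Omega>"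
  by (simp add: surface_measure_def space_restrict_space)

section \<open>Lebesgue spaces\<close>

lemma integrable_mult_bounded:
  fixes f g :: "'a \<Rightarrow> real"
  assumes f: "integrable M f" and g: "g \<in> borel_measurable M" and b: "AE x in M. \<bar>g x\<bar> \<le> C"
  shows "integrable M (\<lambda>x. f x * g x)"
proof (rule Bochner_Integration.integrable_bound)
  show "integrable M (\<lambda>x. C * f x)" using f by simp
  show "(\<lambda>x. f x * g x) \<in> borel_measurable M" using f g by (auto dest: borel_measurable_integrable)
  show "AE x in M. norm (f x * g x) \<le> norm (C * f x)"
    using b
  proof eventually_elim
    case (elim x)
    then have "\<bar>f x\<bar> * \<bar>g x\<bar> \<le> \<bar>f x\<bar> * \<bar>C\<bar>" by (intro mult_left_mono) auto
    then show ?case by (simp add: abs_mult mult.commute)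
  qed
qed

lemma L2_integrable:
  fixes f :: "'a \<Rightarrow> 'b::euclidean_space"
  assumes "finite_measure M" and f: "f \<in> L2 M"
  shows "integrable M f"
proof (rule Bochner_Integration.integrable_bound)
  interpret finite_measure M by fact
  show "integrable M (\<lambda>x. 1 + (norm (f x))\<^sup>2)" using f by (auto simp: L2_def)
  show "f \<in> borel_measurable M" using f by (simp add: L2_def)
  have "norm (f x) \<le> 1 + (norm (f x))\<^sup>2" for x
  proof -
    have "0 \<le> (norm (f x) - 1)\<^sup>2 + norm (f x)" by simp
    then show ?thesis by (simp add: power2_diff)
  qed
  then show "AE x in M. norm (f x) \<le> norm (1 + (norm (f x))\<^sup>2)" by simp
qed

text \<open>
  This follows from \<open>norm (u + v) ^ 2 \<le> 2 * norm u ^ 2 + 2 * norm v ^ 2\<close>.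
\<close>

lemma L2_lincomb:
  fixes f g :: "'a \<Rightarrow> 'b::euclidean_space"
  assumes f: "f \<in> L2 M" and g: "g \<in> L2 M"
  shows "(\<lambda>x. a *\<^sub>R f x + b *\<^sub>R g x) \<in> L2 M"
proof -
  have m: "(\<lambda>x. a *\<^sub>R f x + b *\<^sub>R g x) \<in> borel_measurable M" using f g by (auto simp: L2_def)
  have "integrable M (\<lambda>x. (norm (a *\<^sub>R f x + b *\<^sub>R g x))\<^sup>2)"
  proof (rule Bochner_Integration.integrable_bound)
    show "integrable M (\<lambda>x. 2 * a\<^sup>2 * (norm (f x))\<^sup>2 + 2 * b\<^sup>2 * (norm (g x))\<^sup>2)"
      using f g by (auto simp: L2_def)
    show "(\<lambda>x. (norm (a *\<^sub>R f x + b *\<^sub>R g x))\<^sup>2) \<in> borel_measurable M" using m by simp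
    have "(norm (a *\<^sub>R f x + b *\<^sub>R g x))\<^sup>2 \<le> 2 * a\<^sup>2 * (norm (f x))\<^sup>2 + 2 * b\<^sup>2 * (norm (g x))\<^sup>2" for x
    proof -
      have "norm (a *\<^sub>R f x + b *\<^sub>R g x) \<le> norm (a *\<^sub>R f x) + norm (b *\<^sub>R g x)" by (rule norm_triangle_ineq)
      then have "(norm (a *\<^sub>R f x + b *\<^sub>R g x))\<^sup>2 \<le> (norm (a *\<^sub>R f x) + norm (b *\<^sub>R g x))\<^sup>2"
        by (intro power_mono) auto
      also have "\<dots> \<le> 2 * (norm (a *\<^sub>R f x))\<^sup>2 + 2 * (norm (b *\<^sub>R g x))\<^sup>2"
        using sum_squares_bound[of "norm (a *\<^sub>R f x)" "norm (b *\<^sub>R g x)"] by (simp add: power2_sum)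
      finally show ?thesis by (simp add: power_mult_distrib)
    qed
    then show "AE x in M. norm ((norm (a *\<^sub>R f x + b *\<^sub>R g x))\<^sup>2)
        \<le> norm (2 * a\<^sup>2 * (norm (f x))\<^sup>2 + 2 * b\<^sup>2 * (norm (g x))\<^sup>2)"
      by simp
  qed
  with m show ?thesis by (simp add: L2_def)
qed

lemma L2_bounded:
  fixes f :: "'a \<Rightarrow> 'b::euclidean_space"
  assumes "finite_measure M" and "f \<in> borel_measurable M" and "AE x in M. norm (f x) \<le> C"
  shows "f \<in> L2 M"
proof -
  interpret finite_measure M by fact
  have "AE x in M. norm ((norm (f x))\<^sup>2) \<le> C\<^sup>2"
    using assms(3) by eventually_elim (auto intro!: power_mono)
  with assms(2) show ?thesis
    by (auto simp: L2_def intro!: integrable_const_bound)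
qed

lemma borel_measurable_component:
  fixes G :: "'a \<Rightarrow> real^'m"
  assumes "G \<in> borel_measurable M" shows "(\<lambda>x. G x $ i) \<in> borel_measurable M"
proof -
  have "(\<lambda>v::real^'m. v $ i) \<in> borel_measurable borel"
    by (intro borel_measurable_continuous_onI continuous_intros)
  then show ?thesis using assms by (rule measurable_compose[rotated])
qed

lemma finite_measure_lebesgue_on:
  assumes "bounded (D :: (real^'n) set)" "D \<in> sets lebesgue"
  shows "finite_measure (lebesgue_on D)"
proof -
  have "D \<in> lmeasurable" using assms bounded_set_imp_lmeasurable by blast
  then show ?thesis
    by (intro finite_measureI) (auto simp: emeasure_restrict_space space_restrict_space fmeasurable_def)
qed

lemma open_sets_lebesgue: "open (U :: (real^'n) set) \<Longrightarrow> U \<in> sets lebesgue"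
  by (auto intro: sets_completionI_sets)

section \<open>Uniqueness of weak gradients\<close>

lemma DERIV_max_0_square: "DERIV (\<lambda>t::real. (max 0 t)\<^sup>2) t :> 2 * max 0 t"
proof -
  consider "t < 0" | "t > 0" | "t = 0" by linarith
  then show ?thesis
  proof cases
    case 1
    have "DERIV (\<lambda>t::real. 0) t :> 2 * max 0 t" using 1 by simp
    then show ?thesis
      by (rule has_field_derivative_transform_within_open[where S = "{..<0}"]) (use 1 in auto)
  next
    case 2
    have "DERIV (\<lambda>t::real. t\<^sup>2) t :> 2 * max 0 t" using 2 by (auto intro!: derivative_eq_intros)
    then show ?thesis
      by (rule has_field_derivative_transform_within_open[where S = "{0<..}"]) (use 2 in auto)
  next
    case 3
    have "((\<lambda>y::real. ((max 0 y)\<^sup>2 - 0) / (y - 0)) \<longlongrightarrow> 0) (at 0)"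
    proof (rule Lim_null_comparison)
      show "\<forall>\<^sub>F y::real in at 0. norm (((max 0 y)\<^sup>2 - 0) / (y - 0)) \<le> \<bar>y\<bar>"
        by (rule always_eventually) (auto simp: max_def power2_eq_square)
      show "((\<lambda>y::real. \<bar>y\<bar>) \<longlongrightarrow> 0) (at 0)" by (intro tendsto_eq_intros) auto
    qed
    with 3 show ?thesis by (simp add: has_field_derivative_iff)
  qed
qed

text \<open>
  A continuously differentiable function that is positive exactly on the ball of radius \<open>r\<close> around
  \<open>c\<close>; squaring the positive part removes the kink at the sphere.
\<close>

definition bump :: "'a::real_inner \<Rightarrow> real \<Rightarrow> 'a \<Rightarrow> real" where
  "bump c r x = (max 0 (r\<^sup>2 - (x - c) \<bullet> (x - c)))\<^sup>2"

definition bump_grad :: "'a::real_inner \<Rightarrow> real \<Rightarrow> 'a \<Rightarrow> 'a" where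
  "bump_grad c r x = (2 * max 0 (r\<^sup>2 - (x - c) \<bullet> (x - c))) *\<^sub>R ((- 2) *\<^sub>R (x - c))"

lemma GDERIV_bump: "GDERIV (bump c r) x :> bump_grad c r x"
proof -
  have "GDERIV (\<lambda>x. r\<^sup>2 - (x - c) \<bullet> (x - c)) x :> (- 2) *\<^sub>R (x - c)"
    unfolding gderiv_def
    by (auto intro!: derivative_eq_intros simp: inner_commute algebra_simps)
  from GDERIV_DERIV_compose[OF this DERIV_max_0_square] show ?thesis
    unfolding bump_def[abs_def] bump_grad_def .
qed

lemma continuous_bump_grad [continuous_intros]: "continuous_on S (bump_grad c r)"
  unfolding bump_grad_def[abs_def] by (intro continuous_intros)

lemma bump_nonneg: "bump c r x \<ge> 0"
  by (simp add: bump_def)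

lemma bump_pos_iff: "r \<ge> 0 \<Longrightarrow> bump c r x > 0 \<longleftrightarrow> x \<in> ball c r"
proof -
  assume r: "r \<ge> 0"
  have "bump c r x > 0 \<longleftrightarrow> (norm (x - c))\<^sup>2 < r\<^sup>2"
    by (auto simp: bump_def power2_norm_eq_inner max_def)
  also have "\<dots> \<longleftrightarrow> norm (x - c) < r"
    using r by (metis norm_ge_zero pos2 power_less_imp_less_base power_strict_mono)
  finally show ?thesis by (simp add: dist_norm norm_minus_commute)
qed

text \<open>
  As \<open>n\<close> grows, these test functions increase to the indicator of the union of the balls.
\<close>

lemma test_function_bumps:
  fixes c :: "nat \<Rightarrow> real^'n" and m :: nat
  assumes r: "\<And>k. k < m \<Longrightarrow> r k \<ge> 0 \<and> cball (c k) (r k) \<subseteq> \<Omega>" and n: "n \<ge> (0::real)"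
  defines "P \<equiv> \<lambda>x. \<Sum>k<m. bump (c k) (r k) x"
  shows "\<exists>D. test_function \<Omega> (\<lambda>x. n * P x / (1 + n * P x)) D"
proof -
  define DP where "DP x = (\<Sum>k<m. bump_grad (c k) (r k) x)" for x
  have P0: "P x \<ge> 0" for x by (auto simp: P_def bump_nonneg intro!: sum_nonneg)
  have GP: "GDERIV P x :> DP x" for x
    unfolding P_def DP_def gderiv_def inner_sum_right
    by (rule has_derivative_sum) (rule GDERIV_bump[unfolded gderiv_def])
  have contP: "continuous_on UNIV P"
    using GP by (metis gderiv_def has_derivative_continuous continuous_at_imp_continuous_on)
  have pos: "1 + n * P x > 0" for x
    using P0[of x] n by (simp add: add_pos_nonneg)
  show ?thesis
  proof (intro exI, unfold test_function_def, intro conjI allI exI)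
    fix x
    have "DERIV (\<lambda>s. n * s / (1 + n * s)) (P x) :> n / (1 + n * P x)\<^sup>2"
      using pos[of x] by (auto intro!: derivative_eq_intros simp: power2_eq_square field_simps)
    from GDERIV_DERIV_compose[OF GP this]
    show "GDERIV (\<lambda>x. n * P x / (1 + n * P x)) x :> (n / (1 + n * P x)\<^sup>2) *\<^sub>R DP x" .
  next
    show "continuous_on UNIV (\<lambda>x. (n / (1 + n * P x)\<^sup>2) *\<^sub>R DP x)"
      unfolding DP_def using pos by (intro continuous_intros contP) (auto simp: less_imp_neq[symmetric])
  next
    show "compact (\<Union>k<m. cball (c k) (r k))" by (intro compact_UN) auto
    show "(\<Union>k<m. cball (c k) (r k)) \<subseteq> \<Omega>" using r by blast
    fix x show "x \<notin> (\<Union>k<m. cball (c k) (r k)) \<longrightarrow> n * P x / (1 + n * P x) = 0"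
    proof
      assume x: "x \<notin> (\<Union>k<m. cball (c k) (r k))"
      have "bump (c k) (r k) x = 0" if "k < m" for k
        using x that r[OF that] bump_pos_iff[of "r k" "c k" x] bump_nonneg[of "c k" "r k" x] by force
      then show "n * P x / (1 + n * P x) = 0" by (simp add: P_def)
    qed
  qed
qed

lemma test_function_continuous:
  "test_function \<Omega> \<phi> D\<phi> \<Longrightarrow> continuous_on S \<phi>"
  unfolding test_function_def gderiv_def
  by (metis has_derivative_continuous continuous_at_imp_continuous_on)

lemma test_function_bounded:
  assumes "test_function \<Omega> \<phi> D\<phi>"
  shows "\<exists>C. \<forall>x. \<bar>\<phi> x\<bar> \<le> C"
proof -
  from assms obtain K where K: "compact K" "\<And>x. x \<notin> K \<Longrightarrow> \<phi> x = 0" by (auto simp: test_function_def)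
  have "compact (\<phi> ` K)" using K(1) test_function_continuous[OF assms] by (rule compact_continuous_image[rotated])
  then have "bounded (\<phi> ` K)" by (rule compact_imp_bounded)
  then obtain C where "\<forall>y\<in>\<phi> ` K. norm y \<le> C" unfolding bounded_iff ..
  then have C: "\<And>x. x \<in> K \<Longrightarrow> \<bar>\<phi> x\<bar> \<le> C" by simp
  have "\<bar>\<phi> x\<bar> \<le> max C 0" for x using C[of x] K(2)[of x] by (cases "x \<in> K") auto
  then show ?thesis by blast
qed

lemma test_function_grad_bounded:
  assumes "test_function \<Omega> \<phi> D\<phi>"
  shows "\<exists>C. \<forall>x. norm (D\<phi> x) \<le> C"
proof -
  from assms obtain K where K: "compact K" "\<And>x. x \<notin> K \<Longrightarrow> \<phi> x = 0"
    and D: "\<And>x. GDERIV \<phi> x :> D\<phi> x" "continuous_on UNIV D\<phi>" by (auto simp: test_function_def)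
  have "compact (D\<phi> ` K)" using K(1) D(2) by (intro compact_continuous_image) (auto intro: continuous_on_subset)
  then have "bounded (D\<phi> ` K)" by (rule compact_imp_bounded)
  then obtain C where "\<forall>y\<in>D\<phi> ` K. norm y \<le> C" unfolding bounded_iff ..
  then have C: "\<And>x. x \<in> K \<Longrightarrow> norm (D\<phi> x) \<le> C" by simp
  have "D\<phi> x = 0" if x: "x \<notin> K" for x
  proof -
    have "((\<lambda>y. 0::real) has_derivative (\<lambda>h. h \<bullet> 0)) (at x)" by simp
    moreover have "open (- K)" using K(1) by (simp add: compact_imp_closed open_Compl)
    ultimately have "(\<phi> has_derivative (\<lambda>h. h \<bullet> 0)) (at x)"
      by (rule has_derivative_transform_within_open) (use x K(2) in auto)
    from has_derivative_unique[OF this] D(1)[of x] have "(\<lambda>h. h \<bullet> 0) = (\<lambda>h. h \<bullet> D\<phi> x)"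
      by (simp add: gderiv_def)
    then have "D\<phi> x \<bullet> D\<phi> x = 0" by (metis inner_zero_right)
    then show ?thesis by simp
  qed
  then have "norm (D\<phi> x) \<le> max C 0" for x using C[of x] by (cases "x \<in> K") auto
  then show ?thesis by blast
qed

lemma continuous_measurable_lebesgue_on:
  fixes f :: "real^'n \<Rightarrow> 'b::euclidean_space"
  assumes "continuous_on UNIV f"
  shows "f \<in> borel_measurable (lebesgue_on \<Omega>)"
proof -
  have "f \<in> borel_measurable lborel" using borel_measurable_continuous_onI[OF assms] by simp
  then have "f \<in> borel_measurable lebesgue" by (rule measurable_completion)
  then show ?thesis by (rule measurable_restrict_space1)
qed

lemma integral_indicator_limit:
  fixes f :: "real^'n \<Rightarrow> real" and \<theta> :: "nat \<Rightarrow> real^'n \<Rightarrow> real"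
  assumes f: "integrable (lebesgue_on \<Omega>) f" and A: "A \<in> sets lebesgue"
    and meas: "\<And>n. \<theta> n \<in> borel_measurable (lebesgue_on \<Omega>)" and bound: "\<And>n x. 0 \<le> \<theta> n x \<and> \<theta> n x \<le> 1"
    and lim: "\<And>x. (\<lambda>n. \<theta> n x) \<longlonglongrightarrow> indicator A x"
    and zero: "\<And>n. (LINT x|lebesgue_on \<Omega>. f x * \<theta> n x) = 0"
  shows "(LINT x|lebesgue_on \<Omega>. f x * indicator A x) = 0"
proof -
  note fm = borel_measurable_integrable[OF f]
  have "(\<lambda>n. LINT x|lebesgue_on \<Omega>. f x * \<theta> n x) \<longlonglongrightarrow> (LINT x|lebesgue_on \<Omega>. f x * indicator A x)"
  proof (rule integral_dominated_convergence[where w = "\<lambda>x. \<bar>f x\<bar>"])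
    show "(\<lambda>x. f x * indicator A x) \<in> borel_measurable (lebesgue_on \<Omega>)"
      using A by (intro borel_measurable_times fm measurable_restrict_space1 borel_measurable_indicator)
    show "AE x in lebesgue_on \<Omega>. norm (f x * \<theta> n x) \<le> \<bar>f x\<bar>" for n
      using bound by (auto simp: abs_mult intro!: mult_left_le)
  qed (use f in \<open>auto intro!: borel_measurable_times fm meas AE_I2 tendsto_mult lim\<close>)
  then show ?thesis by (simp add: zero LIMSEQ_const_iff)
qed

lemma fundamental_lemma_balls:
  fixes f :: "real^'n \<Rightarrow> real" and m :: nat
  assumes f: "integrable (lebesgue_on \<Omega>) f"
    and zero: "\<And>\<phi> D\<phi>. test_function \<Omega> \<phi> D\<phi> \<Longrightarrow> (LINT x|lebesgue_on \<Omega>. f x * \<phi> x) = 0"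
    and r: "\<And>k. k < m \<Longrightarrow> r k \<ge> 0 \<and> cball (c k) (r k) \<subseteq> \<Omega>"
  shows "(LINT x|lebesgue_on \<Omega>. f x * indicator (\<Union>k<m. ball (c k) (r k)) x) = 0"
proof -
  define P where "P x = (\<Sum>k<m. bump (c k) (r k) x)" for x
  define U where "U = (\<Union>k<m. ball (c k) (r k))"
  define \<phi> where "\<phi> n x = real n * P x / (1 + real n * P x)" for n x
  have P0: "P x \<ge> 0" for x by (auto simp: P_def bump_nonneg intro!: sum_nonneg)
  have Ppos: "P x > 0 \<longleftrightarrow> x \<in> U" for x
  proof -
    have "P x > 0 \<longleftrightarrow> P x \<noteq> 0" using P0[of x] by auto
    also have "\<dots> \<longleftrightarrow> (\<exists>k<m. bump (c k) (r k) x \<noteq> 0)"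
      unfolding P_def by (subst sum_nonneg_eq_0_iff) (auto simp: bump_nonneg)
    also have "\<dots> \<longleftrightarrow> (\<exists>k<m. bump (c k) (r k) x > 0)" using bump_nonneg by (metis less_eq_real_def less_irrefl)
    also have "\<dots> \<longleftrightarrow> (\<exists>k<m. x \<in> ball (c k) (r k))" using r bump_pos_iff by blast
    also have "\<dots> \<longleftrightarrow> x \<in> U" by (auto simp: U_def)
    finally show ?thesis .
  qed
  have tf: "\<exists>D. test_function \<Omega> (\<phi> n) D" for n
    using test_function_bumps[where m = m and r = r and c = c and \<Omega> = \<Omega> and n = "real n"] r
    by (simp add: \<phi>_def[abs_def] P_def)
  have bd: "0 \<le> \<phi> n x" "\<phi> n x \<le> 1" for n x
    using P0[of x] add_pos_nonneg[of 1 "real n * P x"] by (auto simp: \<phi>_def divide_le_eq_1)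
  have "(LINT x|lebesgue_on \<Omega>. f x * indicator U x) = 0"
  proof (rule integral_indicator_limit[OF f])
    show "U \<in> sets lebesgue" by (rule open_sets_lebesgue) (auto simp: U_def)
    fix n
    obtain D where D: "test_function \<Omega> (\<phi> n) D" using tf by blast
    then show "\<phi> n \<in> borel_measurable (lebesgue_on \<Omega>)"
      by (intro continuous_measurable_lebesgue_on test_function_continuous)
    show "(LINT x|lebesgue_on \<Omega>. f x * \<phi> n x) = 0" by (rule zero[OF D])
    show "0 \<le> \<phi> n x \<and> \<phi> n x \<le> 1" for x using bd by blast
  next
    fix x
    show "(\<lambda>n. \<phi> n x) \<longlonglongrightarrow> indicator U x"
    proof (cases "x \<in> U")
      case False
      then have "P x = 0" using Ppos[of x] P0[of x] by auto
      then show ?thesis using False by (simp add: \<phi>_def)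
    next
      case True
      then have p: "P x > 0" by (simp add: Ppos)
      have "(\<lambda>n. 1 - 1 / (1 + real n * P x)) \<longlonglongrightarrow> 1 - 0"
        using p by (intro tendsto_diff tendsto_const tendsto_divide_0[OF tendsto_const] filterlim_at_top_imp_at_infinity
          filterlim_tendsto_add_at_top[OF tendsto_const] filterlim_at_top_mult_tendsto_pos[OF tendsto_const] filterlim_real_sequentially)
      moreover have "1 - 1 / (1 + real n * P x) = \<phi> n x" for n
      proof -
        have "1 + real n * P x > 0" using p by (simp add: add_pos_nonneg)
        then show ?thesis by (simp add: \<phi>_def field_simps)
      qed
      ultimately show ?thesis using True by simp
    qed
  qed
  then show ?thesis by (simp add: U_def)
qed

lemma fundamental_lemma_open:
  fixes f :: "real^'n \<Rightarrow> real"
  assumes f: "integrable (lebesgue_on \<Omega>) f"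
    and zero: "\<And>\<phi> D\<phi>. test_function \<Omega> \<phi> D\<phi> \<Longrightarrow> (LINT x|lebesgue_on \<Omega>. f x * \<phi> x) = 0"
    and U: "open U" "U \<subseteq> \<Omega>"
  shows "(LINT x|lebesgue_on \<Omega>. f x * indicator U x) = 0"
proof (cases "U = {}")
  case True
  then show ?thesis by simp
next
  case False
  define \<F> where "\<F> = {ball c r |c r. r \<ge> 0 \<and> cball c r \<subseteq> U}"
  have op: "\<And>S. S \<in> \<F> \<Longrightarrow> open S" by (auto simp: \<F>_def)
  obtain \<F>' where \<F>': "\<F>' \<subseteq> \<F>" "countable \<F>'" "\<Union>\<F>' = \<Union>\<F>"
    using Lindelof[OF op] by blast
  have UF: "\<Union>\<F> = U"
  proof
    show "\<Union>\<F> \<subseteq> U" unfolding \<F>_def using ball_subset_cball by blast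
    show "U \<subseteq> \<Union>\<F>"
    proof
      fix x assume "x \<in> U"
      then obtain e where "e > 0" "cball x e \<subseteq> U" using U(1) by (auto simp: open_contains_cball)
      then have "\<exists>c r. ball x e = ball c r \<and> r \<ge> 0 \<and> cball c r \<subseteq> U" "x \<in> ball x e"
        by (intro exI[of _ x] exI[of _ e], simp_all)
      then have "ball x e \<in> \<F>" "x \<in> ball x e" by (simp_all add: \<F>_def)
      then show "x \<in> \<Union>\<F>" by blast
    qed
  qed
  then have ne: "\<F>' \<noteq> {}" using False \<F>'(3) by auto
  define A where "A = from_nat_into \<F>'"
  have rA: "range A = \<F>'" using ne \<F>'(2) by (simp add: A_def range_from_nat_into)
  have "\<exists>c r. A k = ball c r \<and> r \<ge> 0 \<and> cball c r \<subseteq> U" for k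
  proof -
    have "A k \<in> \<F>" using rA \<F>'(1) by blast
    then show ?thesis by (auto simp: \<F>_def)
  qed
  then obtain c r where cr: "\<And>k. A k = ball (c k) (r k)" "\<And>k. r k \<ge> 0" "\<And>k. cball (c k) (r k) \<subseteq> U"
    by metis
  have UA: "(\<Union>k. ball (c k) (r k)) = U" using rA UF \<F>'(3) cr(1) by auto
  show ?thesis
  proof (rule integral_indicator_limit[OF f])
    show "U \<in> sets lebesgue" by (rule open_sets_lebesgue[OF U(1)])
    fix n
    have "(\<Union>k<n. ball (c k) (r k)) \<in> sets lebesgue" by (rule open_sets_lebesgue) auto
    then show "indicat_real (\<Union>k<n. ball (c k) (r k)) \<in> borel_measurable (lebesgue_on \<Omega>)"
      by (intro measurable_restrict_space1 borel_measurable_indicator)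
    show "(LINT x|lebesgue_on \<Omega>. f x * indicator (\<Union>k<n. ball (c k) (r k)) x) = 0"
      using cr(2) subset_trans[OF cr(3) U(2)] by (intro fundamental_lemma_balls f zero) auto
  next
    fix x
    show "(\<lambda>n. indicat_real (\<Union>k<n. ball (c k) (r k)) x) \<longlonglongrightarrow> indicator U x"
      unfolding UA[symmetric] by (rule LIMSEQ_indicator_UN)
  qed (auto simp: indicator_def)
qed

text \<open>
  The integral of \<open>f\<close> vanishes over finite unions of balls by approximation with test functions,
  then over open sets, which are countable unions of balls, then over decreasing intersections of open
  sets, and hence over every measurable set, since that differs from such an intersection by a null
  set. Applied to the sets where \<open>f\<close> is positive and negative this gives the claim.
\<close>

lemma fundamental_lemma:
  fixes f :: "real^'n \<Rightarrow> real"
  assumes \<Omega>: "open \<Omega>"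
    and f: "integrable (lebesgue_on \<Omega>) f"
    and zero: "\<And>\<phi> D\<phi>. test_function \<Omega> \<phi> D\<phi> \<Longrightarrow> (LINT x|lebesgue_on \<Omega>. f x * \<phi> x) = 0"
  shows "AE x in lebesgue_on \<Omega>. f x = 0"
proof -
  have \<Omega>s: "\<Omega> \<in> sets lebesgue" using \<Omega> by (auto intro: sets_completionI_sets)
  have fm: "f \<in> borel_measurable (lebesgue_on \<Omega>)" using f by (rule borel_measurable_integrable)
  have set_zero: "(LINT x|lebesgue_on \<Omega>. f x * indicator A x) = 0"
    if A: "A \<in> sets (lebesgue_on \<Omega>)" for A
  proof -
    have A': "A \<in> sets lebesgue" "A \<subseteq> \<Omega>" using A \<Omega>s by (auto simp: sets_restrict_space_iff)
    have "\<exists>T. open T \<and> A \<subseteq> T \<and> T - A \<in> lmeasurable \<and> emeasure lebesgue (T - A) < ennreal (1 / Suc n)" for n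
      using sets_lebesgue_outer_open[OF A'(1), of "1 / Suc n"] by (metis of_nat_0_less_iff zero_less_Suc zero_less_divide_1_iff)
    then obtain T where T: "\<And>n. open (T n)" "\<And>n. A \<subseteq> T n" "\<And>n. T n - A \<in> lmeasurable"
        "\<And>n. emeasure lebesgue (T n - A) < ennreal (1 / Suc n)" by metis
    define V where "V n = \<Omega> \<inter> (\<Inter>i\<le>n. T i)" for n
    define W where "W = \<Omega> \<inter> (\<Inter>i. T i)"
    have Vo: "open (V n)" for n unfolding V_def using \<Omega> T(1) by (intro open_Int open_INT) auto
    have Ws: "W \<in> sets lebesgue" unfolding W_def using \<Omega>s T(1)
      by (intro sets.Int sets.countable_INT') (auto intro: sets_completionI_sets)
    have WA: "emeasure lebesgue (W - A) = 0"
    proof (rule ccontr)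
      assume "emeasure lebesgue (W - A) \<noteq> 0"
      moreover have le: "emeasure lebesgue (W - A) < ennreal (1 / Suc n)" for n
      proof -
        have "emeasure lebesgue (W - A) \<le> emeasure lebesgue (T n - A)"
          using T(3) by (intro emeasure_mono) (auto simp: W_def)
        also note T(4)
        finally show ?thesis .
      qed
      ultimately obtain e where e: "e > 0" "emeasure lebesgue (W - A) = ennreal e"
        using le[of 0] by (cases "emeasure lebesgue (W - A)") (auto simp: ennreal_eq_0_iff not_le)
      obtain n where "1 / Suc n < e" using e(1) nat_approx_posE by metis
      then show False using le[of n] e by (simp add: ennreal_less_iff)
    qed
    have meas: "indicat_real S \<in> borel_measurable (lebesgue_on \<Omega>)" if "S \<in> sets lebesgue" for S
      using that by (intro measurable_restrict_space1 borel_measurable_indicator)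
    have "(LINT x|lebesgue_on \<Omega>. f x * indicator W x) = 0"
    proof (rule integral_indicator_limit[OF f Ws])
      fix n
      show "indicat_real (V n) \<in> borel_measurable (lebesgue_on \<Omega>)" by (rule meas[OF open_sets_lebesgue[OF Vo]])
      show "(LINT x|lebesgue_on \<Omega>. f x * indicator (V n) x) = 0"
        using Vo by (intro fundamental_lemma_open f zero) (auto simp: V_def)
    next
      fix x
      have "decseq V" unfolding V_def decseq_def by fastforce
      then have "(\<lambda>n. indicat_real (V n) x) \<longlonglongrightarrow> indicator (\<Inter>n. V n) x"
        by (rule LIMSEQ_indicator_decseq)
      moreover have "(\<Inter>n. V n) = W" by (auto simp: V_def W_def)
      ultimately show "(\<lambda>n. indicat_real (V n) x) \<longlonglongrightarrow> indicator W x" by simp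
    qed (auto simp: indicator_def)
    moreover have "(LINT x|lebesgue_on \<Omega>. f x * indicator W x) = (LINT x|lebesgue_on \<Omega>. f x * indicator A x)"
    proof (rule integral_cong_AE)
      show "(\<lambda>x. f x * indicator W x) \<in> borel_measurable (lebesgue_on \<Omega>)"
        by (intro borel_measurable_times fm meas Ws)
      show "(\<lambda>x. f x * indicator A x) \<in> borel_measurable (lebesgue_on \<Omega>)"
        by (intro borel_measurable_times fm meas A')
      have "W - A \<in> null_sets lebesgue" using WA Ws A'(1) by auto
      then have "AE x in lebesgue. x \<notin> W - A" by (rule AE_not_in)
      then have "AE x in lebesgue_on \<Omega>. x \<notin> W - A"
        using \<Omega>s by (subst AE_restrict_space_iff) (auto elim: eventually_mono)
      then show "AE x in lebesgue_on \<Omega>. f x * indicator W x = f x * indicator A x"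
      proof eventually_elim
        case (elim x)
        have "A \<subseteq> W" using T(2) A'(2) by (auto simp: W_def)
        with elim show ?case by (auto simp: indicator_def)
      qed
    qed
    ultimately show ?thesis by simp
  qed
  define A where "A = {x \<in> space (lebesgue_on \<Omega>). f x > 0}"
  define B where "B = {x \<in> space (lebesgue_on \<Omega>). f x < 0}"
  have AB: "A \<in> sets (lebesgue_on \<Omega>)" "B \<in> sets (lebesgue_on \<Omega>)"
    using fm unfolding A_def B_def by measurable
  have intg: "integrable (lebesgue_on \<Omega>) (\<lambda>x. f x * indicator S x)" if "S \<in> sets (lebesgue_on \<Omega>)" for S
    by (rule integrable_mult_bounded[OF f, of _ 1]) (use that in \<open>auto simp: indicator_def\<close>)
  have "AE x in lebesgue_on \<Omega>. f x * indicator A x = 0"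
    by (subst integral_nonneg_eq_0_iff_AE[symmetric])
      (use set_zero[OF AB(1)] intg[OF AB(1)] in \<open>auto simp: A_def indicator_def\<close>)
  moreover have "AE x in lebesgue_on \<Omega>. - (f x * indicator B x) = 0"
    by (subst integral_nonneg_eq_0_iff_AE[symmetric])
      (use set_zero[OF AB(2)] intg[OF AB(2)] in \<open>auto simp: B_def indicator_def\<close>)
  ultimately show ?thesis using AE_space
  proof eventually_elim
    case (elim x)
    then show ?case by (cases "f x" "0 :: real" rule: linorder_cases) (auto simp: A_def B_def)
  qed
qed

section \<open>The Sobolev space\<close>

lemma integrable_mult_test_function:
  assumes "test_function \<Omega> \<phi> D\<phi>" "integrable (lebesgue_on \<Omega>) f"
  shows "integrable (lebesgue_on \<Omega>) (\<lambda>x. f x * \<phi> x)"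
proof -
  obtain C where "\<forall>x. \<bar>\<phi> x\<bar> \<le> C" using test_function_bounded[OF assms(1)] by blast
  then show ?thesis
    by (intro integrable_mult_bounded[OF assms(2), of _ C] continuous_measurable_lebesgue_on
      test_function_continuous[OF assms(1)]) auto
qed

lemma integrable_mult_test_function_grad:
  assumes t: "test_function \<Omega> \<phi> D\<phi>" and f: "integrable (lebesgue_on \<Omega>) f"
  shows "integrable (lebesgue_on \<Omega>) (\<lambda>x. f x * D\<phi> x $ i)"
proof -
  obtain C where C: "\<forall>x. norm (D\<phi> x) \<le> C" using test_function_grad_bounded[OF t] by blast
  have "continuous_on UNIV (\<lambda>x. D\<phi> x $ i)" using t by (auto simp: test_function_def intro!: continuous_intros)
  then show ?thesis
    using C by (intro integrable_mult_bounded[OF f, of _ C] continuous_measurable_lebesgue_on)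
      (auto intro: order_trans[OF component_le_norm_cart])
qed

lemma integrable_component:
  fixes G :: "'a \<Rightarrow> real^'n"
  assumes "integrable M G" shows "integrable M (\<lambda>x. G x $ i)"
  using integrable_inner_left[of "axis i 1" M G] assms by (simp add: inner_axis)

lemma weak_gradient_unique:
  assumes \<Omega>: "open \<Omega>" "bounded \<Omega>"
    and G: "G \<in> L2 (lebesgue_on \<Omega>)" "has_weak_gradient \<Omega> u G"
    and G': "G' \<in> L2 (lebesgue_on \<Omega>)" "has_weak_gradient \<Omega> u G'"
  shows "AE x in lebesgue_on \<Omega>. G x = G' x"
proof -
  note fin = finite_measure_lebesgue_on[OF \<Omega>(2) open_sets_lebesgue[OF \<Omega>(1)]]
  have int: "integrable (lebesgue_on \<Omega>) (\<lambda>x. G x $ i)" "integrable (lebesgue_on \<Omega>) (\<lambda>x. G' x $ i)" for i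
    by (rule integrable_component[OF L2_integrable[OF fin G(1)]], rule integrable_component[OF L2_integrable[OF fin G'(1)]])
  have "AE x in lebesgue_on \<Omega>. G x $ i - G' x $ i = 0" for i
  proof (rule fundamental_lemma[OF \<Omega>(1)])
    show "integrable (lebesgue_on \<Omega>) (\<lambda>x. G x $ i - G' x $ i)" using int by simp
    fix \<phi> D\<phi> assume t: "test_function \<Omega> \<phi> D\<phi>"
    have "(LINT x|lebesgue_on \<Omega>. (G x $ i - G' x $ i) * \<phi> x)
        = (LINT x|lebesgue_on \<Omega>. G x $ i * \<phi> x) - (LINT x|lebesgue_on \<Omega>. G' x $ i * \<phi> x)"
      unfolding left_diff_distrib using int integrable_mult_test_function[OF t] by simp
    also have "\<dots> = 0" using G(2) G'(2) t by (auto simp: has_weak_gradient_def)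
    finally show "(LINT x|lebesgue_on \<Omega>. (G x $ i - G' x $ i) * \<phi> x) = 0" .
  qed
  then have "AE x in lebesgue_on \<Omega>. \<forall>i\<in>UNIV. G x $ i - G' x $ i = 0"
    by (intro AE_finite_allI) auto
  then show ?thesis by eventually_elim (simp add: vec_eq_iff)
qed

lemma grad_weak_gradient:
  assumes "u \<in> H1 \<Omega>"
  shows "grad \<Omega> u \<in> L2 (lebesgue_on \<Omega>)" "has_weak_gradient \<Omega> u (grad \<Omega> u)"
proof -
  have "\<exists>G. G \<in> L2 (lebesgue_on \<Omega>) \<and> has_weak_gradient \<Omega> u G" using assms by (auto simp: H1_def)
  from someI_ex[OF this]
  show "grad \<Omega> u \<in> L2 (lebesgue_on \<Omega>)" "has_weak_gradient \<Omega> u (grad \<Omega> u)" by (auto simp: grad_def)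
qed

lemma has_weak_gradient_lincomb:
  assumes \<Omega>: "open \<Omega>" "bounded \<Omega>"
    and u: "u \<in> L2 (lebesgue_on \<Omega>)" "G \<in> L2 (lebesgue_on \<Omega>)" "has_weak_gradient \<Omega> u G"
    and v: "v \<in> L2 (lebesgue_on \<Omega>)" "H \<in> L2 (lebesgue_on \<Omega>)" "has_weak_gradient \<Omega> v H"
  shows "has_weak_gradient \<Omega> (\<lambda>x. a * u x + b * v x) (\<lambda>x. a *\<^sub>R G x + b *\<^sub>R H x)"
  unfolding has_weak_gradient_def
proof (intro allI impI)
  fix \<phi> D\<phi> i assume t: "test_function \<Omega> \<phi> D\<phi>"
  note fin = finite_measure_lebesgue_on[OF \<Omega>(2) open_sets_lebesgue[OF \<Omega>(1)]]
  have int: "integrable (lebesgue_on \<Omega>) u" "integrable (lebesgue_on \<Omega>) v"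
    "integrable (lebesgue_on \<Omega>) (\<lambda>x. G x $ i)" "integrable (lebesgue_on \<Omega>) (\<lambda>x. H x $ i)"
    by (rule L2_integrable[OF fin u(1)], rule L2_integrable[OF fin v(1)],
      rule integrable_component[OF L2_integrable[OF fin u(2)]], rule integrable_component[OF L2_integrable[OF fin v(2)]])
  note int' = integrable_mult_test_function_grad[OF t int(1), of i] integrable_mult_test_function_grad[OF t int(2), of i]
    integrable_mult_test_function[OF t int(3)] integrable_mult_test_function[OF t int(4)]
  have "(LINT x|lebesgue_on \<Omega>. (a * u x + b * v x) * D\<phi> x $ i)
      = (LINT x|lebesgue_on \<Omega>. a * (u x * D\<phi> x $ i) + b * (v x * D\<phi> x $ i))"
    by (simp add: algebra_simps)
  also have "\<dots> = a * (LINT x|lebesgue_on \<Omega>. u x * D\<phi> x $ i) + b * (LINT x|lebesgue_on \<Omega>. v x * D\<phi> x $ i)"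
    using int' by simp
  also have "\<dots> = - (a * (LINT x|lebesgue_on \<Omega>. G x $ i * \<phi> x) + b * (LINT x|lebesgue_on \<Omega>. H x $ i * \<phi> x))"
    using u(3) v(3) t by (simp add: has_weak_gradient_def)
  also have "a * (LINT x|lebesgue_on \<Omega>. G x $ i * \<phi> x) + b * (LINT x|lebesgue_on \<Omega>. H x $ i * \<phi> x)
      = (LINT x|lebesgue_on \<Omega>. a * (G x $ i * \<phi> x) + b * (H x $ i * \<phi> x))"
    using int' by simp
  also have "\<dots> = (LINT x|lebesgue_on \<Omega>. (a *\<^sub>R G x + b *\<^sub>R H x) $ i * \<phi> x)"
    by (simp add: algebra_simps)
  finally show "(LINT x|lebesgue_on \<Omega>. (a * u x + b * v x) * D\<phi> x $ i)
      = - (LINT x|lebesgue_on \<Omega>. (a *\<^sub>R G x + b *\<^sub>R H x) $ i * \<phi> x)" .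
qed

lemma H1_lincomb:
  assumes \<Omega>: "open \<Omega>" "bounded \<Omega>" and u: "u \<in> H1 \<Omega>" and v: "v \<in> H1 \<Omega>"
  shows "(\<lambda>x. a * u x + b * v x) \<in> H1 \<Omega>"
    and "AE x in lebesgue_on \<Omega>. grad \<Omega> (\<lambda>x. a * u x + b * v x) x = a *\<^sub>R grad \<Omega> u x + b *\<^sub>R grad \<Omega> v x"
proof -
  have uv: "u \<in> L2 (lebesgue_on \<Omega>)" "v \<in> L2 (lebesgue_on \<Omega>)" using u v by (auto simp: H1_def)
  note wg = has_weak_gradient_lincomb[OF \<Omega> uv(1) grad_weak_gradient[OF u] uv(2) grad_weak_gradient[OF v], of a b]
  have L2: "(\<lambda>x. a *\<^sub>R grad \<Omega> u x + b *\<^sub>R grad \<Omega> v x) \<in> L2 (lebesgue_on \<Omega>)"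
    by (intro L2_lincomb grad_weak_gradient u v)
  show H: "(\<lambda>x. a * u x + b * v x) \<in> H1 \<Omega>"
    using L2_lincomb[OF uv, of a b] L2 wg by (auto simp: H1_def)
  show "AE x in lebesgue_on \<Omega>. grad \<Omega> (\<lambda>x. a * u x + b * v x) x = a *\<^sub>R grad \<Omega> u x + b *\<^sub>R grad \<Omega> v x"
    by (rule weak_gradient_unique[OF \<Omega> grad_weak_gradient[OF H] L2 wg])
qed

section \<open>Continuous piecewise affine functions\<close>

locale triangulated_domain =
  fixes \<Omega> :: "(real^'n) set" and \<T> :: "(real^'n) set set"
  assumes open_domain: "open \<Omega>" and bounded_domain: "bounded \<Omega>" and connected_domain: "connected \<Omega>"
    and nonempty_domain: "\<Omega> \<noteq> {}" and triang: "triangulates \<T> \<Omega>"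
begin

lemma finite_mesh: "finite \<T>"
  and mesh_simplex: "T \<in> \<T> \<Longrightarrow> int CARD('n) simplex T"
  and mesh_face: "T \<in> \<T> \<Longrightarrow> T' \<in> \<T> \<Longrightarrow> T \<inter> T' face_of T"
  and Union_mesh: "\<Union>\<T> = closure \<Omega>"
  using triang by (auto simp: triangulates_def triangulation_def)

lemma mesh_convex: "T \<in> \<T> \<Longrightarrow> convex T" and mesh_closed: "T \<in> \<T> \<Longrightarrow> closed T"
  and mesh_compact: "T \<in> \<T> \<Longrightarrow> compact T"
  using mesh_simplex convex_simplex closed_simplex compact_simplex by blast+

lemma mesh_interior_nonempty: "T \<in> \<T> \<Longrightarrow> interior T \<noteq> {}"
proof -
  assume T: "T \<in> \<T>"
  have ad: "aff_dim T = int (DIM(real^'n))"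
    using aff_dim_simplex[OF mesh_simplex[OF T]] by simp
  then have "T \<noteq> {}" by auto
  then have "rel_interior T \<noteq> {}" using rel_interior_eq_empty[OF mesh_convex[OF T]] by simp
  then show ?thesis using interior_rel_interior_gen[of T] ad by simp
qed

lemma mesh_interior_unique:
  assumes "T \<in> \<T>" "T' \<in> \<T>" "x \<in> interior T" "x \<in> interior T'"
  shows "T = T'"
proof -
  have "x \<in> T \<inter> T'" using assms(3,4) interior_subset by blast
  then have "T \<inter> T' = T"
    using face_of_disjoint_interior[OF mesh_face[OF assms(1,2)]] assms(3) by blast
  moreover have "T' \<inter> T = T'"
    using face_of_disjoint_interior[OF mesh_face[OF assms(2,1)]] assms(4) \<open>x \<in> T \<inter> T'\<close> by blast
  ultimately show ?thesis by blast
qed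

lemma domain_sets: "\<Omega> \<in> sets lebesgue"
  by (rule open_sets_lebesgue[OF open_domain])

lemma finite_measure_domain: "finite_measure (lebesgue_on \<Omega>)"
  by (rule finite_measure_lebesgue_on[OF bounded_domain domain_sets])

lemma AE_in_mesh_interior: "AE x in lebesgue. x \<in> \<Omega> \<longrightarrow> (\<exists>T\<in>\<T>. x \<in> interior T)"
proof -
  have "negligible (\<Union>T\<in>\<T>. frontier T)"
    using finite_mesh mesh_convex negligible_convex_frontier by (intro negligible_Union) auto
  then have "AE x in lebesgue. x \<notin> (\<Union>T\<in>\<T>. frontier T)"
    by (intro AE_not_in) (simp add: negligible_iff_null_sets)
  then show ?thesis
  proof eventually_elim
    case (elim x)
    show ?case
    proof
      assume "x \<in> \<Omega>"
      then have "x \<in> \<Union>\<T>" using Union_mesh closure_subset by blast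
      then obtain T where "T \<in> \<T>" "x \<in> T" by blast
      moreover have "x \<notin> frontier T" using elim \<open>T \<in> \<T>\<close> by blast
      ultimately show "\<exists>T\<in>\<T>. x \<in> interior T"
        using closure_subset by (auto simp: frontier_def)
    qed
  qed
qed

definition pw_grad :: "((real^'n) set \<Rightarrow> real^'n) \<Rightarrow> real^'n \<Rightarrow> real^'n" where
  "pw_grad a x = (\<Sum>T\<in>\<T>. indicator (interior T) x *\<^sub>R a T)"

lemma pw_grad_eq: "T \<in> \<T> \<Longrightarrow> x \<in> interior T \<Longrightarrow> pw_grad a x = a T"
proof -
  assume T: "T \<in> \<T>" "x \<in> interior T"
  have "pw_grad a x = (\<Sum>S\<in>\<T>. if S = T then a T else 0)"
    unfolding pw_grad_def
    by (rule sum.cong) (use T mesh_interior_unique in \<open>auto simp: indicator_def\<close>)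
  then show ?thesis using T finite_mesh by simp
qed

lemma pw_grad_measurable: "pw_grad a \<in> borel_measurable (lebesgue_on \<Omega>)"
proof -
  have "pw_grad a \<in> borel_measurable borel"
    unfolding pw_grad_def[abs_def] by (intro borel_measurable_sum borel_measurable_scaleR borel_measurable_indicator borel_measurable_const) auto
  then have "pw_grad a \<in> borel_measurable lborel" by simp
  then have "pw_grad a \<in> borel_measurable lebesgue" by (rule measurable_completion)
  then show ?thesis by (rule measurable_restrict_space1)
qed

lemma pw_grad_norm_le: "norm (pw_grad a x) \<le> (\<Sum>T\<in>\<T>. norm (a T))"
  unfolding pw_grad_def
  by (rule order_trans[OF norm_sum sum_mono]) (auto simp: indicator_def)

lemma P1_space_affine_pieces:
  assumes "u \<in> P1_space \<Omega> \<T>"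
  obtains a b where "\<And>T x. T \<in> \<T> \<Longrightarrow> x \<in> T \<Longrightarrow> u x = a T \<bullet> x + b T"
proof -
  have "\<forall>T\<in>\<T>. \<exists>a b. \<forall>x\<in>T. u x = a \<bullet> x + b"
  proof
    fix T assume "T \<in> \<T>"
    then obtain p where "p \<in> P1" "\<forall>x\<in>T. u x = p x" using assms by (auto simp: P1_space_def)
    moreover then obtain a b where "\<forall>x. p x = a \<bullet> x + b" by (auto simp: P1_def)
    ultimately show "\<exists>a b. \<forall>x\<in>T. u x = a \<bullet> x + b" by auto
  qed
  then show ?thesis using that by metis
qed

text \<open>
  The segment may run inside faces of the mesh, where \<open>u\<close> is not differentiable, and it must not
  leave the closed domain, which need not be convex. Along it the closed elements cut out finitely many
  closed parameter sets, on each of which the function is affine.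
\<close>

lemma P1_space_lipschitz_on_segment:
  assumes pieces: "\<And>T x. T \<in> \<T> \<Longrightarrow> x \<in> T \<Longrightarrow> u x = a T \<bullet> x + b T"
    and seg: "\<And>s. 0 \<le> s \<Longrightarrow> s \<le> t \<Longrightarrow> x + s *\<^sub>R e \<in> closure \<Omega>" and e: "norm e = 1" and t: "t \<ge> 0"
  shows "\<bar>u (x + t *\<^sub>R e) - u x\<bar> \<le> (\<Sum>T\<in>\<T>. norm (a T)) * t"
proof -
  let ?M = "\<Sum>T\<in>\<T>. norm (a T)"
  define S where "S T = {s. x + s *\<^sub>R e \<in> T}" for T
  have M: "?M \<ge> 0" by (intro sum_nonneg) auto
  have "?M-lipschitz_on {0..t} (\<lambda>s. u (x + s *\<^sub>R e))"
  proof (rule lipschitz_on_closed_Union[where I = \<T> and U = S])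
    fix T assume T: "T \<in> \<T>"
    show "?M-lipschitz_on (S T) (\<lambda>s. u (x + s *\<^sub>R e))"
    proof (rule lipschitz_onI[OF _ M])
      fix s r assume "s \<in> S T" "r \<in> S T"
      then have "dist (u (x + s *\<^sub>R e)) (u (x + r *\<^sub>R e)) = \<bar>a T \<bullet> e\<bar> * \<bar>s - r\<bar>"
        using pieces[OF T] by (simp add: S_def dist_real_def inner_add_right algebra_simps flip: abs_mult)
      also have "\<bar>a T \<bullet> e\<bar> \<le> norm (a T)" using Cauchy_Schwarz_ineq2[of "a T" e] e by simp
      also have "norm (a T) \<le> ?M" using T finite_mesh by (intro member_le_sum) auto
      finally show "dist (u (x + s *\<^sub>R e)) (u (x + r *\<^sub>R e)) \<le> ?M * dist s r"
        by (simp add: dist_real_def mult_right_mono)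
    qed
    have "S T = (\<lambda>s. x + s *\<^sub>R e) -` T" by (auto simp: S_def)
    then show "closed (S T)"
      using mesh_closed[OF T] by (auto intro!: closed_vimage continuous_intros)
  next
    show "{0..t} \<subseteq> (\<Union>T\<in>\<T>. S T)"
    proof
      fix s assume "s \<in> {0..t}"
      then have "x + s *\<^sub>R e \<in> \<Union>\<T>" using seg Union_mesh by auto
      then show "s \<in> (\<Union>T\<in>\<T>. S T)" by (auto simp: S_def)
    qed
  qed (use finite_mesh M in auto)
  from lipschitz_onD[OF this, of t 0] t show ?thesis by (simp add: dist_real_def)
qed

lemma P1_space_bounded:
  assumes "u \<in> P1_space \<Omega> \<T>"
  shows "\<exists>C. \<forall>x\<in>closure \<Omega>. \<bar>u x\<bar> \<le> C"
proof -
  have "compact (u ` closure \<Omega>)"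
    using assms bounded_domain by (intro compact_continuous_image) (auto simp: P1_space_def compact_closure)
  then have "bounded (u ` closure \<Omega>)" by (rule compact_imp_bounded)
  then show ?thesis by (auto simp: bounded_iff)
qed

lemma P1_space_measurable:
  assumes "u \<in> P1_space \<Omega> \<T>"
  shows "u \<in> borel_measurable (lebesgue_on \<Omega>)"
proof -
  have "continuous_on \<Omega> u" using assms closure_subset by (auto simp: P1_space_def intro: continuous_on_subset)
  then show ?thesis by (rule continuous_imp_measurable_on_sets_lebesgue[OF _ domain_sets])
qed

text \<open>
  The product \<open>W\<close> of \<open>u\<close> and the test function, extended by zero, is continuous with compact
  support. By translation invariance its difference quotients in the direction \<open>i\<close> have integral
  zero. They are bounded by the Lipschitz estimate along segments and converge, away from the null set
  of element boundaries, to \<open>u * D\<phi> $ i + pw_grad a $ i * \<phi>\<close>; dominated convergence gives the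
  integration by parts formula.
\<close>

lemma P1_space_has_weak_gradient:
  assumes u: "u \<in> P1_space \<Omega> \<T>"
    and pieces: "\<And>T x. T \<in> \<T> \<Longrightarrow> x \<in> T \<Longrightarrow> u x = a T \<bullet> x + b T"
  shows "has_weak_gradient \<Omega> u (pw_grad a)"
  unfolding has_weak_gradient_def
proof (intro allI impI)
  fix \<phi> D\<phi> and i :: 'n assume t: "test_function \<Omega> \<phi> D\<phi>"
  obtain K where K: "compact K" "K \<subseteq> \<Omega>" "\<And>x. x \<notin> K \<Longrightarrow> \<phi> x = 0"
    and G: "\<And>x. GDERIV \<phi> x :> D\<phi> x" using t by (auto simp: test_function_def)
  define e :: "real^'n" where "e = axis i 1"
  have e: "norm e = 1" by (simp add: e_def)
  define W where "W x = (if x \<in> \<Omega> then u x * \<phi> x else 0)" for x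
  define DW where "DW x = (if x \<in> \<Omega> then u x * D\<phi> x $ i + pw_grad a x $ i * \<phi> x else 0)" for x
  have W0: "W x = 0" if "x \<notin> K" for x using K(3) that by (simp add: W_def)
  obtain C\<phi> where C\<phi>: "\<And>x. \<bar>\<phi> x\<bar> \<le> C\<phi>" using test_function_bounded[OF t] by blast
  obtain CD where CD: "\<And>x. norm (D\<phi> x) \<le> CD" using test_function_grad_bounded[OF t] by blast
  obtain Cu where Cu: "\<And>x. x \<in> closure \<Omega> \<Longrightarrow> \<bar>u x\<bar> \<le> Cu" using P1_space_bounded[OF u] by blast
  obtain R where R: "\<And>x. x \<in> K \<Longrightarrow> norm x \<le> R" using compact_imp_bounded[OF K(1)] by (auto simp: bounded_iff)
  obtain \<epsilon> where \<epsilon>: "\<epsilon> > 0" "(\<Union>x\<in>K. ball x \<epsilon>) \<subseteq> \<Omega>"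
    using compact_subset_open_imp_ball_epsilon_subset[OF K(1) open_domain K(2)] by blast
  \<comment> \<open>Steps of length at most \<open>\<tau>\<close> from the support of \<open>\<phi>\<close> stay inside \<open>\<Omega>\<close>.\<close>
  define \<tau> where "\<tau> = \<epsilon> / 2"
  have \<tau>: "\<tau> > 0" "\<tau> < \<epsilon>" using \<epsilon>(1) by (auto simp: \<tau>_def)
  have Wc: "continuous_on UNIV W"
  proof -
    have "continuous_on \<Omega> (\<lambda>x. u x * \<phi> x)"
      using u closure_subset[of \<Omega>]
      by (intro continuous_intros test_function_continuous[OF t]) (auto simp: P1_space_def intro: continuous_on_subset)
    then have "continuous_on \<Omega> W"
      by (rule continuous_on_eq) (simp add: W_def)
    moreover have "continuous_on (- K) W"
      by (rule continuous_on_eq[OF continuous_on_const[of _ 0]]) (simp add: W0)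
    ultimately have "continuous_on (\<Omega> \<union> - K) W"
      using K(1) open_domain by (intro continuous_on_open_Un) (auto simp: compact_imp_closed open_Compl)
    moreover have "\<Omega> \<union> - K = UNIV" using K(2) by blast
    ultimately show ?thesis by simp
  qed
  then have Wm: "W \<in> borel_measurable borel" by (rule borel_measurable_continuous_onI)
  define L where "L = (\<Sum>T\<in>\<T>. norm (a T)) * C\<phi> + Cu * CD"
  have Lnn: "C\<phi> \<ge> 0" "CD \<ge> 0" "Cu \<ge> 0" "(\<Sum>T\<in>\<T>. norm (a T)) \<ge> 0"
  proof -
    show "C\<phi> \<ge> 0" using C\<phi>[of 0] by linarith
    show "CD \<ge> 0" using CD[of 0] norm_ge_zero[of "D\<phi> 0"] by linarith
    obtain x where "x \<in> \<Omega>" using nonempty_domain by blast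
    then show "Cu \<ge> 0" using Cu[of x] closure_subset[of \<Omega>] by force
  qed (auto intro: sum_nonneg)
  have Wlip: "\<bar>W (x + s *\<^sub>R e) - W x\<bar> \<le> L * s" if s: "0 < s" "s \<le> \<tau>" for x s
  proof (cases "x \<in> K \<or> x + s *\<^sub>R e \<in> K")
    case False
    then show ?thesis using Lnn s by (simp add: W0 L_def)
  next
    case True
    have seg: "x + r *\<^sub>R e \<in> \<Omega>" if r: "0 \<le> r" "r \<le> s" for r
    proof -
      have "x + r *\<^sub>R e \<in> ball x \<epsilon>" "x + r *\<^sub>R e \<in> ball (x + s *\<^sub>R e) \<epsilon>"
        using r s \<tau> e by (auto simp: dist_norm simp flip: scaleR_left_diff_distrib)
      then show ?thesis using True \<epsilon>(2) by blast
    qed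
    have 1: "\<bar>u (x + s *\<^sub>R e) - u x\<bar> \<le> (\<Sum>T\<in>\<T>. norm (a T)) * s"
      by (rule P1_space_lipschitz_on_segment[OF pieces]) (use seg closure_subset e s in auto)
    have 2: "\<bar>\<phi> (x + s *\<^sub>R e) - \<phi> x\<bar> \<le> CD * s"
    proof -
      have "norm (\<phi> (x + s *\<^sub>R e) - \<phi> x) \<le> CD * norm ((x + s *\<^sub>R e) - x)"
      proof (rule differentiable_bound[where S = UNIV and f' = "\<lambda>y h. h \<bullet> D\<phi> y"])
        show "(\<phi> has_derivative (\<lambda>h. h \<bullet> D\<phi> y)) (at y within UNIV)" for y
          using G[of y] by (simp add: gderiv_def)
        show "onorm (\<lambda>h. h \<bullet> D\<phi> y) \<le> CD" for y
        proof (rule onorm_bound)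
          fix h have "norm (h \<bullet> D\<phi> y) \<le> norm h * norm (D\<phi> y)" using Cauchy_Schwarz_ineq2[of h "D\<phi> y"] by simp
          also have "\<dots> \<le> norm h * CD" by (intro mult_left_mono CD) auto
          finally show "norm (h \<bullet> D\<phi> y) \<le> CD * norm h" by (simp add: mult.commute)
        qed (use Lnn in auto)
      qed auto
      then show ?thesis using e s by simp
    qed
    have x: "x \<in> \<Omega>" "x + s *\<^sub>R e \<in> \<Omega>" using seg[of 0] seg[of s] s by auto
    have "W (x + s *\<^sub>R e) - W x = (u (x + s *\<^sub>R e) - u x) * \<phi> (x + s *\<^sub>R e) + u x * (\<phi> (x + s *\<^sub>R e) - \<phi> x)"
      using x by (simp add: W_def algebra_simps)
    also have "\<bar>\<dots>\<bar> \<le> \<bar>u (x + s *\<^sub>R e) - u x\<bar> * \<bar>\<phi> (x + s *\<^sub>R e)\<bar> + \<bar>u x\<bar> * \<bar>\<phi> (x + s *\<^sub>R e) - \<phi> x\<bar>"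
      by (rule order_trans[OF abs_triangle_ineq]) (simp add: abs_mult)
    also have "\<dots> \<le> ((\<Sum>T\<in>\<T>. norm (a T)) * s) * C\<phi> + Cu * (CD * s)"
      using x closure_subset Lnn s by (intro add_mono mult_mono 1 2 C\<phi> Cu) auto
    also have "\<dots> = L * s" by (simp add: L_def algebra_simps)
    finally show ?thesis .
  qed
  define tn where "tn n = \<tau> * inverse (real (Suc n))" for n
  have tn: "tn n > 0" "tn n \<le> \<tau>" for n
    using \<tau> by (auto simp: tn_def field_simps)
  have tn_lim: "tn \<longlonglongrightarrow> 0"
    unfolding tn_def by (intro tendsto_mult_right_zero LIMSEQ_inverse_real_of_nat)
  define q where "q n x = (W (x + tn n *\<^sub>R e) - W x) / tn n" for n x
  have shift_m: "(\<lambda>x. W (x + v)) \<in> borel_measurable borel" for v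
    using Wc by (intro borel_measurable_continuous_onI continuous_on_compose2[OF Wc]) (auto intro!: continuous_intros)
  have W_int: "integrable lborel W"
  proof (rule Bochner_Integration.integrable_bound[where f = "\<lambda>x. (Cu * C\<phi>) * indicator (cball 0 R) x"])
    show "integrable lborel (\<lambda>x::real^'n. (Cu * C\<phi>) * indicator (cball 0 R) x)"
      using emeasure_lborel_cball_finite by (intro integrable_mult_right integrable_real_indicator) (auto simp: less_top)
    have "\<bar>W x\<bar> \<le> Cu * C\<phi> * indicator (cball 0 R) x" for x
    proof (cases "x \<in> K")
      case True
      then have "x \<in> \<Omega>" "x \<in> closure \<Omega>" "x \<in> cball 0 R" using K(2) closure_subset R by auto
      then show ?thesis using Cu C\<phi> Lnn by (auto simp: W_def abs_mult intro!: mult_mono)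
    qed (use W0 Lnn in auto)
    then show "AE x in lborel. norm (W x) \<le> norm (Cu * C\<phi> * indicator (cball 0 R) x)"
      using Lnn by (auto simp: abs_mult)
  qed (use Wm in simp)
  have shift: "integrable lborel (\<lambda>x. W (x + v))" "(LINT x|lborel. W (x + v)) = (LINT x|lborel. W x)" for v
  proof -
    have m: "(+) v \<in> lborel \<rightarrow>\<^sub>M borel" by simp
    have "integrable (distr lborel borel ((+) v)) W" using W_int by (simp add: lborel_distr_plus)
    then show "integrable lborel (\<lambda>x. W (x + v))"
      using Wm by (subst (asm) integrable_distr_eq[OF m]) (auto simp: add.commute)
    have "(LINT x|distr lborel borel ((+) v). W x) = (LINT x|lborel. W (v + x))"
      using Wm by (intro integral_distr[OF m]) auto
    then show "(LINT x|lborel. W (x + v)) = (LINT x|lborel. W x)"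
      by (simp add: lborel_distr_plus add.commute)
  qed
  have q0: "(LINT x|lebesgue. q n x) = 0" for n
  proof -
    have "(LINT x|lebesgue. q n x) = (LINT x|lborel. q n x)"
      using Wm shift_m by (intro integral_completion) (simp add: q_def[abs_def])
    also have "\<dots> = 0" using shift W_int by (simp add: q_def[abs_def])
    finally show ?thesis .
  qed
  have "(\<lambda>n. LINT x|lebesgue. q n x) \<longlonglongrightarrow> (LINT x|lebesgue. DW x)"
  proof (rule integral_dominated_convergence[where w = "\<lambda>x. L * indicator (cball 0 (R + \<tau>)) x"])
    have "(\<lambda>x. u x * D\<phi> x $ i + pw_grad a x $ i * \<phi> x) \<in> borel_measurable (lebesgue_on \<Omega>)"
      using t by (intro borel_measurable_add borel_measurable_times P1_space_measurable[OF u]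
        continuous_measurable_lebesgue_on test_function_continuous[OF t]
        borel_measurable_component pw_grad_measurable) (auto simp: test_function_def intro!: continuous_intros)
    then show "DW \<in> borel_measurable lebesgue"
      unfolding DW_def[abs_def] by (rule borel_measurable_if_I[OF _ domain_sets])
    show "q n \<in> borel_measurable lebesgue" for n
    proof -
      have "q n \<in> borel_measurable lborel" using Wm shift_m by (simp add: q_def[abs_def])
      then show ?thesis by (rule measurable_completion)
    qed
    have "integrable lborel (\<lambda>x::real^'n. L * indicator (cball 0 (R + \<tau>)) x)"
      using emeasure_lborel_cball_finite by (intro integrable_mult_right integrable_real_indicator) (auto simp: less_top)
    then show "integrable lebesgue (\<lambda>x::real^'n. L * indicator (cball 0 (R + \<tau>)) x)"
      by (subst integrable_completion) auto
    have "\<bar>q n x\<bar> \<le> L * indicator (cball 0 (R + \<tau>)) x" for n x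
    proof (cases "x \<in> K \<or> x + tn n *\<^sub>R e \<in> K")
      case False
      then show ?thesis using Lnn by (simp add: q_def W0 L_def)
    next
      case True
      have "norm x \<le> norm (x + tn n *\<^sub>R e) + tn n"
        using norm_triangle_ineq4[of "x + tn n *\<^sub>R e" "tn n *\<^sub>R e"] e tn(1)[of n] by simp
      then have "x \<in> cball 0 (R + \<tau>)" using True R tn[of n] \<tau>(1) by force
      then show ?thesis using Wlip[OF tn] tn(1)[of n] by (simp add: q_def abs_div divide_le_eq)
    qed
    then show "AE x in lebesgue. norm (q n x) \<le> L * indicator (cball 0 (R + \<tau>)) x" for n by simp
    show "AE x in lebesgue. (\<lambda>n. q n x) \<longlonglongrightarrow> DW x"
      using AE_in_mesh_interior
    proof eventually_elim
      case (elim x)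
      show ?case
      proof (cases "x \<in> \<Omega>")
        case True
        then obtain T where T: "T \<in> \<T>" "x \<in> interior T" using elim by blast
        have "open (\<Omega> \<inter> interior T)" using open_domain by auto
        then have "eventually (\<lambda>y. y \<in> \<Omega> \<inter> interior T) (nhds x)"
          using True T(2) by (intro eventually_nhds_in_open) auto
        moreover have "(\<lambda>n. x + tn n *\<^sub>R e) \<longlonglongrightarrow> x"
          using tn_lim by (auto intro!: tendsto_eq_intros)
        ultimately have ev: "\<forall>\<^sub>F n in sequentially. x + tn n *\<^sub>R e \<in> \<Omega> \<inter> interior T"
          by (rule eventually_compose_filterlim)
        have D: "((\<lambda>s. (a T \<bullet> (x + s *\<^sub>R e) + b T) * \<phi> (x + s *\<^sub>R e)) has_real_derivative DW x) (at 0)"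
        proof -
          have "((\<lambda>s. \<phi> (x + s *\<^sub>R e)) has_derivative (\<lambda>h. (h *\<^sub>R e) \<bullet> D\<phi> (x + 0 *\<^sub>R e))) (at 0)"
            by (rule has_derivative_compose[where f = "\<lambda>s. x + s *\<^sub>R e" and g = \<phi>])
              (auto intro!: derivative_eq_intros G[unfolded gderiv_def])
          then have "((\<lambda>s. \<phi> (x + s *\<^sub>R e)) has_real_derivative (e \<bullet> D\<phi> x)) (at 0)"
            by (rule has_derivative_imp_has_field_derivative) simp
          moreover have "((\<lambda>s. a T \<bullet> (x + s *\<^sub>R e) + b T) has_real_derivative (a T \<bullet> e)) (at 0)"
            by (auto simp: inner_add_right intro!: derivative_eq_intros)
          moreover have "a T \<bullet> x + b T = u x" using pieces[OF T(1), of x] subsetD[OF interior_subset T(2)] by simp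
          moreover have "pw_grad a x = a T" by (rule pw_grad_eq[OF T])
          moreover note DERIV_mult'[OF calculation(2,1)]
          ultimately show ?thesis
            using True by (simp add: DW_def e_def inner_axis inner_axis')
        qed
        have "((\<lambda>s. ((a T \<bullet> (x + s *\<^sub>R e) + b T) * \<phi> (x + s *\<^sub>R e) - (a T \<bullet> x + b T) * \<phi> x) / s) \<longlongrightarrow> DW x) (at 0)"
          using D by (simp add: has_field_derivative_iff)
        moreover have "filterlim tn (at 0) sequentially"
          using tn tn_lim by (auto simp: filterlim_at intro!: always_eventually less_imp_neq[symmetric])
        ultimately have "(\<lambda>n. ((a T \<bullet> (x + tn n *\<^sub>R e) + b T) * \<phi> (x + tn n *\<^sub>R e) - (a T \<bullet> x + b T) * \<phi> x) / tn n) \<longlonglongrightarrow> DW x"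
          by (rule filterlim_compose)
        moreover have "\<forall>\<^sub>F n in sequentially. ((a T \<bullet> (x + tn n *\<^sub>R e) + b T) * \<phi> (x + tn n *\<^sub>R e) - (a T \<bullet> x + b T) * \<phi> x) / tn n = q n x"
          using ev
        proof eventually_elim
          case (elim n)
          then have "x + tn n *\<^sub>R e \<in> T" "x \<in> T" using T(2) interior_subset by auto
          then show ?case using elim True pieces[OF T(1)] by (simp add: q_def W_def)
        qed
        ultimately show ?thesis by (rule Lim_transform_eventually)
      next
        case False
        then have x: "x \<in> - K" using K(2) by auto
        have "eventually (\<lambda>y. y \<in> - K) (nhds x)"
          using x K(1) by (intro eventually_nhds_in_open) (auto simp: compact_imp_closed open_Compl)
        moreover have "(\<lambda>n. x + tn n *\<^sub>R e) \<longlonglongrightarrow> x"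
          using tn_lim by (auto intro!: tendsto_eq_intros)
        ultimately have "\<forall>\<^sub>F n in sequentially. x + tn n *\<^sub>R e \<in> - K"
          by (rule eventually_compose_filterlim)
        then have "\<forall>\<^sub>F n in sequentially. 0 = q n x"
          by eventually_elim (use x in \<open>simp add: q_def W0\<close>)
        then show ?thesis using False by (auto simp: DW_def intro: Lim_transform_eventually[OF tendsto_const])
      qed
    qed
  qed
  then have DW0: "(LINT x|lebesgue. DW x) = 0" by (simp add: q0 LIMSEQ_const_iff)
  obtain "integrable (lebesgue_on \<Omega>) u" "integrable (lebesgue_on \<Omega>) (\<lambda>x. pw_grad a x $ i)"
  proof
    interpret finite_measure "lebesgue_on \<Omega>" by (rule finite_measure_domain)
    show "integrable (lebesgue_on \<Omega>) u"
      using Cu[OF subsetD[OF closure_subset]] P1_space_measurable[OF u]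
      by (intro integrable_const_bound[of _ Cu]) (auto simp: space_restrict_space intro!: AE_I2)
    have "integrable (lebesgue_on \<Omega>) (pw_grad a)"
      using pw_grad_norm_le pw_grad_measurable by (intro integrable_const_bound) (auto intro!: AE_I2)
    then show "integrable (lebesgue_on \<Omega>) (\<lambda>x. pw_grad a x $ i)" by (rule integrable_component)
  qed
  note int = integrable_mult_test_function_grad[OF t this(1)] integrable_mult_test_function[OF t this(2)]
  have "(LINT x|lebesgue_on \<Omega>. u x * D\<phi> x $ i) + (LINT x|lebesgue_on \<Omega>. pw_grad a x $ i * \<phi> x)
      = (LINT x|lebesgue_on \<Omega>. u x * D\<phi> x $ i + pw_grad a x $ i * \<phi> x)"
    using int by simp
  also have "\<dots> = (LINT x|lebesgue. DW x)"
    unfolding DW_def by (rule Lebesgue_Measure.integral_restrict_UNIV[OF domain_sets, symmetric])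
  finally show "(LINT x|lebesgue_on \<Omega>. u x * D\<phi> x $ i) = - (LINT x|lebesgue_on \<Omega>. pw_grad a x $ i * \<phi> x)"
    using DW0 by simp
qed


lemma P1_space_grad:
  assumes u: "u \<in> P1_space \<Omega> \<T>"
    and pieces: "\<And>T x. T \<in> \<T> \<Longrightarrow> x \<in> T \<Longrightarrow> u x = a T \<bullet> x + b T"
  shows "u \<in> H1 \<Omega>" "AE x in lebesgue_on \<Omega>. grad \<Omega> u x = pw_grad a x"
proof -
  obtain Cu where Cu: "\<And>x. x \<in> closure \<Omega> \<Longrightarrow> \<bar>u x\<bar> \<le> Cu" using P1_space_bounded[OF u] by blast
  have "u \<in> L2 (lebesgue_on \<Omega>)"
    using Cu[OF subsetD[OF closure_subset]]
    by (intro L2_bounded[OF finite_measure_domain P1_space_measurable[OF u], of Cu] AE_I2)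
      (auto simp: space_restrict_space)
  moreover have G: "pw_grad a \<in> L2 (lebesgue_on \<Omega>)"
    by (rule L2_bounded[OF finite_measure_domain pw_grad_measurable AE_I2[OF pw_grad_norm_le]])
  moreover have wg: "has_weak_gradient \<Omega> u (pw_grad a)" by (rule P1_space_has_weak_gradient[OF u pieces])
  ultimately show H: "u \<in> H1 \<Omega>" by (auto simp: H1_def)
  show "AE x in lebesgue_on \<Omega>. grad \<Omega> u x = pw_grad a x"
    by (rule weak_gradient_unique[OF open_domain bounded_domain grad_weak_gradient[OF H] G wg])
qed

lemma P1_space_subset_H1:
  assumes u: "u \<in> P1_space \<Omega> \<T>" shows "u \<in> H1 \<Omega>"
proof -
  obtain a b where "\<And>T x. T \<in> \<T> \<Longrightarrow> x \<in> T \<Longrightarrow> u x = a T \<bullet> x + b T"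
    using P1_space_affine_pieces[OF u] by blast
  from P1_space_grad(1)[of u a b, OF u this] show ?thesis .
qed

lemma P1_space_grad_bounded:
  assumes "u \<in> P1_space \<Omega> \<T>"
  shows "\<exists>C. AE x in lebesgue_on \<Omega>. norm (grad \<Omega> u x) \<le> C"
proof -
  obtain a b where pieces: "\<And>T x. T \<in> \<T> \<Longrightarrow> x \<in> T \<Longrightarrow> u x = a T \<bullet> x + b T"
    using P1_space_affine_pieces[OF assms] by blast
  have "AE x in lebesgue_on \<Omega>. grad \<Omega> u x = pw_grad a x"
    by (rule P1_space_grad(2)[of u a b, OF assms]) (rule pieces)
  then have "AE x in lebesgue_on \<Omega>. norm (grad \<Omega> u x) \<le> (\<Sum>T\<in>\<T>. norm (a T))"
    by eventually_elim (simp add: pw_grad_norm_le)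
  then show ?thesis by blast
qed

text \<open>
  Each element meets \<open>\<Omega>\<close> in a set of positive measure, so all elementwise gradients vanish and
  \<open>u\<close> takes finitely many values; by continuity it is constant on the connected closure.
\<close>

lemma P1_space_grad_zero_imp_const:
  assumes u: "u \<in> P1_space \<Omega> \<T>" and zero: "AE x in lebesgue_on \<Omega>. grad \<Omega> u x = 0"
  shows "\<exists>c. \<forall>x\<in>closure \<Omega>. u x = c"
proof -
  obtain a b where pieces: "\<And>T x. T \<in> \<T> \<Longrightarrow> x \<in> T \<Longrightarrow> u x = a T \<bullet> x + b T"
    using P1_space_affine_pieces[OF u] by blast
  have "AE x in lebesgue_on \<Omega>. grad \<Omega> u x = pw_grad a x"
    by (rule P1_space_grad(2)[of u a b, OF u]) (rule pieces)
  then have "AE x in lebesgue_on \<Omega>. pw_grad a x = 0"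
    using zero by eventually_elim simp
  then have ae: "AE x in lebesgue. x \<in> \<Omega> \<longrightarrow> pw_grad a x = 0"
    using domain_sets by (simp add: AE_restrict_space_iff)
  have a0: "a T = 0" if T: "T \<in> \<T>" for T
  proof (rule ccontr)
    assume "a T \<noteq> 0"
    then have sub: "\<Omega> \<inter> interior T \<subseteq> {x \<in> space lebesgue. \<not> (x \<in> \<Omega> \<longrightarrow> pw_grad a x = 0)}"
      using pw_grad_eq[OF T] by auto
    obtain N where N: "{x \<in> space lebesgue. \<not> (x \<in> \<Omega> \<longrightarrow> pw_grad a x = 0)} \<subseteq> N" "N \<in> null_sets lebesgue"
      using ae by (auto simp: eventually_ae_filter)
    then have "negligible N" by (simp add: negligible_iff_null_sets)
    then have neg: "negligible (\<Omega> \<inter> interior T)"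
      by (rule negligible_subset) (use sub N(1) in blast)
    have "interior T \<inter> closure \<Omega> \<noteq> {}"
      using mesh_interior_nonempty[OF T] interior_subset[of T] T Union_mesh by blast
    then have "\<Omega> \<inter> interior T \<noteq> {}"
      using open_Int_closure_eq_empty[OF open_interior, of T \<Omega>] by (auto simp: Int_commute)
    then show False using neg open_not_negligible[of "\<Omega> \<inter> interior T"] open_domain by auto
  qed
  have "u ` closure \<Omega> \<subseteq> b ` \<T>"
  proof
    fix y assume "y \<in> u ` closure \<Omega>"
    then obtain x T where "x \<in> T" "T \<in> \<T>" "y = u x" using Union_mesh by blast
    then show "y \<in> b ` \<T>" using pieces a0 by simp
  qed
  then have "finite (u ` closure \<Omega>)" using finite_mesh finite_surj by blast
  moreover have "connected (u ` closure \<Omega>)"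
    using u connected_domain by (intro connected_continuous_image connected_imp_connected_closure) (auto simp: P1_space_def)
  ultimately have "u ` closure \<Omega> = {} \<or> (\<exists>c. u ` closure \<Omega> = {c})"
    by (simp add: connected_finite_iff_sing)
  then show ?thesis by auto
qed

lemma P1_space_lincomb:
  assumes u: "u \<in> P1_space \<Omega> \<T>" and v: "v \<in> P1_space \<Omega> \<T>"
  shows "(\<lambda>x. \<alpha> * u x + \<beta> * v x) \<in> P1_space \<Omega> \<T>"
proof -
  obtain a b where 1: "\<And>T x. T \<in> \<T> \<Longrightarrow> x \<in> T \<Longrightarrow> u x = a T \<bullet> x + b T"
    using P1_space_affine_pieces[OF u] by blast
  obtain a' b' where 2: "\<And>T x. T \<in> \<T> \<Longrightarrow> x \<in> T \<Longrightarrow> v x = a' T \<bullet> x + b' T"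
    using P1_space_affine_pieces[OF v] by blast
  have "\<exists>p\<in>P1. \<forall>x\<in>T. \<alpha> * u x + \<beta> * v x = p x" if T: "T \<in> \<T>" for T
  proof (rule bexI)
    show "\<forall>x\<in>T. \<alpha> * u x + \<beta> * v x = (\<alpha> *\<^sub>R a T + \<beta> *\<^sub>R a' T) \<bullet> x + (\<alpha> * b T + \<beta> * b' T)"
      using 1[OF T] 2[OF T] by (simp add: inner_add_left algebra_simps)
    show "(\<lambda>x. (\<alpha> *\<^sub>R a T + \<beta> *\<^sub>R a' T) \<bullet> x + (\<alpha> * b T + \<beta> * b' T)) \<in> P1" unfolding P1_def by blast
  qed
  then show ?thesis using u v by (auto simp: P1_space_def intro!: continuous_intros)
qed

lemma P1_space_const: "(\<lambda>x. c) \<in> P1_space \<Omega> \<T>"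
proof -
  have "(\<lambda>x. c) \<in> P1" unfolding P1_def by (intro CollectI exI[of _ 0] exI[of _ c]) simp
  then show ?thesis by (auto simp: P1_space_def intro!: bexI[of _ "\<lambda>x. c"])
qed

lemma P1_space_add_const: "u \<in> P1_space \<Omega> \<T> \<Longrightarrow> (\<lambda>x. u x - c) \<in> P1_space \<Omega> \<T>"
  using P1_space_lincomb[of u "\<lambda>x. c" 1 "-1"] P1_space_const by simp

end

section \<open>Nodal interpolation\<close>

lemma affine_interpolation:
  fixes C :: "(real^'n) set" and f :: "real^'n \<Rightarrow> real"
  assumes "\<not> affine_dependent C"
  shows "\<exists>a b. \<forall>v\<in>C. a \<bullet> v + b = f v"
proof (cases "C = {}")
  case False
  then obtain v0 where v0: "v0 \<in> C" by blast
  define B where "B = (\<lambda>x. - v0 + x) ` (C - {v0})"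
  have "independent B"
    using assms affine_dependent_iff_dependent2[OF v0] by (simp add: B_def)
  then obtain g where g: "linear g" "\<And>x. x \<in> B \<Longrightarrow> g x = f (x + v0) - f v0"
    using linear_independent_extend[of B "\<lambda>x. f (x + v0) - f v0"] by blast
  define a where "a = adjoint g (1::real)"
  have a: "g x = a \<bullet> x" for x
    using adjoint_works[OF g(1), of x 1] by (simp add: a_def inner_commute)
  have "a \<bullet> v + (f v0 - a \<bullet> v0) = f v" if v: "v \<in> C" for v
  proof (cases "v = v0")
    case False
    then have "- v0 + v \<in> B" using v by (auto simp: B_def)
    from g(2)[OF this] a[of "- v0 + v"] show ?thesis by (simp add: inner_diff_right)
  qed simp
  then show ?thesis by blast
qed simp

lemma affine_eq_on_extreme_points:
  fixes S :: "(real^'n) set" and a a' :: "real^'n"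
  assumes S: "compact S" "convex S" and eq: "\<And>v. v extreme_point_of S \<Longrightarrow> a \<bullet> v + b = a' \<bullet> v + b'"
    and x: "x \<in> S"
  shows "a \<bullet> x + b = a' \<bullet> x + b'"
proof -
  have "S = convex hull {v. v extreme_point_of S}" by (rule Krein_Milman_Minkowski[OF S])
  also have "\<dots> \<subseteq> {y. (a - a') \<bullet> y = b' - b}"
    using eq by (intro hull_minimal convex_hyperplane) (auto simp: inner_diff_left algebra_simps)
  finally show ?thesis using x by (auto simp: inner_diff_left)
qed

context triangulated_domain
begin

lemma finite_nodes: "finite (nodes \<T>)"
proof -
  have "finite {v. v extreme_point_of T}" if T: "T \<in> \<T>" for T
  proof -
    obtain C where "finite C" "T = convex hull C" using mesh_simplex[OF T] by (auto simp: simplex)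
    then show ?thesis using extreme_point_of_convex_hull by (auto intro: finite_subset)
  qed
  moreover have "nodes \<T> = (\<Union>T\<in>\<T>. {v. v extreme_point_of T})" by (auto simp: nodes_def)
  ultimately show ?thesis using finite_mesh by simp
qed

text \<open>
  On each simplex the vertices are affinely independent, so an affine function with the prescribed
  values exists. Two elements meet in a common face, whose extreme points are nodes of both; the two
  affine functions agree there and hence on the face. So the pieces fit together continuously.
\<close>

lemma P1_space_interpolation: "\<exists>w\<in>P1_space \<Omega> \<T>. \<forall>v\<in>nodes \<T>. w v = f v"
proof -
  have "\<forall>T\<in>\<T>. \<exists>a b. \<forall>v. v extreme_point_of T \<longrightarrow> a \<bullet> v + b = f v"
  proof
    fix T assume "T \<in> \<T>"
    then obtain C where "\<not> affine_dependent C" "T = convex hull C" using mesh_simplex by (auto simp: simplex_def)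
    then show "\<exists>a b. \<forall>v. v extreme_point_of T \<longrightarrow> a \<bullet> v + b = f v"
      using affine_interpolation[of C f] extreme_point_of_convex_hull_affine_independent[of C] by auto
  qed
  then obtain a b where ab: "\<And>T v. T \<in> \<T> \<Longrightarrow> v extreme_point_of T \<Longrightarrow> a T \<bullet> v + b T = f v" by metis
  have agree: "a T \<bullet> x + b T = a T' \<bullet> x + b T'" if T: "T \<in> \<T>" "T' \<in> \<T>" "x \<in> T" "x \<in> T'" for T T' x
  proof (rule affine_eq_on_extreme_points)
    show "compact (T \<inter> T')" "convex (T \<inter> T')" "x \<in> T \<inter> T'"
      using T mesh_compact mesh_convex by (auto intro: compact_Int convex_Int)
    fix v assume v: "v extreme_point_of (T \<inter> T')"
    have "v extreme_point_of T" using v extreme_point_of_face[OF mesh_face[OF T(1,2)]] by blast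
    moreover have "v extreme_point_of T'"
      using v extreme_point_of_face[OF mesh_face[OF T(2,1)]] by (simp add: Int_commute)
    ultimately show "a T \<bullet> v + b T = a T' \<bullet> v + b T'" using ab T by simp
  qed
  define w where "w x = (let T = (SOME T. T \<in> \<T> \<and> x \<in> T) in a T \<bullet> x + b T)" for x
  have w: "w x = a T \<bullet> x + b T" if T: "T \<in> \<T>" "x \<in> T" for T x
  proof -
    define S where "S = (SOME T. T \<in> \<T> \<and> x \<in> T)"
    have "S \<in> \<T> \<and> x \<in> S"
      unfolding S_def by (rule someI[of _ T]) (use T in blast)
    then have "a S \<bullet> x + b S = a T \<bullet> x + b T" using agree[of S T x] T by blast
    then show ?thesis by (simp add: w_def Let_def flip: S_def)
  qed
  have "continuous_on (\<Union>T\<in>\<T>. T) w"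
  proof (rule continuous_on_closed_Union)
    fix T assume T: "T \<in> \<T>"
    then show "closed T" by (rule mesh_closed)
    have "continuous_on T (\<lambda>x. a T \<bullet> x + b T)" by (intro continuous_intros)
    then show "continuous_on T w" by (rule continuous_on_eq) (use w[OF T] in simp)
  qed (rule finite_mesh)
  then have "continuous_on (closure \<Omega>) w" using Union_mesh by simp
  moreover have "\<forall>T\<in>\<T>. \<exists>p\<in>P1. \<forall>x\<in>T. w x = p x"
  proof
    fix T assume T: "T \<in> \<T>"
    have "(\<lambda>x. a T \<bullet> x + b T) \<in> P1" unfolding P1_def by blast
    then show "\<exists>p\<in>P1. \<forall>x\<in>T. w x = p x" using w[OF T] by (intro bexI[of _ "\<lambda>x. a T \<bullet> x + b T"]) auto
  qed
  moreover have "w v = f v" if v: "v \<in> nodes \<T>" for v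
  proof -
    obtain T where T: "T \<in> \<T>" "v extreme_point_of T" using v by (auto simp: nodes_def)
    then have "v \<in> T" by (simp add: extreme_point_of_def)
    then show ?thesis using w[OF T(1)] ab[OF T] by simp
  qed
  ultimately show ?thesis by (auto simp: P1_space_def)
qed

lemma P1_space_eq_if_nodes_eq:
  assumes u: "u \<in> P1_space \<Omega> \<T>" and v: "v \<in> P1_space \<Omega> \<T>"
    and eq: "\<And>z. z \<in> nodes \<T> \<Longrightarrow> u z = v z" and x: "x \<in> closure \<Omega>"
  shows "u x = v x"
proof -
  obtain a b where 1: "\<And>T x. T \<in> \<T> \<Longrightarrow> x \<in> T \<Longrightarrow> u x = a T \<bullet> x + b T"
    using P1_space_affine_pieces[OF u] by blast
  obtain a' b' where 2: "\<And>T x. T \<in> \<T> \<Longrightarrow> x \<in> T \<Longrightarrow> v x = a' T \<bullet> x + b' T"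
    using P1_space_affine_pieces[OF v] by blast
  obtain T where T: "T \<in> \<T>" "x \<in> T" using x Union_mesh by blast
  have "a T \<bullet> x + b T = a' T \<bullet> x + b' T"
  proof (rule affine_eq_on_extreme_points[OF mesh_compact[OF T(1)] mesh_convex[OF T(1)] _ T(2)])
    fix z assume z: "z extreme_point_of T"
    then have "z \<in> T" "z \<in> nodes \<T>" using T(1) by (auto simp: nodes_def extreme_point_of_def)
    then show "a T \<bullet> z + b T = a' T \<bullet> z + b' T"
      using 1[OF T(1) \<open>z \<in> T\<close>] 2[OF T(1) \<open>z \<in> T\<close>] eq[of z] by simp
  qed
  then show ?thesis using 1[OF T] 2[OF T] by simp
qed

end

section \<open>Clement interpolation\<close>

lemma affine_zero_on_open:
  fixes a :: "real^'n"
  assumes U: "open U" "x \<in> U" and z: "\<And>y. y \<in> U \<Longrightarrow> a \<bullet> y + b = 0"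
  shows "a = 0 \<and> b = 0"
proof -
  obtain e where e: "e > 0" "cball x e \<subseteq> U" using U by (auto simp: open_contains_cball)
  define t where "t = e / (norm a + 1)"
  have t: "t > 0" using e(1) by (simp add: t_def add_nonneg_pos)
  have "norm a / (norm a + 1) \<le> 1" by (simp add: divide_le_eq_1 add_nonneg_pos)
  then have "e * (norm a / (norm a + 1)) \<le> e * 1" using e(1) by (intro mult_left_mono) auto
  then have "norm (t *\<^sub>R a) \<le> e"
    using t e(1) by (simp add: t_def)
  then have "x + t *\<^sub>R a \<in> U" using e(2) by (auto simp: dist_norm subset_iff)
  then have "a \<bullet> (x + t *\<^sub>R a) + b = 0" "a \<bullet> x + b = 0" using z U(2) by auto
  then have "a \<bullet> x + t * (a \<bullet> a) + b = 0" by (simp add: inner_add_right)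
  then have "t * (a \<bullet> a) = 0" using \<open>a \<bullet> x + b = 0\<close> by linarith
  then show ?thesis using t \<open>a \<bullet> x + b = 0\<close> by simp
qed

lemma integrable_lebesgue_on_subset:
  fixes f :: "real^'n \<Rightarrow> real"
  assumes f: "integrable (lebesgue_on \<Omega>) f" and "\<Omega> \<in> sets lebesgue" "D \<in> sets lebesgue" "D \<subseteq> \<Omega>"
  shows "integrable (lebesgue_on D) f"
proof -
  have "integrable lebesgue (\<lambda>x. if x \<in> \<Omega> then f x else 0)"
    using f assms(2) by (simp add: Lebesgue_Measure.integrable_restrict_UNIV)
  from integrable_mult_indicator[OF assms(3) this]
  have "integrable lebesgue (\<lambda>x. if x \<in> D then f x else 0)"
    by (rule Bochner_Integration.integrable_cong[THEN iffD1, rotated -1]) (use assms(4) in \<open>auto simp: indicator_def\<close>)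
  then show ?thesis using assms(3) by (simp add: Lebesgue_Measure.integrable_restrict_UNIV)
qed

text \<open>
  Affine functions are parametrized by \<open>(real^'n) \<times> real\<close>. An affine function that vanishes almost
  everywhere on a set with interior points is zero, so the Gram operator \<open>A\<close> is injective, hence
  surjective, and every linear functional is represented by the inner product of \<open>L2\<close>.
\<close>

lemma affine_L2_projection:
  fixes v :: "real^'n \<Rightarrow> real"
  assumes D: "D \<in> sets lebesgue" "bounded D" and U: "open U" "U \<noteq> {}" "U \<subseteq> D"
    and v: "integrable (lebesgue_on D) v"
  shows "\<exists>p\<in>P1. \<forall>q\<in>P1. (LINT x|lebesgue_on D. (v x - p x) * q x) = 0"
proof -
  define P :: "(real^'n) \<times> real \<Rightarrow> real^'n \<Rightarrow> real" where "P c x = fst c \<bullet> x + snd c" for c x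
  obtain R where R: "\<And>x. x \<in> D \<Longrightarrow> norm x \<le> R" using D(2) by (auto simp: bounded_iff)
  note fin = finite_measure_lebesgue_on[OF D(2,1)]
  have Pm: "P c \<in> borel_measurable (lebesgue_on D)" for c
    unfolding P_def[abs_def] by (intro continuous_measurable_lebesgue_on continuous_intros)
  have Pb: "AE x in lebesgue_on D. \<bar>P c x\<bar> \<le> norm (fst c) * R + \<bar>snd c\<bar>" for c
  proof (rule AE_I2)
    fix x assume "x \<in> space (lebesgue_on D)"
    then have x: "x \<in> D" by (simp add: space_restrict_space)
    have "\<bar>P c x\<bar> \<le> \<bar>fst c \<bullet> x\<bar> + \<bar>snd c\<bar>" by (simp add: P_def abs_triangle_ineq)
    also have "\<bar>fst c \<bullet> x\<bar> \<le> norm (fst c) * norm x" by (rule Cauchy_Schwarz_ineq2)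
    also have "\<dots> \<le> norm (fst c) * R" using R[OF x] by (intro mult_left_mono) auto
    finally show "\<bar>P c x\<bar> \<le> norm (fst c) * R + \<bar>snd c\<bar>" by simp
  qed
  have Pint: "integrable (lebesgue_on D) (P c)" for c
    using Pb[of c] Pm[of c]
    by (intro finite_measure.integrable_const_bound[OF fin, of _ "norm (fst c) * R + \<bar>snd c\<bar>"]) simp_all
  have int: "integrable (lebesgue_on D) (\<lambda>x. f x * P c x)" if "integrable (lebesgue_on D) f" for f c
    by (rule integrable_mult_bounded[OF that Pm Pb])
  have P_add: "P (c + d) x = P c x + P d x" "P (r *\<^sub>R c) x = r * P c x" for c d r x
    by (auto simp: P_def inner_add_left algebra_simps)
  define B where "B c d = (LINT x|lebesgue_on D. P c x * P d x)" for c d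
  define l where "l c = (LINT x|lebesgue_on D. v x * P c x)" for c
  have B1: "linear (\<lambda>c. B c d)" for d
    by (rule linearI) (simp_all add: B_def P_add distrib_right mult.assoc int[OF Pint])
  have Bsym: "B c d = B d c" for c d
    unfolding B_def by (subst mult.commute) (rule refl)
  have B2: "linear (B c)" for c
  proof -
    have "B c = (\<lambda>d. B d c)" by (rule ext) (rule Bsym)
    then show ?thesis using B1[of c] by simp
  qed
  have l: "linear l"
  proof (rule linearI)
    show "l (c + d) = l c + l d" for c d
      by (simp add: l_def P_add distrib_left int[OF v])
    have "v x * P (r *\<^sub>R c) x = r * (v x * P c x)" for r c x by (simp add: P_add)
    then show "l (r *\<^sub>R c) = r *\<^sub>R l c" for r c unfolding l_def by (simp only: integral_mult_right_zero real_scaleR_def)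
  qed
  have expand: "F d = (\<Sum>i\<in>Basis. (d \<bullet> i) * F i)" if "linear F" for F :: "(real^'n) \<times> real \<Rightarrow> real" and d
  proof -
    have "F d = F (\<Sum>i\<in>Basis. (d \<bullet> i) *\<^sub>R i)" by (simp add: euclidean_representation)
    also have "\<dots> = (\<Sum>i\<in>Basis. (d \<bullet> i) * F i)"
      using that by (simp add: linear_sum linear_scale)
    finally show ?thesis .
  qed
  define A where "A c = (\<Sum>i\<in>Basis. B c i *\<^sub>R i)" for c
  have A: "A c \<bullet> d = B c d" for c d
    using expand[OF B2[of c], of d] by (simp add: A_def inner_sum_left inner_commute[of d] mult.commute)
  have linA: "linear A"
    by (rule linearI) (simp_all add: A_def linear_add[OF B1] linear_scale[OF B1] scaleR_left_distrib
      sum.distrib scaleR_sum_right)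
  have "inj A"
  proof (subst linear_injective_0[OF linA], intro allI impI)
    fix c assume "A c = 0"
    then have "B c c = 0" using A[of c c] by simp
    then have "AE x in lebesgue_on D. P c x * P c x = 0"
      using int[OF Pint] integral_nonneg_eq_0_iff_AE[of "lebesgue_on D" "\<lambda>x. P c x * P c x"] by (simp add: B_def)
    then have ae: "AE x in lebesgue. x \<in> D \<longrightarrow> P c x = 0"
      using D(1) by (simp add: AE_restrict_space_iff)
    have "{y\<in>U. P c y \<noteq> 0} = {}"
    proof (rule ccontr)
      assume ne: "{y\<in>U. P c y \<noteq> 0} \<noteq> {}"
      have "{y\<in>U. P c y \<noteq> 0} = U \<inter> (P c -` (- {0}))" by auto
      moreover have "open (P c -` (- {0}))"
        unfolding P_def[abs_def] by (intro open_vimage continuous_intros)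
      ultimately have op: "open {y\<in>U. P c y \<noteq> 0}" using U(1) by auto
      obtain N where N: "{x \<in> space lebesgue. \<not> (x \<in> D \<longrightarrow> P c x = 0)} \<subseteq> N" "N \<in> null_sets lebesgue"
        using ae by (auto simp: eventually_ae_filter)
      then have "negligible N" by (simp add: negligible_iff_null_sets)
      then have "negligible {y\<in>U. P c y \<noteq> 0}"
        by (rule negligible_subset) (use N(1) U(3) in auto)
      then show False using open_not_negligible[OF op ne] by blast
    qed
    then have "\<And>y. y \<in> U \<Longrightarrow> fst c \<bullet> y + snd c = 0" by (auto simp: P_def)
    moreover obtain y where "y \<in> U" using U(2) by blast
    ultimately have "fst c = 0 \<and> snd c = 0" by (rule affine_zero_on_open[OF U(1), rotated])
    then show "c = 0" by (simp add: prod_eq_iff)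
  qed
  then have "surj A" using linear_injective_imp_surjective[OF linA] by simp
  from surjD[OF this, of "\<Sum>i\<in>Basis. l i *\<^sub>R i"] obtain c where "(\<Sum>i\<in>Basis. l i *\<^sub>R i) = A c" ..
  note c = this[symmetric]
  have Bl: "B c d = l d" for d
  proof -
    have "B c d = (\<Sum>i\<in>Basis. l i * (i \<bullet> d))"
      unfolding A[symmetric] c by (simp add: inner_sum_left)
    also have "\<dots> = (\<Sum>i\<in>Basis. (d \<bullet> i) * l i)"
      by (rule sum.cong) (simp_all add: inner_commute mult.commute)
    also have "\<dots> = l d" by (rule expand[OF l, symmetric])
    finally show ?thesis .
  qed
  show ?thesis
  proof (rule bexI[of _ "P c"], rule ballI)
    show "P c \<in> P1" by (auto simp: P1_def P_def)
    fix q :: "real^'n \<Rightarrow> real" assume "q \<in> P1"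
    then obtain a b where "\<And>x. q x = a \<bullet> x + b" by (auto simp: P1_def)
    then have q: "q = P (a, b)" by (auto simp: P_def)
    have "(LINT x|lebesgue_on D. (v x - P c x) * q x) = l (a, b) - B c (a, b)"
      unfolding q l_def B_def left_diff_distrib using int[OF v] int[OF Pint] by simp
    then show "(LINT x|lebesgue_on D. (v x - P c x) * q x) = 0" by (simp add: Bl)
  qed
qed

context triangulated_domain
begin

lemma clement_in_P1_space:
  assumes v: "v \<in> L2 (lebesgue_on \<Omega>)"
  shows "clement \<Omega> \<T> v \<in> P1_space \<Omega> \<T>"
proof -
  have vi: "integrable (lebesgue_on \<Omega>) v" by (rule L2_integrable[OF finite_measure_domain v])
  have "\<exists>p\<in>P1. \<forall>q\<in>P1. (LINT x|lebesgue_on (patch \<T> z \<inter> \<Omega>). (v x - p x) * q x) = 0"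
    if z: "z \<in> nodes \<T>" for z
  proof -
    obtain T where T: "T \<in> \<T>" "z extreme_point_of T" using z by (auto simp: nodes_def)
    then have zT: "z \<in> T" by (simp add: extreme_point_of_def)
    have "closed (patch \<T> z)" unfolding patch_def using finite_mesh mesh_closed by (intro closed_Union) auto
    then have s: "patch \<T> z \<inter> \<Omega> \<in> sets lebesgue"
      using domain_sets by (intro sets.Int) (auto intro: sets_completionI_sets)
    show ?thesis
    proof (rule affine_L2_projection[OF s])
      show "bounded (patch \<T> z \<inter> \<Omega>)" using bounded_domain by (auto intro: bounded_subset)
      show "open (interior T \<inter> \<Omega>)" using open_domain by auto
      show "interior T \<inter> \<Omega> \<noteq> {}"
      proof -
        have "interior T \<inter> closure \<Omega> \<noteq> {}"
          using mesh_interior_nonempty[OF T(1)] interior_subset[of T] T(1) Union_mesh by blast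
        then show ?thesis using open_Int_closure_eq_empty[OF open_interior, of T \<Omega>] by auto
      qed
      show "interior T \<inter> \<Omega> \<subseteq> patch \<T> z \<inter> \<Omega>"
        using interior_subset[of T] T(1) zT by (auto simp: patch_def)
      show "integrable (lebesgue_on (patch \<T> z \<inter> \<Omega>)) v"
        by (rule integrable_lebesgue_on_subset[OF vi domain_sets s]) auto
    qed
  qed
  then obtain p where p: "\<And>z. z \<in> nodes \<T> \<Longrightarrow> p z \<in> P1 \<and>
      (\<forall>q\<in>P1. (LINT x|lebesgue_on (patch \<T> z \<inter> \<Omega>). (v x - p z x) * q x) = 0)"
    unfolding Bex_def by metis
  obtain w where w: "w \<in> P1_space \<Omega> \<T>" "\<And>z. z \<in> nodes \<T> \<Longrightarrow> w z = p z z"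
    using P1_space_interpolation[of "\<lambda>z. p z z"] by blast
  have "\<exists>w. w \<in> P1_space \<Omega> \<T> \<and> (\<forall>a\<in>nodes \<T>. \<exists>p\<in>P1.
      (\<forall>q\<in>P1. (LINT x|lebesgue_on (patch \<T> a \<inter> \<Omega>). (v x - p x) * q x) = 0) \<and> w a = p a)"
    using p w by blast
  from someI_ex[OF this] show ?thesis unfolding clement_def by blast
qed

end

section \<open>A finite-dimensional minimax principle\<close>

lemma bounded_coefficients_subsequence:
  fixes x :: "nat \<Rightarrow> nat \<Rightarrow> real"
  assumes "\<And>n k. k < m \<Longrightarrow> \<bar>x n k\<bar> \<le> C"
  shows "\<exists>r c. strict_mono (r :: nat \<Rightarrow> nat) \<and> (\<forall>k<m. (\<lambda>n. x (r n) k) \<longlonglongrightarrow> c k)"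
  using assms
proof (induction m)
  case 0
  then show ?case by (auto intro!: exI[of _ id] strict_mono_id simp: id_def)
next
  case (Suc m)
  then obtain r c where r: "strict_mono (r :: nat \<Rightarrow> nat)" "\<And>k. k < m \<Longrightarrow> (\<lambda>n. x (r n) k) \<longlonglongrightarrow> c k"
    by (metis less_SucI)
  have mem: "\<forall>n. x (r n) m \<in> {-C..C}" using Suc.prems[of m] by (auto simp: abs_le_iff) (metis lessI minus_le_iff)+
  have "seq_compact {-C..C}" by (intro compact_imp_seq_compact) simp
  from seq_compactE[OF this mem] obtain l s
    where s: "strict_mono (s :: nat \<Rightarrow> nat)" "((\<lambda>n. x (r n) m) \<circ> s) \<longlonglongrightarrow> l" by blast
  have "(\<lambda>n. x (r (s n)) k) \<longlonglongrightarrow> (c(m := l)) k" if "k < Suc m" for k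
  proof (cases "k = m")
    case True
    then show ?thesis using s(2) by (simp add: o_def)
  next
    case False
    then have "(\<lambda>n. x (r n) k) \<longlonglongrightarrow> c k" using r(2) that by simp
    from LIMSEQ_subseq_LIMSEQ[OF this s(1)] show ?thesis using False by (simp add: o_def)
  qed
  then show ?case
    using strict_mono_o[OF r(1) s(1)] by (intro exI[of _ "r \<circ> s"] exI[of _ "c(m := l)"]) (simp add: o_def)
qed

lemma quadratic_form_coordinate_shift:
  fixes B :: "nat \<Rightarrow> nat \<Rightarrow> real"
  assumes k: "k < m" and sym: "\<And>i j. B i j = B j i"
  shows "(\<Sum>i<m. \<Sum>j<m. (c(k := c k + t)) i * (c(k := c k + t)) j * B i j)
    = (\<Sum>i<m. \<Sum>j<m. c i * c j * B i j) + 2 * t * (\<Sum>i<m. c i * B i k) + t\<^sup>2 * B k k"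
proof -
  define d where "d i = (if i = k then t else 0)" for i
  have c: "(c(k := c k + t)) i = c i + d i" for i by (simp add: d_def)
  have "(\<Sum>i<m. \<Sum>j<m. (c(k := c k + t)) i * (c(k := c k + t)) j * B i j)
      = (\<Sum>i<m. \<Sum>j<m. c i * c j * B i j) + (\<Sum>i<m. \<Sum>j<m. c i * d j * B i j)
        + (\<Sum>i<m. \<Sum>j<m. d i * c j * B i j) + (\<Sum>i<m. \<Sum>j<m. d i * d j * B i j)"
    unfolding c by (simp add: algebra_simps sum.distrib)
  also have "(\<Sum>i<m. \<Sum>j<m. c i * d j * B i j) = (\<Sum>i<m. \<Sum>j<m. if j = k then t * (c i * B i k) else 0)"
    by (intro sum.cong) (auto simp: d_def)
  also have "\<dots> = t * (\<Sum>i<m. c i * B i k)" using k by (simp add: sum_distrib_left)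
  also have "(\<Sum>i<m. \<Sum>j<m. d i * c j * B i j) = (\<Sum>i<m. if i = k then t * (\<Sum>j<m. c j * B k j) else 0)"
    by (intro sum.cong) (auto simp: d_def sum_distrib_left mult.assoc)
  also have "\<dots> = t * (\<Sum>i<m. c i * B i k)" using k sym[of k] by simp
  also have "(\<Sum>i<m. \<Sum>j<m. d i * d j * B i j) = (\<Sum>i<m. if i = k then t * t * B k k else 0)"
  proof (rule sum.cong[OF refl])
    fix i
    have "(\<Sum>j<m. d i * d j * B i j) = (\<Sum>j<m. if j = k then d i * t * B i k else 0)"
      by (rule sum.cong) (auto simp: d_def)
    then show "(\<Sum>j<m. d i * d j * B i j) = (if i = k then t * t * B k k else 0)"
      using k by (simp add: d_def)
  qed
  also have "\<dots> = t\<^sup>2 * B k k" using k by (simp add: power2_eq_square)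
  finally show ?thesis by simp
qed

text \<open>
  Here \<open>H g\<close> is a concave quadratic function of the coefficients for every control \<open>g\<close>, and
  \<open>s c\<close> is a control that minimizes \<open>H g c\<close>. The dual function \<open>D c = H (s c) c\<close> is
  bounded above by \<open>H gc\<close>, so a maximizing sequence is bounded and has a limit \<open>c\<close> along a
  subsequence; the limit is a maximizer, because \<open>D \<le> H (s c)\<close> and the latter is continuous. For
  the control \<open>g\<close> that is minimizing at a point shifted from \<open>c\<close> by \<open>t\<close> in the
  coordinate \<open>k\<close>, the chain \<open>H g (shifted c) \<le> D c \<le> H g c\<close> bounds the derivative of
  \<open>H g\<close> at \<open>c\<close> in that coordinate by a multiple of \<open>t\<close>, from above or below according
  to the sign of \<open>t\<close>. As \<open>t\<close> tends to 0, the derivative for the control \<open>s c\<close> vanishes.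
  For a one-element set of controls this is the Lax-Milgram lemma for a symmetric form.
\<close>

lemma finite_dimensional_saddle_point:
  fixes kk :: "'g \<Rightarrow> real" and l :: "'g \<Rightarrow> nat \<Rightarrow> real" and B :: "'g \<Rightarrow> nat \<Rightarrow> nat \<Rightarrow> real"
    and s :: "(nat \<Rightarrow> real) \<Rightarrow> 'g" and m :: nat
  defines "H \<equiv> \<lambda>g c. kk g + 2 * (\<Sum>j<m. c j * l g j) - (\<Sum>i<m. \<Sum>j<m. c i * c j * B g i j)"
  assumes sA: "\<And>c. s c \<in> A" and min: "\<And>g c. g \<in> A \<Longrightarrow> H (s c) c \<le> H g c"
    and sym: "\<And>g i j. g \<in> A \<Longrightarrow> B g i j = B g j i"
    and coercive: "gc \<in> A" "q > 0" "\<And>c. q * (\<Sum>i<m. (c i)\<^sup>2) \<le> (\<Sum>i<m. \<Sum>j<m. c i * c j * B gc i j)"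
    and diag: "\<And>g k. g \<in> A \<Longrightarrow> k < m \<Longrightarrow> \<bar>B g k k\<bar> \<le> b"
    and cont: "\<And>c k. k < m \<Longrightarrow>
      ((\<lambda>t. l (s (c(k := c k + t))) k - (\<Sum>i<m. c i * B (s (c(k := c k + t))) i k))
        \<longlongrightarrow> l (s c) k - (\<Sum>i<m. c i * B (s c) i k)) (at 0)"
  shows "\<exists>c. \<forall>k<m. l (s c) k = (\<Sum>i<m. c i * B (s c) i k)"
proof -
  define D where "D c = H (s c) c" for c
  define M where "M = kk gc + (\<Sum>j<m. 2 / q * (l gc j)\<^sup>2)"
  have upper: "D c \<le> M - q / 2 * (\<Sum>i<m. (c i)\<^sup>2)" for c
  proof -
    have "2 * (c j * l gc j) \<le> q / 2 * (c j)\<^sup>2 + 2 / q * (l gc j)\<^sup>2" for j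
    proof -
      \<comment> \<open>The linear term is absorbed into half of the coercive quadratic term.\<close>
      have "0 \<le> (q * c j - 2 * l gc j)\<^sup>2 / (2 * q)" using coercive(2) by simp
      also have "\<dots> = q / 2 * (c j)\<^sup>2 + 2 / q * (l gc j)\<^sup>2 - 2 * (c j * l gc j)"
        using coercive(2) by (simp add: power2_eq_square field_simps)
      finally show ?thesis by simp
    qed
    then have "(\<Sum>j<m. 2 * (c j * l gc j)) \<le> (\<Sum>j<m. q / 2 * (c j)\<^sup>2 + 2 / q * (l gc j)\<^sup>2)"
      by (rule sum_mono)
    then have *: "2 * (\<Sum>j<m. c j * l gc j) \<le> q / 2 * (\<Sum>j<m. (c j)\<^sup>2) + (\<Sum>j<m. 2 / q * (l gc j)\<^sup>2)"
      by (simp add: sum.distrib sum_distrib_left)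
    have "D c \<le> H gc c" unfolding D_def by (rule min[OF coercive(1)])
    also have "\<dots> \<le> kk gc + 2 * (\<Sum>j<m. c j * l gc j) - q * (\<Sum>i<m. (c i)\<^sup>2)"
      using coercive(3)[of c] by (simp add: H_def)
    also have "\<dots> \<le> M - q / 2 * (\<Sum>i<m. (c i)\<^sup>2)" using * by (simp add: M_def)
    finally show ?thesis .
  qed
  have nn: "0 \<le> q / 2 * (\<Sum>i<m. (c i)\<^sup>2)" for c
    using coercive(2) by (intro mult_nonneg_nonneg sum_nonneg) auto
  have bdd: "bdd_above (range D)"
  proof (rule bdd_aboveI[of _ M])
    fix y assume "y \<in> range D"
    then obtain c where "y = D c" by blast
    then show "y \<le> M" using upper[of c] nn[of c] by linarith
  qed
  define S where "S = (SUP c. D c)"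
  have leS: "D c \<le> S" for c unfolding S_def using bdd by (intro cSUP_upper) auto
  have "\<exists>c. S - 1 / real (Suc n) < D c" for n
  proof -
    have "S - 1 / real (Suc n) < Sup (range D)" by (simp add: S_def)
    then show ?thesis using less_cSUP_iff[OF _ bdd] by auto
  qed
  then obtain x where x: "\<And>n. S - 1 / real (Suc n) < D (x n)" by metis
  have bound: "\<bar>x n k\<bar> \<le> (M - S + 1) * 2 / q + 1" if k: "k < m" for n k
  proof -
    have "1 / real (Suc n) \<le> 1" by simp
    then have "q / 2 * (\<Sum>i<m. (x n i)\<^sup>2) \<le> M - S + 1"
      using upper[of "x n"] x[of n] by linarith
    then have "(\<Sum>i<m. (x n i)\<^sup>2) \<le> (M - S + 1) * 2 / q"
      using coercive(2) by (simp add: field_simps)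
    moreover have "(x n k)\<^sup>2 \<le> (\<Sum>i<m. (x n i)\<^sup>2)"
      using k by (intro member_le_sum) auto
    moreover have "\<bar>x n k\<bar> \<le> (x n k)\<^sup>2 + 1"
    proof -
      have "0 \<le> (\<bar>x n k\<bar> - 1)\<^sup>2 + \<bar>x n k\<bar>" by simp
      then show ?thesis by (simp add: power2_diff)
    qed
    ultimately show ?thesis by linarith
  qed
  obtain r c where r: "strict_mono (r :: nat \<Rightarrow> nat)" and lim: "\<And>k. k < m \<Longrightarrow> (\<lambda>n. x (r n) k) \<longlonglongrightarrow> c k"
    using bounded_coefficients_subsequence[of m x, OF bound] by blast
  have "S \<le> D c"
  proof (rule LIMSEQ_le)
    show "(\<lambda>n. S - 1 / real (Suc (r n))) \<longlonglongrightarrow> S"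
    proof -
      have "(\<lambda>n. S - 1 / real (Suc n)) \<longlonglongrightarrow> S - 0"
        by (intro tendsto_diff tendsto_const LIMSEQ_Suc[OF lim_1_over_n])
      from LIMSEQ_subseq_LIMSEQ[OF this r] show ?thesis by (simp add: o_def)
    qed
    show "(\<lambda>n. H (s c) (x (r n))) \<longlonglongrightarrow> D c"
      unfolding D_def H_def using lim by (intro tendsto_intros) auto
    show "\<exists>N. \<forall>n\<ge>N. S - 1 / real (Suc (r n)) \<le> H (s c) (x (r n))"
    proof (intro exI allI impI)
      fix n
      have "D (x (r n)) \<le> H (s c) (x (r n))" unfolding D_def by (rule min[OF sA])
      then show "S - 1 / real (Suc (r n)) \<le> H (s c) (x (r n))" using x[of "r n"] by linarith
    qed
  qed
  then have max: "D c' \<le> D c" for c' using leS[of c'] by linarith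
  have "l (s c) k = (\<Sum>i<m. c i * B (s c) i k)" if k: "k < m" for k
  proof -
    define R where "R t = l (s (c(k := c k + t))) k - (\<Sum>i<m. c i * B (s (c(k := c k + t))) i k)" for t
    define R0 where "R0 = l (s c) k - (\<Sum>i<m. c i * B (s c) i k)"
    have lim: "(R \<longlongrightarrow> R0) (at 0)" unfolding R_def[abs_def] R0_def by (rule cont[OF k])
    \<comment> \<open>\<open>R t\<close> is half of the derivative at \<open>c\<close> for the control of the shifted point.\<close>
    have key: "2 * t * R t \<le> t\<^sup>2 * b" for t
    proof -
      let ?c = "c(k := c k + t)"
      let ?g = "s ?c"
      have lin: "(\<Sum>j<m. ?c j * l ?g j) = (\<Sum>j<m. c j * l ?g j) + t * l ?g k"
      proof -
        have "(\<Sum>j<m. ?c j * l ?g j) = (\<Sum>j<m. c j * l ?g j + (if j = k then t * l ?g k else 0))"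
          by (rule sum.cong) (auto simp: algebra_simps)
        then show ?thesis using k by (simp add: sum.distrib)
      qed
      have "H ?g ?c = H ?g c + 2 * t * R t - t\<^sup>2 * B ?g k k"
        unfolding H_def R_def lin quadratic_form_coordinate_shift[of k m "B ?g", OF k sym[OF sA]]
        by (simp add: algebra_simps)
      moreover have "H ?g ?c \<le> H ?g c"
        using max[of ?c] min[OF sA, of c ?c] unfolding D_def by linarith
      ultimately have "2 * t * R t \<le> t\<^sup>2 * B ?g k k" by linarith
      also have "\<dots> \<le> t\<^sup>2 * b" using diag[OF sA k, of ?c] by (intro mult_left_mono) auto
      finally show ?thesis .
    qed
    have "R0 \<le> 0"
    proof (rule tendsto_le[of "at_right 0"])
      show "((\<lambda>t. t * b / 2) \<longlongrightarrow> 0) (at_right 0)" by (auto intro!: tendsto_eq_intros)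
      show "(R \<longlongrightarrow> R0) (at_right 0)" using lim by (rule filterlim_mono[OF _ order_refl at_le]) simp
      show "\<forall>\<^sub>F t in at_right 0. R t \<le> t * b / 2"
        unfolding eventually_at_right_field
      proof (intro exI[of _ 1] conjI allI impI)
        fix t :: real assume "0 < t" "t < 1"
        then show "R t \<le> t * b / 2" using key[of t] by (simp add: power2_eq_square)
      qed simp
    qed simp
    moreover have "0 \<le> R0"
    proof (rule tendsto_le[of "at_left 0"])
      show "((\<lambda>t. t * b / 2) \<longlongrightarrow> 0) (at_left 0)" by (auto intro!: tendsto_eq_intros)
      show "(R \<longlongrightarrow> R0) (at_left 0)" using lim by (rule filterlim_mono[OF _ order_refl at_le]) simp
      show "\<forall>\<^sub>F t in at_left 0. t * b / 2 \<le> R t"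
        unfolding eventually_at_left_field
      proof (intro exI[of _ "-1"] conjI allI impI)
        fix t :: real assume "-1 < t" "t < 0"
        then show "t * b / 2 \<le> R t" using key[of t] by (simp add: power2_eq_square)
      qed simp
    qed simp
    ultimately show ?thesis by (simp add: R0_def)
  qed
  then show ?thesis by blast
qed

section \<open>Orthonormal bases\<close>

locale semi_inner_product_on =
  fixes V :: "('a \<Rightarrow> real) set" and ip :: "('a \<Rightarrow> real) \<Rightarrow> ('a \<Rightarrow> real) \<Rightarrow> real"
  assumes V_zero: "(\<lambda>x. 0) \<in> V"
    and V_lincomb: "u \<in> V \<Longrightarrow> v \<in> V \<Longrightarrow> (\<lambda>x. a * u x + b * v x) \<in> V"
    and ip_lincomb: "u \<in> V \<Longrightarrow> v \<in> V \<Longrightarrow> w \<in> V \<Longrightarrow> ip (\<lambda>x. a * u x + b * v x) w = a * ip u w + b * ip v w"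
    and ip_sym: "u \<in> V \<Longrightarrow> v \<in> V \<Longrightarrow> ip u v = ip v u"
    and ip_nonneg: "u \<in> V \<Longrightarrow> ip u u \<ge> 0"
begin

lemma V_sum: "finite I \<Longrightarrow> (\<And>i. i \<in> I \<Longrightarrow> f i \<in> V) \<Longrightarrow> (\<lambda>x. \<Sum>i\<in>I. c i * f i x) \<in> V"
proof (induction rule: finite_induct)
  case (insert i I)
  then show ?case using V_lincomb[of "f i" "\<lambda>x. \<Sum>i\<in>I. c i * f i x" "c i" 1] by simp
qed (simp add: V_zero)

lemma ip_sum: "finite I \<Longrightarrow> (\<And>i. i \<in> I \<Longrightarrow> f i \<in> V) \<Longrightarrow> w \<in> V \<Longrightarrow>
    ip (\<lambda>x. \<Sum>i\<in>I. c i * f i x) w = (\<Sum>i\<in>I. c i * ip (f i) w)"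
proof (induction rule: finite_induct)
  case empty
  then show ?case using ip_lincomb[OF V_zero V_zero, of w 0 0] by simp
next
  case (insert i I)
  then show ?case
    using ip_lincomb[of "f i" "\<lambda>x. \<Sum>i\<in>I. c i * f i x" w "c i" 1] V_sum[of I f c] by simp
qed

text \<open>
  Gram-Schmidt orthogonalization. Elements of the function space matter only through their values on
  \<open>X\<close>, so a vector of length zero is one that vanishes on \<open>X\<close>.
\<close>

lemma orthonormal_basis:
  assumes definite: "\<And>u. u \<in> V \<Longrightarrow> ip u u = 0 \<Longrightarrow> \<forall>x\<in>X. u x = 0"
    and F: "finite F" "F \<subseteq> V"
  shows "\<exists>(m::nat) e. (\<forall>k<m. e k \<in> V) \<and> (\<forall>j<m. \<forall>k<m. ip (e j) (e k) = (if j = k then 1 else 0)) \<and>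
    (\<forall>u\<in>F. \<exists>c. \<forall>x\<in>X. u x = (\<Sum>k<m. c k * e k x))"
  using F
proof (induction rule: finite_induct)
  case empty
  show ?case by (intro exI[of _ 0]) simp
next
  case (insert h F)
  then have h: "h \<in> V" by simp
  from insert obtain m :: nat and e where e: "\<And>k. k < m \<Longrightarrow> e k \<in> V"
    and on: "\<And>j k. j < m \<Longrightarrow> k < m \<Longrightarrow> ip (e j) (e k) = (if j = k then 1 else 0)"
    and span: "\<And>u. u \<in> F \<Longrightarrow> \<exists>c. \<forall>x\<in>X. u x = (\<Sum>k<m. c k * e k x)"
    by auto blast
  define p where "p x = (\<Sum>k<m. ip h (e k) * e k x)" for x
  have p: "p \<in> V" unfolding p_def by (rule V_sum) (use e in auto)
  define r where "r x = 1 * h x + (- 1) * p x" for x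
  have r: "r \<in> V" unfolding r_def by (rule V_lincomb[OF h p])
  have ipp: "ip p (e j) = ip h (e j)" if j: "j < m" for j
  proof -
    have "ip p (e j) = (\<Sum>k<m. ip h (e k) * ip (e k) (e j))"
      unfolding p_def by (rule ip_sum) (use e j in auto)
    also have "\<dots> = (\<Sum>k<m. if k = j then ip h (e j) else 0)"
      by (rule sum.cong) (use on j in auto)
    finally show ?thesis using j by simp
  qed
  have orth: "ip r (e j) = 0" if j: "j < m" for j
    using ip_lincomb[OF h p e[OF j], of 1 "-1"] ipp[OF j] by (simp add: r_def[abs_def])
  have hX: "h x = r x + p x" for x by (simp add: r_def)
  show ?case
  proof (cases "ip r r = 0")
    case True
    then have "\<forall>x\<in>X. h x = (\<Sum>k<m. ip h (e k) * e k x)"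
      using definite[OF r] by (simp add: hX p_def)
    then show ?thesis using e on span by (intro exI[of _ m] exI[of _ e]) auto
  next
    case False
    then have pos: "ip r r > 0" using ip_nonneg[OF r] by simp
    define n where "n = sqrt (ip r r)"
    have n: "n > 0" "n * n = ip r r" using pos by (auto simp: n_def)
    define w where "w x = (1 / n) * r x + 0 * r x" for x
    have w: "w \<in> V" unfolding w_def by (rule V_lincomb[OF r r])
    have ipw: "ip w v = ip r v / n" if "v \<in> V" for v
      using ip_lincomb[OF r r that, of "1 / n" 0] by (simp add: w_def[abs_def])
    have ww: "ip w w = 1"
    proof -
      have "n * ip r w = n * n" using ip_sym[OF r w] ipw[OF r] n by (simp add: field_simps)
      then have "ip r w = n" using n(1) by simp
      then show ?thesis using ipw[OF w] n(1) by simp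
    qed
    have we: "ip w (e j) = 0" "ip (e j) w = 0" if "j < m" for j
      using ipw[OF e[OF that]] orth[OF that] ip_sym[OF e[OF that] w] by auto
    define e' where "e' = e(m := w)"
    have "\<forall>k<Suc m. e' k \<in> V" using e w by (auto simp: e'_def)
    moreover have "\<forall>j<Suc m. \<forall>k<Suc m. ip (e' j) (e' k) = (if j = k then 1 else 0)"
      using on ww we by (auto simp: e'_def less_Suc_eq)
    moreover have "\<exists>c. \<forall>x\<in>X. u x = (\<Sum>k<Suc m. c k * e' k x)" if u: "u \<in> insert h F" for u
    proof (cases "u = h")
      case True
      have "u x = (\<Sum>k<Suc m. (if k = m then n else ip h (e k)) * e' k x)" for x
        using n True by (simp add: e'_def hX p_def w_def)
      then show ?thesis by (intro exI[of _ "\<lambda>k. if k = m then n else ip h (e k)"]) simp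
    next
      case False
      then obtain c where "\<forall>x\<in>X. u x = (\<Sum>k<m. c k * e k x)" using span u by blast
      then have "\<forall>x\<in>X. u x = (\<Sum>k<Suc m. (if k = m then 0 else c k) * e' k x)" by (simp add: e'_def)
      then show ?thesis by (intro exI[of _ "\<lambda>k. if k = m then 0 else c k"]) simp
    qed
    ultimately show ?thesis by blast
  qed
qed

end

section \<open>The projection onto the admissible matrices\<close>

lemma mat_inner_eq_inner: "N \<in> sym_matrices \<Longrightarrow> mat_inner M N = M \<bullet> N"
  by (simp add: mat_inner_def trace_def matrix_matrix_mult_def sym_matrices_def transpose_def inner_vec_def vec_eq_iff)

lemma sym_matrices_diff: "M \<in> sym_matrices \<Longrightarrow> N \<in> sym_matrices \<Longrightarrow> M - N \<in> sym_matrices"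
  by (simp add: sym_matrices_def transpose_def vec_eq_iff)

lemma matrix_quadratic_form: "(M *v \<xi>) \<bullet> \<eta> = (\<Sum>i\<in>UNIV. \<Sum>j\<in>UNIV. M $ i $ j * \<xi> $ j * \<eta> $ i)" for M :: "real^'n^'n"
  by (simp add: matrix_vector_mult_def inner_vec_def sum_distrib_right)

lemma K_set_eq:
  "K_set ql qu = {M :: real^'n^'n. (\<forall>i j. M $ i $ j = M $ j $ i) \<and>
    (\<forall>\<xi>. ql * (norm \<xi>)\<^sup>2 \<le> (M *v \<xi>) \<bullet> \<xi> \<and> (M *v \<xi>) \<bullet> \<xi> \<le> qu * (norm \<xi>)\<^sup>2)}"
  by (auto simp: K_set_def sym_matrices_def spectral_bounds_def transpose_def vec_eq_iff)

lemma convex_K_set: "convex (K_set ql qu :: (real^'n^'n) set)"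
proof (rule convexI)
  fix M N :: "real^'n^'n" and u v :: real
  assume M: "M \<in> K_set ql qu" and N: "N \<in> K_set ql qu" and uv: "0 \<le> u" "0 \<le> v" "u + v = 1"
  have eq: "((u *\<^sub>R M + v *\<^sub>R N) *v \<xi>) \<bullet> \<xi> = u * ((M *v \<xi>) \<bullet> \<xi>) + v * ((N *v \<xi>) \<bullet> \<xi>)" for \<xi>
    by (simp add: matrix_quadratic_form sum.distrib sum_distrib_left algebra_simps)
  have "ql * (norm \<xi>)\<^sup>2 \<le> ((u *\<^sub>R M + v *\<^sub>R N) *v \<xi>) \<bullet> \<xi>" for \<xi>
  proof -
    have "ql * (norm \<xi>)\<^sup>2 = u * (ql * (norm \<xi>)\<^sup>2) + v * (ql * (norm \<xi>)\<^sup>2)"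
      using uv(3) by (metis distrib_right mult_1)
    also have "\<dots> \<le> u * ((M *v \<xi>) \<bullet> \<xi>) + v * ((N *v \<xi>) \<bullet> \<xi>)"
      using M N uv by (intro add_mono mult_left_mono) (auto simp: K_set_eq)
    finally show ?thesis by (simp add: eq)
  qed
  moreover have "((u *\<^sub>R M + v *\<^sub>R N) *v \<xi>) \<bullet> \<xi> \<le> qu * (norm \<xi>)\<^sup>2" for \<xi>
  proof -
    have "u * ((M *v \<xi>) \<bullet> \<xi>) + v * ((N *v \<xi>) \<bullet> \<xi>) \<le> u * (qu * (norm \<xi>)\<^sup>2) + v * (qu * (norm \<xi>)\<^sup>2)"
      using M N uv by (intro add_mono mult_left_mono) (auto simp: K_set_eq)
    also have "\<dots> = qu * (norm \<xi>)\<^sup>2"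
      using uv(3) by (metis distrib_right mult_1)
    finally show ?thesis by (simp add: eq)
  qed
  ultimately show "u *\<^sub>R M + v *\<^sub>R N \<in> K_set ql qu"
    using M N by (simp add: K_set_eq)
qed

lemma closed_K_set: "closed (K_set ql qu :: (real^'n^'n) set)"
proof -
  have c: "continuous_on UNIV (\<lambda>M::real^'n^'n. (M *v \<xi>) \<bullet> \<xi>)" for \<xi>
    unfolding matrix_quadratic_form by (intro continuous_intros)
  show ?thesis
    unfolding K_set_eq
    by (intro closed_Collect_conj closed_Collect_all closed_Collect_eq closed_Collect_le c continuous_intros)
qed

lemma scaled_identity_in_K_set: "ql \<le> t \<Longrightarrow> t \<le> qu \<Longrightarrow> (mat t :: real^'n^'n) \<in> K_set ql qu"
proof -
  assume t: "ql \<le> t" "t \<le> qu"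
  have "(mat t *v \<xi>) \<bullet> \<xi> = t * (norm \<xi>)\<^sup>2" for \<xi> :: "real^'n"
  proof -
    have "mat t *v \<xi> = t *\<^sub>R \<xi>"
      by (simp add: vec_eq_iff matrix_vector_mult_def mat_def if_distrib[where f = "\<lambda>x. x * _"] cong: if_cong)
    then show ?thesis by (simp add: power2_norm_eq_inner)
  qed
  moreover have "(mat t :: real^'n^'n) $ i $ j = mat t $ j $ i" for i j by (simp add: mat_def)
  ultimately show ?thesis using t by (simp add: K_set_eq mult_right_mono)
qed

text \<open>
  By polarization: \<open>4 * M $ i $ j\<close> is the difference of the values of the quadratic form at
  \<open>axis i 1 + axis j 1\<close> and \<open>axis i 1 - axis j 1\<close>, both of which lie between 0 and \<open>4 * qu\<close>.
\<close>

lemma K_set_entry_le: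
  fixes M :: "real^'n^'n"
  assumes M: "M \<in> K_set ql qu" and "0 \<le> ql"
  shows "\<bar>M $ i $ j\<bar> \<le> qu"
proof -
  let ?a = "axis i 1 :: real^'n" and ?b = "axis j 1 :: real^'n"
  have qf: "(M *v axis k 1) \<bullet> axis l 1 = M $ l $ k" for k l :: 'n
    by (simp add: inner_axis matrix_vector_mult_basis column_def)
  have exp: "(M *v (?a + s *\<^sub>R ?b)) \<bullet> (?a + s *\<^sub>R ?b) = M $ i $ i + 2 * s * M $ i $ j + s\<^sup>2 * M $ j $ j" for s
  proof -
    have "(M *v (?a + s *\<^sub>R ?b)) \<bullet> (?a + s *\<^sub>R ?b) = M $ i $ i + s * M $ j $ i + s * M $ i $ j + s * (s * M $ j $ j)"
      by (simp add: matrix_vector_right_distrib matrix_vector_mult_scaleR inner_add_left inner_add_right qf distrib_left)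
    moreover have "M $ j $ i = M $ i $ j" using M unfolding K_set_eq by blast
    ultimately show ?thesis by (simp add: power2_eq_square)
  qed
  have nb: "0 \<le> (M *v \<xi>) \<bullet> \<xi> \<and> (M *v \<xi>) \<bullet> \<xi> \<le> qu * (norm \<xi>)\<^sup>2" for \<xi>
  proof -
    have "0 \<le> ql * (norm \<xi>)\<^sup>2" using assms(2) by simp
    moreover have "ql * (norm \<xi>)\<^sup>2 \<le> (M *v \<xi>) \<bullet> \<xi>" "(M *v \<xi>) \<bullet> \<xi> \<le> qu * (norm \<xi>)\<^sup>2"
      using M unfolding K_set_eq by blast+
    ultimately show ?thesis by linarith
  qed
  have qu: "qu \<ge> 0" using nb[of ?a] by simp
  have n: "(norm (?a + s *\<^sub>R ?b))\<^sup>2 \<le> 4" if "s = 1 \<or> s = -1" for s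
  proof -
    have "norm (?a + s *\<^sub>R ?b) \<le> norm ?a + norm (s *\<^sub>R ?b)" by (rule norm_triangle_ineq)
    then have "norm (?a + s *\<^sub>R ?b) \<le> 2" using that by auto
    then have "(norm (?a + s *\<^sub>R ?b))\<^sup>2 \<le> 2\<^sup>2" by (intro power_mono) auto
    then show ?thesis by simp
  qed
  have "qu * (norm (?a + 1 *\<^sub>R ?b))\<^sup>2 \<le> qu * 4" "qu * (norm (?a + (-1) *\<^sub>R ?b))\<^sup>2 \<le> qu * 4"
    by (intro mult_left_mono n qu, simp)+
  then show ?thesis
    using nb[of "?a + 1 *\<^sub>R ?b"] nb[of "?a + (-1) *\<^sub>R ?b"] unfolding exp by (simp add: abs_le_iff)
qed

lemma norm_matrix_le_sum: "norm (M :: real^'n^'n) \<le> (\<Sum>i\<in>UNIV. \<Sum>j\<in>UNIV. \<bar>M $ i $ j\<bar>)"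
proof -
  have "norm M \<le> (\<Sum>i\<in>UNIV. norm (M $ i))" unfolding norm_vec_def by (rule L2_set_le_sum) auto
  also have "\<dots> \<le> (\<Sum>i\<in>UNIV. \<Sum>j\<in>UNIV. \<bar>M $ i $ j\<bar>)" by (intro sum_mono norm_le_l1_cart)
  finally show ?thesis .
qed

lemma K_set_norm_le:
  fixes M :: "real^'n^'n"
  assumes M: "M \<in> K_set ql qu" and "0 \<le> ql"
  shows "norm M \<le> real CARD('n) * real CARD('n) * qu"
proof -
  have "(\<Sum>i\<in>UNIV. \<Sum>j\<in>UNIV. \<bar>M $ i $ j\<bar>) \<le> (\<Sum>i\<in>(UNIV::'n set). \<Sum>j\<in>(UNIV::'n set). qu)"
    using K_set_entry_le[OF assms] by (intro sum_mono)
  then show ?thesis using norm_matrix_le_sum[of M] by simp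
qed

text \<open>
  On differences of symmetric matrices the product \<open>trace (M ** N)\<close> is the Euclidean inner product,
  so the characterizing inequality is the variational inequality of the Euclidean projection.
\<close>

lemma P_K_eq_closest_point:
  assumes "ql \<le> qu"
  shows "P_K ql qu A = closest_point (K_set ql qu) A"
proof -
  let ?K = "K_set ql qu :: (real^'n^'n) set"
  have ne: "?K \<noteq> {}" using scaled_identity_in_K_set[of ql ql qu] assms by auto
  have conv: "(mat_inner (A - P) (B - P) \<le> 0) = ((A - P) \<bullet> (B - P) \<le> 0)" if "P \<in> ?K" "B \<in> ?K" for P B
    using that by (subst mat_inner_eq_inner) (auto simp: K_set_def intro: sym_matrices_diff)
  have cp: "closest_point ?K A \<in> ?K" by (rule closest_point_in_set[OF closed_K_set ne])
  show ?thesis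
    unfolding P_K_def
  proof (rule the_equality)
    show "closest_point ?K A \<in> ?K \<and> (\<forall>B\<in>?K. mat_inner (A - closest_point ?K A) (B - closest_point ?K A) \<le> 0)"
      using cp conv closest_point_dot[OF convex_K_set closed_K_set] by auto
  next
    fix P assume P: "P \<in> ?K \<and> (\<forall>B\<in>?K. mat_inner (A - P) (B - P) \<le> 0)"
    let ?C = "closest_point ?K A"
    have 1: "(A - P) \<bullet> (?C - P) \<le> 0" using P conv cp by auto
    have 2: "(A - ?C) \<bullet> (P - ?C) \<le> 0" using P by (intro closest_point_dot[OF convex_K_set closed_K_set]) auto
    have "(?C - P) \<bullet> (?C - P) = (A - P) \<bullet> (?C - P) + (A - ?C) \<bullet> (P - ?C)"
      by (simp add: algebra_simps inner_commute)
    then have "(?C - P) \<bullet> (?C - P) \<le> 0" using 1 2 by linarith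
    then show "P = ?C" by (metis eq_iff_diff_eq_0 inner_eq_zero_iff inner_ge_zero order_antisym)
  qed
qed

lemma P_K_in_K_set: "ql \<le> qu \<Longrightarrow> P_K ql qu A \<in> K_set ql qu"
  by (simp only: P_K_eq_closest_point, rule closest_point_in_set[OF closed_K_set])
    (use scaled_identity_in_K_set[of ql ql qu] in auto)

lemma P_K_closest:
  assumes "ql \<le> qu" "B \<in> K_set ql qu"
  shows "(norm (P_K ql qu A - A))\<^sup>2 \<le> (norm (B - A))\<^sup>2"
proof -
  have "dist A (closest_point (K_set ql qu) A) \<le> dist A B"
    by (rule closest_point_le[OF closed_K_set assms(2)])
  then have "norm (P_K ql qu A - A) \<le> norm (B - A)"
    by (simp add: P_K_eq_closest_point[OF assms(1)] dist_norm norm_minus_commute)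
  then show ?thesis by (intro power_mono) auto
qed

lemma continuous_P_K:
  assumes "ql \<le> qu"
  shows "continuous_on S (P_K ql qu :: real^'n^'n \<Rightarrow> real^'n^'n)"
proof -
  have "P_K ql qu = closest_point (K_set ql qu :: (real^'n^'n) set)"
    by (rule ext) (rule P_K_eq_closest_point[OF assms])
  moreover have "K_set ql qu \<noteq> ({} :: (real^'n^'n) set)"
    using scaled_identity_in_K_set[of ql ql qu] assms by auto
  ultimately show ?thesis
    using continuous_on_closest_point[OF convex_K_set closed_K_set] by simp
qed

lemma sym_tensor_self_inner: "(M *v \<xi>) \<bullet> \<xi> = M \<bullet> sym_tensor \<xi> \<xi>" for M :: "real^'n^'n"
  unfolding matrix_quadratic_form
  by (simp add: inner_vec_def sym_tensor_def mult.assoc mult.commute[of "\<xi> $ _" "\<xi> $ _"])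

section \<open>The saddle point problem\<close>

lemma measurable_entry:
  fixes Q :: "'a \<Rightarrow> real^'n^'n"
  assumes "Q \<in> borel_measurable M" shows "(\<lambda>x. Q x $ i $ j) \<in> borel_measurable M"
proof -
  have "(\<lambda>v::real^'n^'n. v $ i $ j) \<in> borel_measurable borel"
    by (intro borel_measurable_continuous_onI continuous_intros)
  then show ?thesis using assms by (rule measurable_compose[rotated])
qed

lemma borel_measurable_quadratic_form:
  fixes Q :: "'a \<Rightarrow> real^'n^'n"
  assumes "Q \<in> borel_measurable M" "u \<in> borel_measurable M" "w \<in> borel_measurable M"
  shows "(\<lambda>x. (Q x *v u x) \<bullet> w x) \<in> borel_measurable M"
  unfolding matrix_quadratic_form
  by (intro borel_measurable_sum borel_measurable_times measurable_entry borel_measurable_component assms)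

lemma K_set_form_bound:
  fixes M :: "real^'n^'n"
  assumes M: "M \<in> K_set ql qu" "0 \<le> ql"
  shows "\<bar>(M *v \<xi>) \<bullet> \<eta>\<bar> \<le> real CARD('n) * real CARD('n) * (qu * norm \<xi> * norm \<eta>)"
proof -
  have "\<bar>(M *v \<xi>) \<bullet> \<eta>\<bar> \<le> (\<Sum>i\<in>UNIV. \<bar>\<Sum>j\<in>UNIV. M $ i $ j * \<xi> $ j * \<eta> $ i\<bar>)"
    unfolding matrix_quadratic_form by (rule sum_abs)
  also have "\<dots> \<le> (\<Sum>i\<in>UNIV. \<Sum>j\<in>UNIV. \<bar>M $ i $ j * \<xi> $ j * \<eta> $ i\<bar>)"
    by (intro sum_mono sum_abs)
  also have "\<dots> \<le> (\<Sum>i\<in>(UNIV::'n set). \<Sum>j\<in>(UNIV::'n set). qu * norm \<xi> * norm \<eta>)"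
  proof (intro sum_mono)
    fix i j
    have "qu \<ge> 0" using K_set_entry_le[OF M, of i j] by linarith
    then show "\<bar>M $ i $ j * \<xi> $ j * \<eta> $ i\<bar> \<le> qu * norm \<xi> * norm \<eta>"
      unfolding abs_mult
      by (intro mult_mono K_set_entry_le[OF M] component_le_norm_cart mult_nonneg_nonneg) auto
  qed
  finally show ?thesis by simp
qed

lemma K_set_form_sym: "M \<in> K_set ql qu \<Longrightarrow> (M *v \<xi>) \<bullet> \<eta> = (M *v \<eta>) \<bullet> \<xi>" for M :: "real^'n^'n"
proof -
  assume M: "M \<in> K_set ql qu"
  have "(M *v \<xi>) \<bullet> \<eta> = (\<Sum>j\<in>UNIV. \<Sum>i\<in>UNIV. M $ i $ j * \<xi> $ j * \<eta> $ i)"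
    unfolding matrix_quadratic_form by (rule sum.swap)
  also have "\<dots> = (M *v \<eta>) \<bullet> \<xi>"
    unfolding matrix_quadratic_form using M by (intro sum.cong refl) (simp add: K_set_eq)
  finally show ?thesis .
qed

lemma square_convex_identity:
  fixes a b :: "'a::real_inner"
  shows "(norm ((1 - t) *\<^sub>R a + t *\<^sub>R b))\<^sup>2
    = (1 - t) * (norm a)\<^sup>2 + t * (norm b)\<^sup>2 - t * (1 - t) * (norm (a - b))\<^sup>2"
  unfolding power2_norm_eq_inner
  by (simp add: inner_add_left inner_add_right inner_diff_left inner_diff_right inner_commute algebra_simps)

lemma L2_square_convex:
  fixes a b :: "'a \<Rightarrow> 'b::euclidean_space"
  assumes a: "a \<in> L2 M" and b: "b \<in> L2 M"
  shows "(LINT x|M. (norm ((1 - t) *\<^sub>R a x + t *\<^sub>R b x))\<^sup>2)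
    = (1 - t) * (LINT x|M. (norm (a x))\<^sup>2) + t * (LINT x|M. (norm (b x))\<^sup>2)
      - t * (1 - t) * (LINT x|M. (norm (a x - b x))\<^sup>2)"
proof -
  have "(\<lambda>x. a x - b x) \<in> L2 M" using L2_lincomb[OF a b, of 1 "-1"] by simp
  then have "integrable M (\<lambda>x. (norm (a x))\<^sup>2)" "integrable M (\<lambda>x. (norm (b x))\<^sup>2)"
      "integrable M (\<lambda>x. (norm (a x - b x))\<^sup>2)"
    using a b by (auto simp: L2_def)
  then show ?thesis unfolding square_convex_identity by simp
qed

text \<open>
  The discrete problem in terms of the coefficients of discrete functions in an energy orthonormal
  basis: \<open>e k\<close>, \<open>ge k\<close> and \<open>te k\<close> are values, gradient and boundary trace of the
  \<open>k\<close>-th basis function, and \<open>p\<close> holds the coefficients of the interpolated data.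
\<close>

type_synonym ('a, 'b, 'n) control = "('a \<Rightarrow> real^'n^'n) \<times> ('a \<Rightarrow> real) \<times> ('b \<Rightarrow> real)"

locale saddle_problem =
  fixes M :: "'a measure" and S :: "'b measure" and m :: nat
    and e :: "nat \<Rightarrow> 'a \<Rightarrow> real" and ge :: "nat \<Rightarrow> 'a \<Rightarrow> real^'n" and te :: "nat \<Rightarrow> 'b \<Rightarrow> real"
    and p :: "nat \<Rightarrow> real" and \<rho> ql qu :: real
  assumes finite_M: "finite_measure M" and finite_S: "finite_measure S"
    and e_measurable: "k < m \<Longrightarrow> e k \<in> borel_measurable M"
    and e_bounded: "k < m \<Longrightarrow> \<exists>C. AE x in M. \<bar>e k x\<bar> \<le> C"
    and ge_measurable: "k < m \<Longrightarrow> ge k \<in> borel_measurable M"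
    and ge_bounded: "k < m \<Longrightarrow> \<exists>C. AE x in M. norm (ge k x) \<le> C"
    and te_measurable: "k < m \<Longrightarrow> te k \<in> borel_measurable S"
    and te_bounded: "k < m \<Longrightarrow> \<exists>C. AE x in S. \<bar>te k x\<bar> \<le> C"
    and orthonormal: "j < m \<Longrightarrow> k < m \<Longrightarrow> (LINT x|M. ge j x \<bullet> ge k x) = (if j = k then 1 else 0)"
    and \<rho>_pos: "0 < \<rho>" and ql_pos: "0 < ql" and ql_le_qu: "ql \<le> qu"
begin

definition ev :: "(nat \<Rightarrow> real) \<Rightarrow> 'a \<Rightarrow> real" where "ev c x = (\<Sum>k<m. c k * e k x)"
definition gv :: "(nat \<Rightarrow> real) \<Rightarrow> 'a \<Rightarrow> real^'n" where "gv c x = (\<Sum>k<m. c k *\<^sub>R ge k x)"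
definition tv :: "(nat \<Rightarrow> real) \<Rightarrow> 'b \<Rightarrow> real" where "tv c x = (\<Sum>k<m. c k * te k x)"

definition adm :: "('a, 'b, 'n) control set" where
  "adm = {(Q, f, g). Q \<in> borel_measurable M \<and> (AE x in M. Q x \<in> K_set ql qu) \<and> f \<in> L2 M \<and> g \<in> L2 S}"

definition load :: "('a, 'b, 'n) control \<Rightarrow> (nat \<Rightarrow> real) \<Rightarrow> real" where
  "load = (\<lambda>(Q, f, g) c. (LINT x|M. f x * ev c x) + (LINT x|S. g x * tv c x))"

definition form :: "('a, 'b, 'n) control \<Rightarrow> (nat \<Rightarrow> real) \<Rightarrow> (nat \<Rightarrow> real) \<Rightarrow> real" where
  "form = (\<lambda>(Q, f, g) c d. LINT x|M. (Q x *v gv c x) \<bullet> gv d x)"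

definition pen :: "('a, 'b, 'n) control \<Rightarrow> real" where
  "pen = (\<lambda>(Q, f, g). (LINT x|M. (norm (Q x))\<^sup>2) + (LINT x|M. (f x)\<^sup>2) + (LINT x|S. (g x)\<^sup>2))"

text \<open>
  The Lagrangian. At the coefficients \<open>c\<close> of the state of \<open>\<Gamma>\<close> its value is the regularized
  cost of \<open>\<Gamma>\<close>.
\<close>

definition Lag :: "('a, 'b, 'n) control \<Rightarrow> (nat \<Rightarrow> real) \<Rightarrow> real" where
  "Lag \<Gamma> c = 2 * (load \<Gamma> c - load \<Gamma> p) - form \<Gamma> c c + form \<Gamma> p p + \<rho> * pen \<Gamma>"

text \<open>
  The control whose components are the right-hand sides of the optimality system for the discrete
  function with coefficients \<open>c\<close>.
\<close>

definition opt :: "(nat \<Rightarrow> real) \<Rightarrow> ('a, 'b, 'n) control" where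
  "opt c = (\<lambda>x. P_K ql qu ((1 / (2 * \<rho>)) *\<^sub>R (sym_tensor (gv c x) (gv c x) - sym_tensor (gv p x) (gv p x))),
            \<lambda>x. (1 / \<rho>) * (ev p x - ev c x), \<lambda>x. (1 / \<rho>) * (tv p x - tv c x))"

definition solves :: "('a, 'b, 'n) control \<Rightarrow> (nat \<Rightarrow> real) \<Rightarrow> bool" where
  "solves \<Gamma> c \<longleftrightarrow> (\<forall>d. form \<Gamma> c d = load \<Gamma> d)"

definition unit :: "nat \<Rightarrow> nat \<Rightarrow> real" where "unit k i = (if i = k then 1 else 0)"

lemma gv_unit: "k < m \<Longrightarrow> gv (unit k) x = ge k x"
  by (simp add: gv_def unit_def if_distrib[where f = "\<lambda>r. r *\<^sub>R _"] cong: if_cong)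

lemma ev_lincomb: "ev (\<lambda>k. a * c k + b * d k) x = a * ev c x + b * ev d x"
  and gv_lincomb: "gv (\<lambda>k. a * c k + b * d k) x = a *\<^sub>R gv c x + b *\<^sub>R gv d x"
  and tv_lincomb: "tv (\<lambda>k. a * c k + b * d k) y = a * tv c y + b * tv d y"
  by (simp_all add: ev_def gv_def tv_def sum.distrib sum_distrib_left scaleR_sum_right algebra_simps)

lemma ev_measurable: "ev c \<in> borel_measurable M"
  and gv_measurable: "gv c \<in> borel_measurable M"
  and tv_measurable: "tv c \<in> borel_measurable S"
  unfolding ev_def[abs_def] gv_def[abs_def] tv_def[abs_def]
  using e_measurable ge_measurable te_measurable
  by (auto intro!: borel_measurable_sum borel_measurable_times borel_measurable_scaleR)

lemma AE_bounded_sum: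
  fixes f :: "nat \<Rightarrow> 'c \<Rightarrow> 'd::real_normed_vector"
  assumes "\<And>k. k < n \<Longrightarrow> \<exists>C. AE x in N. norm (f k x) \<le> C"
  shows "\<exists>C. AE x in N. norm (\<Sum>k<n. c k *\<^sub>R f k x) \<le> C"
proof -
  obtain C where "\<And>k. k < n \<Longrightarrow> AE x in N. norm (f k x) \<le> C k" using assms by metis
  then have "AE x in N. \<forall>k\<in>{..<n}. norm (f k x) \<le> C k" by (intro AE_finite_allI) auto
  then have "AE x in N. norm (\<Sum>k<n. c k *\<^sub>R f k x) \<le> (\<Sum>k<n. \<bar>c k\<bar> * C k)"
  proof eventually_elim
    case (elim x)
    have "norm (\<Sum>k<n. c k *\<^sub>R f k x) \<le> (\<Sum>k<n. norm (c k *\<^sub>R f k x))" by (rule norm_sum)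
    also have "\<dots> \<le> (\<Sum>k<n. \<bar>c k\<bar> * C k)" using elim by (intro sum_mono) (auto intro!: mult_left_mono)
    finally show ?case .
  qed
  then show ?thesis by blast
qed

lemma ev_bounded: "\<exists>C. AE x in M. \<bar>ev c x\<bar> \<le> C"
  and gv_bounded: "\<exists>C. AE x in M. norm (gv c x) \<le> C"
  and tv_bounded: "\<exists>C. AE x in S. \<bar>tv c x\<bar> \<le> C"
  using AE_bounded_sum[where n = m and N = M and f = e and c = c] AE_bounded_sum[where n = m and N = M and f = ge and c = c]
    AE_bounded_sum[where n = m and N = S and f = te and c = c] e_bounded ge_bounded te_bounded
  by (simp_all add: ev_def gv_def tv_def)

lemma ev_L2: "ev c \<in> L2 M" and gv_L2: "gv c \<in> L2 M" and tv_L2: "tv c \<in> L2 S"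
proof -
  obtain C1 C2 C3 where b: "AE x in M. norm (ev c x) \<le> C1" "AE x in M. norm (gv c x) \<le> C2" "AE x in S. norm (tv c x) \<le> C3"
    using ev_bounded[of c] gv_bounded[of c] tv_bounded[of c] by auto
  show "ev c \<in> L2 M" by (rule L2_bounded[OF finite_M ev_measurable b(1)])
  show "gv c \<in> L2 M" by (rule L2_bounded[OF finite_M gv_measurable b(2)])
  show "tv c \<in> L2 S" by (rule L2_bounded[OF finite_S tv_measurable b(3)])
qed

lemma integrable_load:
  assumes "(Q, f, g) \<in> adm"
  shows "integrable M (\<lambda>x. f x * ev c x)" "integrable S (\<lambda>x. g x * tv c x)"
proof -
  have fg: "f \<in> L2 M" "g \<in> L2 S" using assms by (auto simp: adm_def)
  obtain C where "AE x in M. \<bar>ev c x\<bar> \<le> C" using ev_bounded by blast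
  then show "integrable M (\<lambda>x. f x * ev c x)"
    by (rule integrable_mult_bounded[OF L2_integrable[OF finite_M fg(1)] ev_measurable])
  obtain C where "AE x in S. \<bar>tv c x\<bar> \<le> C" using tv_bounded by blast
  then show "integrable S (\<lambda>x. g x * tv c x)"
    by (rule integrable_mult_bounded[OF L2_integrable[OF finite_S fg(2)] tv_measurable])
qed

lemma load_lincomb:
  assumes "\<Gamma> \<in> adm"
  shows "load \<Gamma> (\<lambda>k. a * c k + b * d k) = a * load \<Gamma> c + b * load \<Gamma> d"
proof -
  obtain Q f g where \<Gamma>: "\<Gamma> = (Q, f, g)" by (cases \<Gamma>) auto
  note int = integrable_load[OF assms[unfolded \<Gamma>]]
  have "(\<lambda>x. f x * ev (\<lambda>k. a * c k + b * d k) x) = (\<lambda>x. a * (f x * ev c x) + b * (f x * ev d x))"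
    "(\<lambda>x. g x * tv (\<lambda>k. a * c k + b * d k) x) = (\<lambda>x. a * (g x * tv c x) + b * (g x * tv d x))"
    by (auto simp: ev_lincomb tv_lincomb algebra_simps)
  then show ?thesis using int by (simp add: \<Gamma> load_def algebra_simps)
qed

lemma integrable_form:
  assumes "(Q, f, g) \<in> adm"
  shows "integrable M (\<lambda>x. (Q x *v gv c x) \<bullet> gv d x)"
proof -
  have Q: "Q \<in> borel_measurable M" "AE x in M. Q x \<in> K_set ql qu" using assms by (auto simp: adm_def)
  obtain C D where CD: "AE x in M. norm (gv c x) \<le> C" "AE x in M. norm (gv d x) \<le> D" using gv_bounded by metis
  have "AE x in M. norm ((Q x *v gv c x) \<bullet> gv d x) \<le> real CARD('n) * real CARD('n) * (qu * C * D)"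
    using Q(2) CD
  proof eventually_elim
    case (elim x)
    have "norm ((Q x *v gv c x) \<bullet> gv d x) \<le> real CARD('n) * real CARD('n) * (qu * norm (gv c x) * norm (gv d x))"
      using K_set_form_bound[OF elim(1), of "gv c x" "gv d x"] ql_pos by simp
    also have "\<dots> \<le> real CARD('n) * real CARD('n) * (qu * C * D)"
    proof -
      have "0 \<le> C" "0 \<le> D" "0 \<le> qu"
        using elim(2,3) norm_ge_zero[of "gv c x"] norm_ge_zero[of "gv d x"] ql_pos ql_le_qu by linarith+
      then show ?thesis using elim(2,3) by (intro mult_left_mono mult_mono mult_nonneg_nonneg) auto
    qed
    finally show ?case .
  qed
  then show ?thesis
    by (rule finite_measure.integrable_const_bound[OF finite_M _ borel_measurable_quadratic_form[OF Q(1) gv_measurable gv_measurable]])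
qed

lemma form_lincomb_left:
  assumes "\<Gamma> \<in> adm"
  shows "form \<Gamma> (\<lambda>k. a * c k + b * d k) z = a * form \<Gamma> c z + b * form \<Gamma> d z"
proof -
  obtain Q f g where \<Gamma>: "\<Gamma> = (Q, f, g)" by (cases \<Gamma>) auto
  note int = integrable_form[OF assms[unfolded \<Gamma>]]
  have "(\<lambda>x. (Q x *v gv (\<lambda>k. a * c k + b * d k) x) \<bullet> gv z x)
      = (\<lambda>x. a * ((Q x *v gv c x) \<bullet> gv z x) + b * ((Q x *v gv d x) \<bullet> gv z x))"
    by (simp add: gv_lincomb matrix_vector_right_distrib matrix_vector_mult_scaleR inner_add_left)
  then show ?thesis using int by (simp add: \<Gamma> form_def)
qed

lemma form_sym:
  assumes "\<Gamma> \<in> adm"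
  shows "form \<Gamma> c d = form \<Gamma> d c"
proof -
  obtain Q f g where \<Gamma>: "\<Gamma> = (Q, f, g)" by (cases \<Gamma>) auto
  have Q: "Q \<in> borel_measurable M" "AE x in M. Q x \<in> K_set ql qu" using assms by (auto simp: adm_def \<Gamma>)
  have "(LINT x|M. (Q x *v gv c x) \<bullet> gv d x) = (LINT x|M. (Q x *v gv d x) \<bullet> gv c x)"
    using Q(2) by (intro integral_cong_AE borel_measurable_quadratic_form[OF Q(1)] gv_measurable)
      (auto elim!: eventually_mono intro: K_set_form_sym)
  then show ?thesis by (simp add: \<Gamma> form_def)
qed

lemma form_bounds:
  assumes "\<Gamma> \<in> adm"
  shows "ql * (LINT x|M. gv c x \<bullet> gv c x) \<le> form \<Gamma> c c" "form \<Gamma> c c \<le> qu * (LINT x|M. gv c x \<bullet> gv c x)"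
proof -
  obtain Q f g where \<Gamma>: "\<Gamma> = (Q, f, g)" by (cases \<Gamma>) auto
  have Q: "AE x in M. Q x \<in> K_set ql qu" using assms by (auto simp: adm_def \<Gamma>)
  note int = integrable_form[OF assms[unfolded \<Gamma>], of c c]
  have sq: "integrable M (\<lambda>x. gv c x \<bullet> gv c x)" using gv_L2[of c] by (simp add: L2_def power2_norm_eq_inner)
  have "(LINT x|M. ql * (gv c x \<bullet> gv c x)) \<le> (LINT x|M. (Q x *v gv c x) \<bullet> gv c x)"
    by (intro integral_mono_AE int integrable_mult_right sq eventually_mono[OF Q]) (simp add: K_set_eq power2_norm_eq_inner)
  then show "ql * (LINT x|M. gv c x \<bullet> gv c x) \<le> form \<Gamma> c c" by (simp add: \<Gamma> form_def)
  have "(LINT x|M. (Q x *v gv c x) \<bullet> gv c x) \<le> (LINT x|M. qu * (gv c x \<bullet> gv c x))"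
    by (intro integral_mono_AE int integrable_mult_right sq eventually_mono[OF Q]) (simp add: K_set_eq power2_norm_eq_inner)
  then show "form \<Gamma> c c \<le> qu * (LINT x|M. gv c x \<bullet> gv c x)" by (simp add: \<Gamma> form_def)
qed

lemma form_nonneg: "\<Gamma> \<in> adm \<Longrightarrow> 0 \<le> form \<Gamma> c c"
proof -
  assume "\<Gamma> \<in> adm"
  have "0 \<le> (LINT x|M. gv c x \<bullet> gv c x)" by (rule Bochner_Integration.integral_nonneg) simp
  then show ?thesis using form_bounds(1)[OF \<open>\<Gamma> \<in> adm\<close>, of c] ql_pos by (meson less_imp_le mult_nonneg_nonneg order_trans)
qed

lemma form_diff:
  assumes "\<Gamma> \<in> adm"
  shows "form \<Gamma> (\<lambda>k. c k - d k) (\<lambda>k. c k - d k) = form \<Gamma> c c - 2 * form \<Gamma> c d + form \<Gamma> d d"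
proof -
  let ?z = "\<lambda>k. 1 * c k + (-1) * d k"
  have "form \<Gamma> ?z ?z = form \<Gamma> c ?z - form \<Gamma> d ?z" using form_lincomb_left[OF assms, of 1 c "-1" d] by simp
  also have "form \<Gamma> c ?z = form \<Gamma> c c - form \<Gamma> d c"
    using form_lincomb_left[OF assms, of 1 c "-1" d c] form_sym[OF assms, of c ?z] by simp
  also have "form \<Gamma> d ?z = form \<Gamma> c d - form \<Gamma> d d"
    using form_lincomb_left[OF assms, of 1 c "-1" d d] form_sym[OF assms, of d ?z] by simp
  finally show ?thesis using form_sym[OF assms, of c d] by simp
qed

text \<open>
  The difference of the two sides is the energy of the difference of the two discrete functions,
  weighted with the positive definite coefficient matrix of \<open>\<Gamma>\<close>.
\<close>

lemma Lag_le_solution: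
  assumes \<Gamma>: "\<Gamma> \<in> adm" and s: "solves \<Gamma> c"
  shows "Lag \<Gamma> d \<le> Lag \<Gamma> c"
proof -
  have "load \<Gamma> c = form \<Gamma> c c" "load \<Gamma> d = form \<Gamma> c d" using s by (auto simp: solves_def)
  then have "Lag \<Gamma> c - Lag \<Gamma> d = form \<Gamma> (\<lambda>k. c k - d k) (\<lambda>k. c k - d k)"
    by (simp add: Lag_def form_diff[OF \<Gamma>])
  then show ?thesis using form_nonneg[OF \<Gamma>, of "\<lambda>k. c k - d k"] by linarith
qed

lemma Lag_solution:
  assumes \<Gamma>: "\<Gamma> \<in> adm" and s: "solves \<Gamma> c"
  shows "Lag \<Gamma> c = form \<Gamma> (\<lambda>k. c k - p k) (\<lambda>k. c k - p k) + \<rho> * pen \<Gamma>"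
proof -
  have "load \<Gamma> c = form \<Gamma> c c" "load \<Gamma> p = form \<Gamma> c p" using s by (auto simp: solves_def)
  then show ?thesis by (simp add: Lag_def form_diff[OF \<Gamma>])
qed

lemma sum_unit_expansion:
  assumes lin: "\<And>a b c d. F (\<lambda>k. a * c k + b * d k) = a * F c + b * F d"
    and cong: "\<And>c d. (\<And>k. k < m \<Longrightarrow> c k = d k) \<Longrightarrow> F c = F d"
  shows "F c = (\<Sum>k<m. c k * (F (unit k) :: real))"
proof -
  have "F (\<lambda>i. if i < n then c i else 0) = (\<Sum>k<n. c k * F (unit k))" for n
  proof (induction n)
    case 0
    show ?case using lin[of 0 "\<lambda>_. 0" 0 "\<lambda>_. 0"] by simp
  next
    case (Suc n)
    have "(\<lambda>i. if i < Suc n then c i else 0) = (\<lambda>i. 1 * (if i < n then c i else 0) + c n * unit n i)"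
      by (auto simp: unit_def fun_eq_iff less_Suc_eq)
    then have "F (\<lambda>i. if i < Suc n then c i else 0) = 1 * F (\<lambda>i. if i < n then c i else 0) + c n * F (unit n)"
      using lin by metis
    then show ?case using Suc by simp
  qed
  moreover have "F c = F (\<lambda>i. if i < m then c i else 0)" by (rule cong) simp
  ultimately show ?thesis by simp
qed

lemma ev_cong: "(\<And>k. k < m \<Longrightarrow> c k = d k) \<Longrightarrow> ev c = ev d"
  and gv_cong: "(\<And>k. k < m \<Longrightarrow> c k = d k) \<Longrightarrow> gv c = gv d"
  and tv_cong: "(\<And>k. k < m \<Longrightarrow> c k = d k) \<Longrightarrow> tv c = tv d"
  by (auto simp: ev_def gv_def tv_def fun_eq_iff intro!: sum.cong)

lemma load_cong: "(\<And>k. k < m \<Longrightarrow> c k = d k) \<Longrightarrow> load \<Gamma> c = load \<Gamma> d"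
  using ev_cong[of c d] tv_cong[of c d] by (cases \<Gamma>) (simp add: load_def)

lemma form_cong: "(\<And>k. k < m \<Longrightarrow> c k = d k) \<Longrightarrow> form \<Gamma> c z = form \<Gamma> d z"
  using gv_cong[of c d] by (cases \<Gamma>) (simp add: form_def)

lemma load_expansion: "\<Gamma> \<in> adm \<Longrightarrow> load \<Gamma> c = (\<Sum>k<m. c k * load \<Gamma> (unit k))"
  by (rule sum_unit_expansion) (auto intro: load_lincomb load_cong)

lemma form_expansion: "\<Gamma> \<in> adm \<Longrightarrow> form \<Gamma> c z = (\<Sum>k<m. c k * form \<Gamma> (unit k) z)"
  by (rule sum_unit_expansion[where F = "\<lambda>c. form \<Gamma> c z"]) (auto intro: form_lincomb_left form_cong)

lemma form_expansion2: 
  assumes "\<Gamma> \<in> adm" shows "form \<Gamma> c d = (\<Sum>i<m. \<Sum>j<m. c i * d j * form \<Gamma> (unit i) (unit j))"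
proof -
  have "form \<Gamma> (unit i) d = (\<Sum>j<m. d j * form \<Gamma> (unit i) (unit j))" for i
    using form_expansion[OF assms, of d "unit i"] by (simp add: form_sym[OF assms, of _ "unit i"])
  then show ?thesis by (simp add: form_expansion[OF assms, of c] sum_distrib_left mult.assoc)
qed

lemma solves_iff:
  assumes "\<Gamma> \<in> adm"
  shows "solves \<Gamma> c \<longleftrightarrow> (\<forall>k<m. load \<Gamma> (unit k) = (\<Sum>i<m. c i * form \<Gamma> (unit i) (unit k)))"
proof
  assume "solves \<Gamma> c"
  then show "\<forall>k<m. load \<Gamma> (unit k) = (\<Sum>i<m. c i * form \<Gamma> (unit i) (unit k))"
    by (simp add: solves_def form_expansion[OF assms, of c])
next
  assume *: "\<forall>k<m. load \<Gamma> (unit k) = (\<Sum>i<m. c i * form \<Gamma> (unit i) (unit k))"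
  have "form \<Gamma> c d = load \<Gamma> d" for d
  proof -
    have "form \<Gamma> c d = (\<Sum>k<m. d k * form \<Gamma> (unit k) c)"
      by (simp add: form_sym[OF assms, of c] form_expansion[OF assms, of d])
    also have "\<dots> = (\<Sum>k<m. d k * load \<Gamma> (unit k))"
      using * by (intro sum.cong) (simp_all add: form_sym[OF assms, of _ c] form_expansion[OF assms, of c])
    finally show ?thesis using load_expansion[OF assms, of d] by simp
  qed
  then show "solves \<Gamma> c" by (simp add: solves_def)
qed

lemma energy_orthonormal: "(LINT x|M. gv c x \<bullet> gv c x) = (\<Sum>i<m. (c i)\<^sup>2)"
proof -
  have int: "integrable M (\<lambda>x. ge i x \<bullet> ge j x)" if ij: "i < m" "j < m" for i j
  proof -
    have "integrable M (\<lambda>x. (mat ql *v gv (unit i) x) \<bullet> gv (unit j) x)"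
    proof (rule integrable_form[where f = "\<lambda>_. 0" and g = "\<lambda>_. 0"])
      show "(\<lambda>x. mat ql, \<lambda>_. 0, \<lambda>_. 0) \<in> adm"
        using scaled_identity_in_K_set[of ql ql qu] ql_le_qu by (auto simp: adm_def L2_def)
    qed
    moreover have "mat ql *v \<xi> = ql *\<^sub>R \<xi>" for \<xi> :: "real^'n"
      by (simp add: vec_eq_iff matrix_vector_mult_def mat_def if_distrib[where f = "\<lambda>x. x * _"] cong: if_cong)
    ultimately show ?thesis using ij ql_pos by (simp add: gv_unit)
  qed
  have "(LINT x|M. gv c x \<bullet> gv c x) = (LINT x|M. (\<Sum>i<m. \<Sum>j<m. (c i * c j) * (ge i x \<bullet> ge j x)))"
    by (simp add: gv_def inner_sum_left inner_sum_right sum_distrib_left mult.assoc inner_commute[of "ge _ _" "ge _ _"])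
  also have "\<dots> = (\<Sum>i<m. \<Sum>j<m. (c i * c j) * (LINT x|M. ge i x \<bullet> ge j x))"
  proof -
    have int': "integrable M (\<lambda>x. (c i * c j) * (ge i x \<bullet> ge j x))" if "i < m" "j < m" for i j
      by (rule integrable_mult_right) (use int that in simp)
    have "(LINT x|M. (\<Sum>i<m. \<Sum>j<m. (c i * c j) * (ge i x \<bullet> ge j x)))
        = (\<Sum>i<m. LINT x|M. (\<Sum>j<m. (c i * c j) * (ge i x \<bullet> ge j x)))"
      using int' by (intro Bochner_Integration.integral_sum Bochner_Integration.integrable_sum) auto
    also have "\<dots> = (\<Sum>i<m. \<Sum>j<m. LINT x|M. (c i * c j) * (ge i x \<bullet> ge j x))"
      using int' by (intro sum.cong refl Bochner_Integration.integral_sum) auto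
    finally show ?thesis by simp
  qed
  also have "\<dots> = (\<Sum>i<m. \<Sum>j<m. if j = i then c i * c i else 0)"
    by (intro sum.cong) (auto simp: orthonormal)
  finally show ?thesis by (simp add: power2_eq_square)
qed


lemma tensor_continuous: "continuous_on UNIV (\<lambda>\<xi>::real^'n. sym_tensor \<xi> \<xi>)"
  unfolding sym_tensor_def by (intro continuous_on_vec_lambda continuous_intros) auto

lemma opt_adm: "opt c \<in> adm"
proof -
  have t: "(\<lambda>x. sym_tensor (gv d x) (gv d x)) \<in> borel_measurable M" for d
    by (rule measurable_compose[OF gv_measurable borel_measurable_continuous_onI[OF tensor_continuous]])
  have "(\<lambda>x. P_K ql qu ((1 / (2 * \<rho>)) *\<^sub>R (sym_tensor (gv c x) (gv c x) - sym_tensor (gv p x) (gv p x)))) \<in> borel_measurable M"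
    by (rule measurable_compose[OF _ borel_measurable_continuous_onI[OF continuous_P_K[OF ql_le_qu]]])
      (intro borel_measurable_scaleR borel_measurable_diff borel_measurable_const t)
  moreover have "(\<lambda>x. (1 / \<rho>) * (ev p x - ev c x)) \<in> L2 M"
    using L2_lincomb[OF ev_L2 ev_L2, of "1 / \<rho>" p "- (1 / \<rho>)" c] by (simp add: algebra_simps)
  moreover have "(\<lambda>x. (1 / \<rho>) * (tv p x - tv c x)) \<in> L2 S"
    using L2_lincomb[OF tv_L2 tv_L2, of "1 / \<rho>" p "- (1 / \<rho>)" c] by (simp add: algebra_simps)
  ultimately show ?thesis by (simp add: opt_def adm_def P_K_in_K_set[OF ql_le_qu])
qed

lemma adm_Q_L2:
  assumes "(Q, f, g) \<in> adm" shows "Q \<in> L2 M"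
proof -
  have "AE x in M. norm (Q x) \<le> real CARD('n) * real CARD('n) * qu"
    using assms ql_pos by (auto simp: adm_def elim!: eventually_mono intro: K_set_norm_le)
  then show ?thesis using assms by (intro L2_bounded[OF finite_M]) (auto simp: adm_def)
qed

lemma Lag_split:
  assumes adm: "(Q, f, g) \<in> adm"
  shows "Lag (Q, f, g) c = (LINT x|M. 2 * f x * (ev c x - ev p x) + \<rho> * (f x)\<^sup>2)
    + (LINT x|S. 2 * g x * (tv c x - tv p x) + \<rho> * (g x)\<^sup>2)
    + (LINT x|M. \<rho> * (norm (Q x))\<^sup>2 - (Q x *v gv c x) \<bullet> gv c x + (Q x *v gv p x) \<bullet> gv p x)"
    and "integrable M (\<lambda>x. 2 * f x * (ev c x - ev p x) + \<rho> * (f x)\<^sup>2)"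
    and "integrable S (\<lambda>x. 2 * g x * (tv c x - tv p x) + \<rho> * (g x)\<^sup>2)"
    and "integrable M (\<lambda>x. \<rho> * (norm (Q x))\<^sup>2 - (Q x *v gv c x) \<bullet> gv c x + (Q x *v gv p x) \<bullet> gv p x)"
proof -
  note l = integrable_load[OF adm] and q = integrable_form[OF adm]
  have sq: "integrable M (\<lambda>x. (f x)\<^sup>2)" "integrable S (\<lambda>x. (g x)\<^sup>2)" "integrable M (\<lambda>x. (norm (Q x))\<^sup>2)"
    using adm adm_Q_L2[OF adm] by (auto simp: adm_def L2_def)
  have eq: "(\<lambda>x. 2 * f x * (ev c x - ev p x) + \<rho> * (f x)\<^sup>2) = (\<lambda>x. 2 * (f x * ev c x) - 2 * (f x * ev p x) + \<rho> * (f x)\<^sup>2)"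
    "(\<lambda>x. 2 * g x * (tv c x - tv p x) + \<rho> * (g x)\<^sup>2) = (\<lambda>x. 2 * (g x * tv c x) - 2 * (g x * tv p x) + \<rho> * (g x)\<^sup>2)"
    by (auto simp: algebra_simps)
  show "integrable M (\<lambda>x. 2 * f x * (ev c x - ev p x) + \<rho> * (f x)\<^sup>2)"
    "integrable S (\<lambda>x. 2 * g x * (tv c x - tv p x) + \<rho> * (g x)\<^sup>2)"
    "integrable M (\<lambda>x. \<rho> * (norm (Q x))\<^sup>2 - (Q x *v gv c x) \<bullet> gv c x + (Q x *v gv p x) \<bullet> gv p x)"
    unfolding eq using l q sq by simp_all
  show "Lag (Q, f, g) c = (LINT x|M. 2 * f x * (ev c x - ev p x) + \<rho> * (f x)\<^sup>2)
    + (LINT x|S. 2 * g x * (tv c x - tv p x) + \<rho> * (g x)\<^sup>2)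
    + (LINT x|M. \<rho> * (norm (Q x))\<^sup>2 - (Q x *v gv c x) \<bullet> gv c x + (Q x *v gv p x) \<bullet> gv p x)"
  proof -
    have i: "(LINT x|M. 2 * (f x * ev c x) - 2 * (f x * ev p x) + \<rho> * (f x)\<^sup>2)
        = 2 * (LINT x|M. f x * ev c x) - 2 * (LINT x|M. f x * ev p x) + \<rho> * (LINT x|M. (f x)\<^sup>2)"
      "(LINT x|S. 2 * (g x * tv c x) - 2 * (g x * tv p x) + \<rho> * (g x)\<^sup>2)
        = 2 * (LINT x|S. g x * tv c x) - 2 * (LINT x|S. g x * tv p x) + \<rho> * (LINT x|S. (g x)\<^sup>2)"
      "(LINT x|M. \<rho> * (norm (Q x))\<^sup>2 - (Q x *v gv c x) \<bullet> gv c x + (Q x *v gv p x) \<bullet> gv p x)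
        = \<rho> * (LINT x|M. (norm (Q x))\<^sup>2) - (LINT x|M. (Q x *v gv c x) \<bullet> gv c x) + (LINT x|M. (Q x *v gv p x) \<bullet> gv p x)"
      using l q sq by simp_all
    show ?thesis unfolding eq i by (simp add: Lag_def load_def form_def pen_def distrib_left)
  qed
qed

lemma complete_the_square:
  fixes f b :: real
  shows "2 * ((1 / \<rho>) * b) * (- b) + \<rho> * ((1 / \<rho>) * b)\<^sup>2 \<le> 2 * f * (- b) + \<rho> * f\<^sup>2"
proof -
  have "0 \<le> \<rho> * (f - b / \<rho>)\<^sup>2" using \<rho>_pos by simp
  also have "\<rho> * (f - b / \<rho>)\<^sup>2 = 2 * f * (- b) + \<rho> * f\<^sup>2 - (2 * ((1 / \<rho>) * b) * (- b) + \<rho> * ((1 / \<rho>) * b)\<^sup>2)"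
    using \<rho>_pos by (simp add: power2_eq_square field_simps)
  finally show ?thesis by simp
qed

text \<open>
  The matrix part of the integrand is, up to a term that does not depend on \<open>Q\<close>, a multiple of the
  squared distance of \<open>Q\<close> to the matrix \<open>A u w\<close>; over the admissible matrices it is therefore
  smallest at the projection of that matrix.
\<close>

lemma complete_the_square_matrix:
  fixes Q :: "real^'n^'n"
  defines "A \<equiv> \<lambda>u w. (1 / (2 * \<rho>)) *\<^sub>R (sym_tensor u u - sym_tensor w w)"
  shows "\<rho> * (norm Q)\<^sup>2 - (Q *v u) \<bullet> u + (Q *v w) \<bullet> w = \<rho> * (norm (Q - A u w))\<^sup>2 - \<rho> * (norm (A u w))\<^sup>2"
proof -
  have "2 * \<rho> * (Q \<bullet> A u w) = (Q *v u) \<bullet> u - (Q *v w) \<bullet> w"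
    using \<rho>_pos by (simp add: A_def inner_diff_right sym_tensor_self_inner)
  then show ?thesis
    unfolding power2_norm_eq_inner inner_diff_left inner_diff_right inner_commute[of "A u w" Q]
    by (simp add: algebra_simps)
qed

lemma Lag_opt_le:
  assumes "\<Gamma> \<in> adm"
  shows "Lag (opt c) c \<le> Lag \<Gamma> c"
proof -
  obtain Q f g where \<Gamma>: "\<Gamma> = (Q, f, g)" by (cases \<Gamma>) auto
  obtain Q' f' g' where o: "opt c = (Q', f', g')" by (cases "opt c") auto
  note adm = assms[unfolded \<Gamma>] and adm' = opt_adm[of c, unfolded o]
  have o': "Q' = (\<lambda>x. P_K ql qu ((1 / (2 * \<rho>)) *\<^sub>R (sym_tensor (gv c x) (gv c x) - sym_tensor (gv p x) (gv p x))))"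
    "f' = (\<lambda>x. (1 / \<rho>) * (ev p x - ev c x))" "g' = (\<lambda>x. (1 / \<rho>) * (tv p x - tv c x))"
    using o by (auto simp: opt_def)
  have 1: "(LINT x|M. 2 * f' x * (ev c x - ev p x) + \<rho> * (f' x)\<^sup>2) \<le> (LINT x|M. 2 * f x * (ev c x - ev p x) + \<rho> * (f x)\<^sup>2)"
  proof (rule integral_mono[OF Lag_split(2)[OF adm'] Lag_split(2)[OF adm]])
    fix x show "2 * f' x * (ev c x - ev p x) + \<rho> * (f' x)\<^sup>2 \<le> 2 * f x * (ev c x - ev p x) + \<rho> * (f x)\<^sup>2"
      using complete_the_square[of "ev p x - ev c x" "f x"] by (simp add: o')
  qed
  have 2: "(LINT x|S. 2 * g' x * (tv c x - tv p x) + \<rho> * (g' x)\<^sup>2) \<le> (LINT x|S. 2 * g x * (tv c x - tv p x) + \<rho> * (g x)\<^sup>2)"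
  proof (rule integral_mono[OF Lag_split(3)[OF adm'] Lag_split(3)[OF adm]])
    fix x show "2 * g' x * (tv c x - tv p x) + \<rho> * (g' x)\<^sup>2 \<le> 2 * g x * (tv c x - tv p x) + \<rho> * (g x)\<^sup>2"
      using complete_the_square[of "tv p x - tv c x" "g x"] by (simp add: o')
  qed
  have 3: "(LINT x|M. \<rho> * (norm (Q' x))\<^sup>2 - (Q' x *v gv c x) \<bullet> gv c x + (Q' x *v gv p x) \<bullet> gv p x)
      \<le> (LINT x|M. \<rho> * (norm (Q x))\<^sup>2 - (Q x *v gv c x) \<bullet> gv c x + (Q x *v gv p x) \<bullet> gv p x)"
  proof (rule integral_mono_AE[OF Lag_split(4)[OF adm'] Lag_split(4)[OF adm]])
    have "AE x in M. Q x \<in> K_set ql qu" using adm by (simp add: adm_def)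
    then show "AE x in M. \<rho> * (norm (Q' x))\<^sup>2 - (Q' x *v gv c x) \<bullet> gv c x + (Q' x *v gv p x) \<bullet> gv p x
        \<le> \<rho> * (norm (Q x))\<^sup>2 - (Q x *v gv c x) \<bullet> gv c x + (Q x *v gv p x) \<bullet> gv p x"
    proof eventually_elim
      case (elim x)
      show ?case
        unfolding complete_the_square_matrix o'
        using P_K_closest[OF ql_le_qu elim] \<rho>_pos by simp
    qed
  qed
  show ?thesis
    unfolding \<Gamma> o Lag_split(1)[OF adm] Lag_split(1)[OF adm'] using 1 2 3 by linarith
qed

definition aeq :: "('a, 'b, 'n) control \<Rightarrow> ('a, 'b, 'n) control \<Rightarrow> bool" where
  "aeq = (\<lambda>(Q, f, g) (Q', f', g').
     (AE x in M. Q x = Q' x) \<and> (AE x in M. f x = f' x) \<and> (AE x in S. g x = g' x))"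

lemma aeq_cong:
  assumes adm: "\<Gamma> \<in> adm" "\<Gamma>' \<in> adm" and ae: "aeq \<Gamma> \<Gamma>'"
  shows "load \<Gamma> c = load \<Gamma>' c" "form \<Gamma> c d = form \<Gamma>' c d" "pen \<Gamma> = pen \<Gamma>'"
    "solves \<Gamma> c \<longleftrightarrow> solves \<Gamma>' c" "Lag \<Gamma> c = Lag \<Gamma>' c"
proof -
  obtain Q f g where \<Gamma>: "\<Gamma> = (Q, f, g)" by (cases \<Gamma>) auto
  obtain Q' f' g' where \<Gamma>': "\<Gamma>' = (Q', f', g')" by (cases \<Gamma>') auto
  have me: "Q \<in> borel_measurable M" "Q' \<in> borel_measurable M" "f \<in> borel_measurable M" "f' \<in> borel_measurable M"
    "g \<in> borel_measurable S" "g' \<in> borel_measurable S"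
    using adm by (auto simp: \<Gamma> \<Gamma>' adm_def L2_def)
  have ae': "AE x in M. Q x = Q' x" "AE x in M. f x = f' x" "AE x in S. g x = g' x"
    using ae by (auto simp: aeq_def \<Gamma> \<Gamma>')
  have "(LINT x|M. f x * ev c x) = (LINT x|M. f' x * ev c x)" for c
    using ae'(2) by (intro integral_cong_AE borel_measurable_times me ev_measurable) (auto elim: eventually_mono)
  moreover have "(LINT x|S. g x * tv c x) = (LINT x|S. g' x * tv c x)" for c
    using ae'(3) by (intro integral_cong_AE borel_measurable_times me tv_measurable) (auto elim: eventually_mono)
  ultimately have l: "load \<Gamma> c = load \<Gamma>' c" for c by (simp add: load_def \<Gamma> \<Gamma>')
  have "(LINT x|M. (Q x *v gv c x) \<bullet> gv d x) = (LINT x|M. (Q' x *v gv c x) \<bullet> gv d x)" for c d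
    using ae'(1) by (intro integral_cong_AE borel_measurable_quadratic_form me gv_measurable) (auto elim: eventually_mono)
  then have q: "form \<Gamma> c d = form \<Gamma>' c d" for c d by (simp add: form_def \<Gamma> \<Gamma>')
  have "(LINT x|M. (norm (Q x))\<^sup>2) = (LINT x|M. (norm (Q' x))\<^sup>2)"
    using ae'(1) me by (intro integral_cong_AE) (auto elim: eventually_mono)
  moreover have "(LINT x|M. (f x)\<^sup>2) = (LINT x|M. (f' x)\<^sup>2)"
    using ae'(2) me by (intro integral_cong_AE) (auto elim: eventually_mono)
  moreover have "(LINT x|S. (g x)\<^sup>2) = (LINT x|S. (g' x)\<^sup>2)"
    using ae'(3) me by (intro integral_cong_AE) (auto elim: eventually_mono)
  ultimately have pe: "pen \<Gamma> = pen \<Gamma>'" by (simp add: pen_def \<Gamma> \<Gamma>')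
  show "load \<Gamma> c = load \<Gamma>' c" "form \<Gamma> c d = form \<Gamma>' c d" "pen \<Gamma> = pen \<Gamma>'"
    "solves \<Gamma> c \<longleftrightarrow> solves \<Gamma>' c" "Lag \<Gamma> c = Lag \<Gamma>' c"
    by (simp_all add: l q pe solves_def Lag_def)
qed

lemma Lag_quadratic:
  assumes "\<Gamma> \<in> adm"
  shows "Lag \<Gamma> c = (form \<Gamma> p p - 2 * load \<Gamma> p + \<rho> * pen \<Gamma>) + 2 * (\<Sum>j<m. c j * load \<Gamma> (unit j))
    - (\<Sum>i<m. \<Sum>j<m. c i * c j * form \<Gamma> (unit i) (unit j))"
  by (simp add: Lag_def load_expansion[OF assms, of c] form_expansion2[OF assms, of c c])

lemma form_unit_bound: "\<Gamma> \<in> adm \<Longrightarrow> k < m \<Longrightarrow> \<bar>form \<Gamma> (unit k) (unit k)\<bar> \<le> qu"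
  using form_bounds(2)[of \<Gamma> "unit k"] form_nonneg[of \<Gamma> "unit k"] orthonormal[of k k] by (simp add: gv_unit)

lemma form_coercive: "\<Gamma> \<in> adm \<Longrightarrow> ql * (\<Sum>i<m. (c i)\<^sup>2) \<le> (\<Sum>i<m. \<Sum>j<m. c i * c j * form \<Gamma> (unit i) (unit j))"
  using form_bounds(1)[of \<Gamma> c] by (simp add: energy_orthonormal form_expansion2)

lemma solution_exists:
  assumes \<Gamma>: "\<Gamma> \<in> adm"
  shows "\<exists>c. solves \<Gamma> c"
proof -
  have "\<exists>c. \<forall>k<m. load \<Gamma> (unit k) = (\<Sum>i<m. c i * form \<Gamma> (unit i) (unit k))"
    by (rule finite_dimensional_saddle_point[where A = "{\<Gamma>}" and s = "\<lambda>_. \<Gamma>" and kk = "\<lambda>_. 0" and gc = \<Gamma> and q = ql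
          and l = "\<lambda>\<Gamma> k. load \<Gamma> (unit k)" and B = "\<lambda>\<Gamma> i j. form \<Gamma> (unit i) (unit j)" and b = qu])
      (use ql_pos \<Gamma> form_unit_bound form_coercive form_sym in auto)
  then show ?thesis by (simp add: solves_iff[OF \<Gamma>])
qed

lemma load_opt_shift:
  "load (opt (\<lambda>i. 1 * c i + t * unit k i)) d
    = load (opt c) d - t / \<rho> * ((LINT x|M. ev (unit k) x * ev d x) + (LINT x|S. tv (unit k) x * tv d x))"
proof -
  have "(mat ql :: real^'n^'n) \<in> K_set ql qu"
    by (rule scaled_identity_in_K_set) (simp_all add: ql_le_qu)
  then have "(\<lambda>x. mat ql, ev (unit k), tv (unit k)) \<in> adm"
    using ev_L2 tv_L2 by (simp add: adm_def)
  note i1 = integrable_load[OF this, of d]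
  note i2 = integrable_load[OF opt_adm[of c, unfolded opt_def], of d]
  have "(\<lambda>x. (1 / \<rho>) * (ev p x - ev (\<lambda>i. 1 * c i + t * unit k i) x) * ev d x)
      = (\<lambda>x. (1 / \<rho>) * (ev p x - ev c x) * ev d x - t / \<rho> * (ev (unit k) x * ev d x))"
    unfolding ev_lincomb by (auto simp: algebra_simps diff_divide_distrib add_divide_distrib)
  moreover have "(\<lambda>x. (1 / \<rho>) * (tv p x - tv (\<lambda>i. 1 * c i + t * unit k i) x) * tv d x)
      = (\<lambda>x. (1 / \<rho>) * (tv p x - tv c x) * tv d x - t / \<rho> * (tv (unit k) x * tv d x))"
    unfolding tv_lincomb by (auto simp: algebra_simps diff_divide_distrib add_divide_distrib)
  ultimately show ?thesis
    using i1 i2 by (simp add: load_def opt_def distrib_left del: times_divide_eq_left times_divide_eq_right)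
qed

text \<open>
  Since the projection is continuous, the optimal matrices converge pointwise when one coefficient
  is moved, and they are uniformly bounded; so dominated convergence applies.
\<close>

lemma form_opt_tendsto:
  assumes X: "X \<longlonglongrightarrow> 0"
  shows "(\<lambda>n. form (opt (\<lambda>i. 1 * c i + X n * unit k i)) d z) \<longlonglongrightarrow> form (opt c) d z"
proof -
  define A where "A u w = (1 / (2 * \<rho>)) *\<^sub>R (sym_tensor u u - sym_tensor w w)" for u w :: "real^'n"
  define c' where "c' n = (\<lambda>i. 1 * c i + X n * unit k i)" for n
  define Q where "Q c x = P_K ql qu (A (gv c x) (gv p x))" for c x
  define w where "w x = real CARD('n) * real CARD('n) * qu * ((norm (gv d x))\<^sup>2 + (norm (gv z x))\<^sup>2)" for x
  have Qm: "Q c \<in> borel_measurable M" for c using opt_adm[of c] by (simp add: adm_def opt_def Q_def[abs_def] A_def)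
  have "(\<lambda>n. LINT x|M. (Q (c' n) x *v gv d x) \<bullet> gv z x) \<longlonglongrightarrow> (LINT x|M. (Q c x *v gv d x) \<bullet> gv z x)"
  proof (rule integral_dominated_convergence[where w = w])
    show "(\<lambda>x. (Q c x *v gv d x) \<bullet> gv z x) \<in> borel_measurable M"
      "(\<lambda>x. (Q (c' n) x *v gv d x) \<bullet> gv z x) \<in> borel_measurable M" for n
      by (intro borel_measurable_quadratic_form Qm gv_measurable)+
    show "integrable M w" unfolding w_def[abs_def] using gv_L2[of d] gv_L2[of z] by (auto simp: L2_def)
    have "norm ((Q c x *v gv d x) \<bullet> gv z x) \<le> w x" for c x
    proof -
      have "norm (gv d x) * norm (gv z x) \<le> (norm (gv d x))\<^sup>2 + (norm (gv z x))\<^sup>2"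
        using sum_squares_bound[of "norm (gv d x)" "norm (gv z x)"]
          mult_nonneg_nonneg[OF norm_ge_zero[of "gv d x"] norm_ge_zero[of "gv z x"]] by linarith
      then have "real CARD('n) * real CARD('n) * qu * (norm (gv d x) * norm (gv z x)) \<le> w x"
        unfolding w_def using ql_pos ql_le_qu by (intro mult_left_mono) auto
      then show ?thesis
        using K_set_form_bound[OF P_K_in_K_set[OF ql_le_qu], of "A (gv c x) (gv p x)" "gv d x" "gv z x"] ql_pos
        by (simp add: Q_def mult.assoc)
    qed
    then show "AE x in M. norm ((Q (c' n) x *v gv d x) \<bullet> gv z x) \<le> w x" for n by simp
    show "AE x in M. (\<lambda>n. (Q (c' n) x *v gv d x) \<bullet> gv z x) \<longlonglongrightarrow> (Q c x *v gv d x) \<bullet> gv z x"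
    proof (rule AE_I2)
      fix x
      have "(\<lambda>n. 1 *\<^sub>R gv c x + X n *\<^sub>R gv (unit k) x) \<longlonglongrightarrow> 1 *\<^sub>R gv c x + 0 *\<^sub>R gv (unit k) x"
        by (intro tendsto_intros X)
      moreover have "gv (c' n) x = 1 *\<^sub>R gv c x + X n *\<^sub>R gv (unit k) x" for n
        unfolding c'_def by (rule gv_lincomb)
      ultimately have "(\<lambda>n. gv (c' n) x) \<longlonglongrightarrow> gv c x" by simp
      moreover have "isCont (\<lambda>\<xi>::real^'n. sym_tensor \<xi> \<xi>) (gv c x)"
        using tensor_continuous by (simp add: continuous_on_eq_continuous_at)
      ultimately have "(\<lambda>n. sym_tensor (gv (c' n) x) (gv (c' n) x)) \<longlonglongrightarrow> sym_tensor (gv c x) (gv c x)"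
        using isCont_tendsto_compose by fast
      then have "(\<lambda>n. A (gv (c' n) x) (gv p x)) \<longlonglongrightarrow> A (gv c x) (gv p x)"
        unfolding A_def by (intro tendsto_intros)
      moreover have "isCont (P_K ql qu :: real^'n^'n \<Rightarrow> real^'n^'n) (A (gv c x) (gv p x))"
        using continuous_P_K[OF ql_le_qu, where S = "UNIV :: (real^'n^'n) set"] by (simp add: continuous_on_eq_continuous_at)
      ultimately have "(\<lambda>n. Q (c' n) x) \<longlonglongrightarrow> Q c x"
        unfolding Q_def using isCont_tendsto_compose by fast
      then show "(\<lambda>n. (Q (c' n) x *v gv d x) \<bullet> gv z x) \<longlonglongrightarrow> (Q c x *v gv d x) \<bullet> gv z x"
        unfolding matrix_quadratic_form by (intro tendsto_intros)
    qed
  qed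
  then show ?thesis by (simp add: form_def opt_def Q_def A_def c'_def)
qed

text \<open>
  The dual function is coercive because every admissible matrix is bounded below by \<open>ql\<close>
  and the basis is orthonormal for the energy, so any admissible control, such as \<open>opt p\<close>, serves for
  the upper bound.
\<close>

lemma saddle_point_exists: "\<exists>c. solves (opt c) c"
proof -
  have "\<exists>c. \<forall>k<m. load (opt c) (unit k) = (\<Sum>i<m. c i * form (opt c) (unit i) (unit k))"
  proof (rule finite_dimensional_saddle_point[where A = adm and s = opt
        and kk = "\<lambda>\<Gamma>. form \<Gamma> p p - 2 * load \<Gamma> p + \<rho> * pen \<Gamma>" and gc = "opt p" and q = ql
        and l = "\<lambda>\<Gamma> k. load \<Gamma> (unit k)" and B = "\<lambda>\<Gamma> i j. form \<Gamma> (unit i) (unit j)" and b = qu])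
    show "opt c \<in> adm" for c by (rule opt_adm)
    show "opt p \<in> adm" by (rule opt_adm)
    fix \<Gamma> and c :: "nat \<Rightarrow> real" assume \<Gamma>: "\<Gamma> \<in> adm"
    show "form (opt c) p p - 2 * load (opt c) p + \<rho> * pen (opt c) + 2 * (\<Sum>j<m. c j * load (opt c) (unit j))
        - (\<Sum>i<m. \<Sum>j<m. c i * c j * form (opt c) (unit i) (unit j))
      \<le> form \<Gamma> p p - 2 * load \<Gamma> p + \<rho> * pen \<Gamma> + 2 * (\<Sum>j<m. c j * load \<Gamma> (unit j))
        - (\<Sum>i<m. \<Sum>j<m. c i * c j * form \<Gamma> (unit i) (unit j))"
      using Lag_opt_le[OF \<Gamma>, of c] unfolding Lag_quadratic[OF \<Gamma>] Lag_quadratic[OF opt_adm] .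
    show "form \<Gamma> (unit i) (unit j) = form \<Gamma> (unit j) (unit i)" for i j by (rule form_sym[OF \<Gamma>])
    show "\<bar>form \<Gamma> (unit k) (unit k)\<bar> \<le> qu" if "k < m" for k by (rule form_unit_bound[OF \<Gamma> that])
  next
    show "ql > 0" by (rule ql_pos)
    show "ql * (\<Sum>i<m. (c i)\<^sup>2) \<le> (\<Sum>i<m. \<Sum>j<m. c i * c j * form (opt p) (unit i) (unit j))" for c
      by (rule form_coercive[OF opt_adm])
  next
    fix c :: "nat \<Rightarrow> real" and k assume k: "k < m"
    have shift: "c(k := c k + t) = (\<lambda>i. 1 * c i + t * unit k i)" for t by (auto simp: unit_def)
    have rw: "(\<Sum>i<m. c i * form (opt d) (unit i) (unit k)) = form (opt d) c (unit k)" for d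
      by (rule form_expansion[OF opt_adm, symmetric])
    show "((\<lambda>t. load (opt (c(k := c k + t))) (unit k) - (\<Sum>i<m. c i * form (opt (c(k := c k + t))) (unit i) (unit k)))
        \<longlongrightarrow> load (opt c) (unit k) - (\<Sum>i<m. c i * form (opt c) (unit i) (unit k))) (at 0)"
      unfolding rw shift
    proof (rule tendsto_diff)
      show "((\<lambda>t. load (opt (\<lambda>i. 1 * c i + t * unit k i)) (unit k)) \<longlongrightarrow> load (opt c) (unit k)) (at 0)"
        unfolding load_opt_shift using \<rho>_pos by (auto intro!: tendsto_eq_intros)
      show "((\<lambda>t. form (opt (\<lambda>i. 1 * c i + t * unit k i)) c (unit k)) \<longlongrightarrow> form (opt c) c (unit k)) (at 0)"
        unfolding tendsto_at_iff_sequentially o_def by (intro allI impI form_opt_tendsto)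
    qed
  qed
  then show ?thesis by (simp add: solves_iff[OF opt_adm])
qed

text \<open>
  Both halves of the saddle point property are used: \<open>opt c\<close> is the best control for the
  coefficients \<open>c\<close>, and those of the state are the worst case for each other control.
\<close>

lemma optimality_sufficient:
  assumes \<Gamma>: "\<Gamma> \<in> adm" "solves \<Gamma> c" and opt: "aeq \<Gamma> (opt c)" and \<Gamma>': "\<Gamma>' \<in> adm" "solves \<Gamma>' c'"
  shows "Lag \<Gamma> c \<le> Lag \<Gamma>' c'"
proof -
  have "Lag \<Gamma> c = Lag (opt c) c" by (rule aeq_cong(5)[OF \<Gamma>(1) opt_adm opt])
  also have "\<dots> \<le> Lag \<Gamma>' c" by (rule Lag_opt_le[OF \<Gamma>'(1)])
  also have "\<dots> \<le> Lag \<Gamma>' c'" by (rule Lag_le_solution[OF \<Gamma>'])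
  finally show ?thesis .
qed

definition comb where
  "comb t = (\<lambda>(Q, f, g) (Q', f', g').
     ((\<lambda>x::'a. (1 - t) *\<^sub>R (Q x :: real^'n^'n) + t *\<^sub>R Q' x), (\<lambda>x::'a. (1 - t) * f x + t * f' x :: real),
      (\<lambda>x::'b. (1 - t) * g x + t * g' x :: real)))"

definition dsq where
  "dsq = (\<lambda>(Q :: 'a \<Rightarrow> real^'n^'n, f :: 'a \<Rightarrow> real, g :: 'b \<Rightarrow> real) (Q', f', g').
     (LINT x|M. (norm (Q x - Q' x))\<^sup>2) + (LINT x|M. (norm (f x - f' x))\<^sup>2) + (LINT x|S. (norm (g x - g' x))\<^sup>2))"

lemma comb_adm:
  assumes "\<Gamma> \<in> adm" "\<Gamma>' \<in> adm" "0 \<le> t" "t \<le> 1"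
  shows "comb t \<Gamma> \<Gamma>' \<in> adm"
proof -
  obtain Q f g where \<Gamma>: "\<Gamma> = (Q, f, g)" by (cases \<Gamma>) auto
  obtain Q' f' g' where \<Gamma>': "\<Gamma>' = (Q', f', g')" by (cases \<Gamma>') auto
  have Q: "Q \<in> borel_measurable M" "AE x in M. Q x \<in> K_set ql qu" and Q': "Q' \<in> borel_measurable M" "AE x in M. Q' x \<in> K_set ql qu"
    and fg: "f \<in> L2 M" "f' \<in> L2 M" "g \<in> L2 S" "g' \<in> L2 S"
    using assms by (auto simp: \<Gamma> \<Gamma>' adm_def)
  have "AE x in M. (1 - t) *\<^sub>R Q x + t *\<^sub>R Q' x \<in> K_set ql qu"
    using Q(2) Q'(2)
  proof eventually_elim
    case (elim x)
    then show ?case using assms(3,4) convexD[OF convex_K_set, of "Q x" ql qu "Q' x" "1 - t" t] by simp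
  qed
  then show ?thesis
    using Q(1) Q'(1) L2_lincomb[OF fg(1,2), of "1 - t" t] L2_lincomb[OF fg(3,4), of "1 - t" t]
    by (simp add: \<Gamma> \<Gamma>' comb_def adm_def)
qed

lemma Lag_comb:
  assumes adm: "\<Gamma> \<in> adm" "\<Gamma>' \<in> adm"
  shows "Lag (comb t \<Gamma> \<Gamma>') c = (1 - t) * Lag \<Gamma> c + t * Lag \<Gamma>' c - \<rho> * (t * (1 - t) * dsq \<Gamma> \<Gamma>')"
proof -
  obtain Q f g where \<Gamma>: "\<Gamma> = (Q, f, g)" by (cases \<Gamma>) auto
  obtain Q' f' g' where \<Gamma>': "\<Gamma>' = (Q', f', g')" by (cases \<Gamma>') auto
  note a = adm[unfolded \<Gamma> \<Gamma>']
  have fg: "f \<in> L2 M" "f' \<in> L2 M" "g \<in> L2 S" "g' \<in> L2 S" using a by (auto simp: adm_def)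
  have eq: "(\<lambda>x. ((1 - t) * f x + t * f' x) * ev c x) = (\<lambda>x. (1 - t) * (f x * ev c x) + t * (f' x * ev c x))"
    "(\<lambda>x. ((1 - t) * g x + t * g' x) * tv c x) = (\<lambda>x. (1 - t) * (g x * tv c x) + t * (g' x * tv c x))"
    "(\<lambda>x. (((1 - t) *\<^sub>R Q x + t *\<^sub>R Q' x) *v gv c x) \<bullet> gv c x)
      = (\<lambda>x. (1 - t) * ((Q x *v gv c x) \<bullet> gv c x) + t * ((Q' x *v gv c x) \<bullet> gv c x))" for c
    by (auto simp: distrib_right mult.assoc matrix_vector_mult_add_rdistrib inner_add_left simp flip: scaleR_matrix_vector_assoc)
  have l: "load (comb t \<Gamma> \<Gamma>') c = (1 - t) * load \<Gamma> c + t * load \<Gamma>' c" for c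
    using integrable_load[OF a(1)] integrable_load[OF a(2)]
    by (simp add: load_def comb_def \<Gamma> \<Gamma>' eq distrib_left)
  have q: "form (comb t \<Gamma> \<Gamma>') c c = (1 - t) * form \<Gamma> c c + t * form \<Gamma>' c c" for c
    using integrable_form[OF a(1)] integrable_form[OF a(2)]
    by (simp add: form_def comb_def \<Gamma> \<Gamma>' eq)
  have pe: "pen (comb t \<Gamma> \<Gamma>') = (1 - t) * pen \<Gamma> + t * pen \<Gamma>' - t * (1 - t) * dsq \<Gamma> \<Gamma>'"
    using L2_square_convex[OF adm_Q_L2[OF a(1)] adm_Q_L2[OF a(2)], of t]
      L2_square_convex[OF fg(1,2), of t] L2_square_convex[OF fg(3,4), of t]
    by (simp add: pen_def comb_def dsq_def \<Gamma> \<Gamma>' algebra_simps)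
  show ?thesis unfolding Lag_def l q pe by (simp add: algebra_simps)
qed

lemma dsq_nonneg: "0 \<le> dsq \<Gamma> \<Gamma>'"
  by (cases \<Gamma>; cases \<Gamma>') (auto simp: dsq_def)

lemma dsq_pos:
  assumes adm: "\<Gamma> \<in> adm" "\<Gamma>' \<in> adm" and ne: "\<not> aeq \<Gamma> \<Gamma>'"
  shows "0 < dsq \<Gamma> \<Gamma>'"
proof (rule ccontr)
  assume "\<not> 0 < dsq \<Gamma> \<Gamma>'"
  then have z: "dsq \<Gamma> \<Gamma>' = 0" using dsq_nonneg[of \<Gamma> \<Gamma>'] by linarith
  obtain Q f g where \<Gamma>: "\<Gamma> = (Q, f, g)" by (cases \<Gamma>) auto
  obtain Q' f' g' where \<Gamma>': "\<Gamma>' = (Q', f', g')" by (cases \<Gamma>') auto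
  note a = adm[unfolded \<Gamma> \<Gamma>']
  have fg: "f \<in> L2 M" "f' \<in> L2 M" "g \<in> L2 S" "g' \<in> L2 S" using a by (auto simp: adm_def)
  have int: "integrable M (\<lambda>x. (norm (Q x - Q' x))\<^sup>2)" "integrable M (\<lambda>x. (norm (f x - f' x))\<^sup>2)"
      "integrable S (\<lambda>x. (norm (g x - g' x))\<^sup>2)"
    using L2_lincomb[OF adm_Q_L2[OF a(1)] adm_Q_L2[OF a(2)], of 1 "-1"] L2_lincomb[OF fg(1,2), of 1 "-1"]
      L2_lincomb[OF fg(3,4), of 1 "-1"] by (simp_all add: L2_def)
  have nn: "0 \<le> (LINT x|M. (norm (Q x - Q' x))\<^sup>2)" "0 \<le> (LINT x|M. (norm (f x - f' x))\<^sup>2)"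
      "0 \<le> (LINT x|S. (norm (g x - g' x))\<^sup>2)"
    by (rule Bochner_Integration.integral_nonneg, simp)+
  have "(LINT x|M. (norm (Q x - Q' x))\<^sup>2) = 0" "(LINT x|M. (norm (f x - f' x))\<^sup>2) = 0"
      "(LINT x|S. (norm (g x - g' x))\<^sup>2) = 0"
    using z nn unfolding \<Gamma> \<Gamma>' dsq_def prod.case by linarith+
  then have "AE x in M. (norm (Q x - Q' x))\<^sup>2 = 0" "AE x in M. (norm (f x - f' x))\<^sup>2 = 0"
      "AE x in S. (norm (g x - g' x))\<^sup>2 = 0"
    using integral_nonneg_eq_0_iff_AE[OF int(1)] integral_nonneg_eq_0_iff_AE[OF int(2)]
      integral_nonneg_eq_0_iff_AE[OF int(3)] by auto
  then have "aeq \<Gamma> \<Gamma>'" by (simp add: aeq_def \<Gamma> \<Gamma>')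
  then show False using ne by blast
qed

text \<open>
  With the coefficients fixed to those of the state of the combined control, the Lagrangian is affine
  in the control up to the penalty, which contributes the strict gap; replacing them by those of the
  states of the two end points only increases the right-hand side.
\<close>

lemma strict_convexity:
  assumes adm: "\<Gamma> \<in> adm" "\<Gamma>' \<in> adm" and t: "0 < t" "t < 1"
    and s: "solves \<Gamma> c" "solves \<Gamma>' c'" "solves (comb t \<Gamma> \<Gamma>') c''" and ne: "\<not> aeq \<Gamma> \<Gamma>'"
  shows "Lag (comb t \<Gamma> \<Gamma>') c'' < (1 - t) * Lag \<Gamma> c + t * Lag \<Gamma>' c'"
proof -
  have "0 < \<rho> * (t * (1 - t) * dsq \<Gamma> \<Gamma>')" using t \<rho>_pos dsq_pos[OF adm ne] by simp
  then have "Lag (comb t \<Gamma> \<Gamma>') c'' < (1 - t) * Lag \<Gamma> c'' + t * Lag \<Gamma>' c''"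
    by (simp add: Lag_comb[OF adm])
  also have "\<dots> \<le> (1 - t) * Lag \<Gamma> c + t * Lag \<Gamma>' c'"
    using t Lag_le_solution adm s by (intro add_mono mult_left_mono) auto
  finally show ?thesis .
qed


lemma solution_unique:
  assumes \<Gamma>: "\<Gamma> \<in> adm" and s: "solves \<Gamma> c" "solves \<Gamma> c'" and k: "k < m"
  shows "c k = c' k"
proof -
  have "form \<Gamma> c c = load \<Gamma> c" "form \<Gamma> c c' = load \<Gamma> c'" "form \<Gamma> c' c' = load \<Gamma> c'" "form \<Gamma> c' c = load \<Gamma> c"
    using s by (auto simp: solves_def)
  then have "form \<Gamma> (\<lambda>k. c k - c' k) (\<lambda>k. c k - c' k) = 0"
    using form_sym[OF \<Gamma>, of c c'] by (simp add: form_diff[OF \<Gamma>])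
  then have "ql * (\<Sum>i<m. (c i - c' i)\<^sup>2) \<le> 0"
    using form_bounds(1)[OF \<Gamma>, of "\<lambda>k. c k - c' k"] by (simp add: energy_orthonormal)
  then have "(\<Sum>i<m. (c i - c' i)\<^sup>2) \<le> 0" using ql_pos by (simp add: mult_le_0_iff)
  moreover have "(c k - c' k)\<^sup>2 \<le> (\<Sum>i<m. (c i - c' i)\<^sup>2)" using k by (intro member_le_sum) auto
  ultimately have "(c k - c' k)\<^sup>2 \<le> 0" by linarith
  then show ?thesis by simp
qed

lemma opt_cong: "(\<And>k. k < m \<Longrightarrow> c k = c' k) \<Longrightarrow> opt c = opt c'"
  using ev_cong[of c c'] gv_cong[of c c'] tv_cong[of c c'] by (simp add: opt_def)

end

section \<open>The finite element space as a saddle point problem\<close>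

locale traced_domain = triangulated_domain \<Omega> \<T> for \<Omega> :: "(real^'n) set" and \<T> +
  fixes \<gamma> :: "(real^'n \<Rightarrow> real) \<Rightarrow> real^'n \<Rightarrow> real"
  assumes trace: "trace_operator \<Omega> \<gamma>"
begin

abbreviation "M \<equiv> lebesgue_on \<Omega>"
abbreviation "S \<equiv> surface_measure \<Omega>"
abbreviation "V \<equiv> V1 \<Omega> \<gamma> \<T>"

lemma trace_L2: "u \<in> H1 \<Omega> \<Longrightarrow> \<gamma> u \<in> L2 S"
  using trace by (simp add: trace_operator_def)

lemma trace_P1: "u \<in> P1_space \<Omega> \<T> \<Longrightarrow> AE x in S. \<gamma> u x = u x"
  using trace P1_space_subset_H1[of u] by (auto simp: trace_operator_def P1_space_def)

text \<open>
  The trace of the constant function 1 is square integrable over the boundary and equals 1 almost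
  everywhere.
\<close>

lemma finite_measure_surface: "finite_measure S"
proof -
  have c: "(\<lambda>x. 1) \<in> P1_space \<Omega> \<T>" by (rule P1_space_const)
  have L2: "\<gamma> (\<lambda>x. 1) \<in> L2 S" by (rule trace_L2[OF P1_space_subset_H1[OF c]])
  have "integrable S (\<lambda>x. 1 :: real)"
  proof (rule Bochner_Integration.integrable_cong_AE_imp)
    show "integrable S (\<lambda>x. (norm (\<gamma> (\<lambda>x. 1) x))\<^sup>2)" using L2 by (simp add: L2_def)
    show "AE x in S. (norm (\<gamma> (\<lambda>x. 1) x))\<^sup>2 = 1" using trace_P1[OF c] by eventually_elim simp
  qed simp
  then have "(\<integral>\<^sup>+ x. ennreal (norm (1::real)) \<partial>S) < \<infinity>" by (simp only: integrable_iff_bounded)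
  then have "emeasure S (space S) < \<infinity>" by simp
  then show ?thesis by (intro finite_measureI) auto
qed

lemma surface_area_pos: "0 < measure S (frontier \<Omega>)"
proof -
  have "emeasure S (frontier \<Omega>) \<noteq> 0"
    using surface_measure_positive[OF open_domain bounded_domain nonempty_domain] by auto
  then show ?thesis
    using finite_measure.emeasure_eq_measure[OF finite_measure_surface, of "frontier \<Omega>"]
    by (metis ennreal_0 less_eq_real_def measure_nonneg)
qed

lemma trace_P1_measurable: "u \<in> P1_space \<Omega> \<T> \<Longrightarrow> \<gamma> u \<in> borel_measurable S"
  using trace_L2[OF P1_space_subset_H1] by (auto simp: L2_def)

lemma trace_P1_bounded:
  assumes u: "u \<in> P1_space \<Omega> \<T>" shows "\<exists>C. AE x in S. \<bar>\<gamma> u x\<bar> \<le> C"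
proof -
  obtain C where "\<forall>x\<in>closure \<Omega>. \<bar>u x\<bar> \<le> C" using P1_space_bounded[OF u] by blast
  then have "AE x in S. \<bar>u x\<bar> \<le> C" by (intro AE_I2) (auto simp: frontier_def)
  then have "AE x in S. \<bar>\<gamma> u x\<bar> \<le> C" using trace_P1[OF u] by eventually_elim simp
  then show ?thesis by blast
qed

lemma trace_P1_integrable: "u \<in> P1_space \<Omega> \<T> \<Longrightarrow> integrable S (\<gamma> u)"
  using L2_integrable[OF finite_measure_surface trace_L2[OF P1_space_subset_H1]] .

lemma AE_surface_closure: "(\<And>x. x \<in> closure \<Omega> \<Longrightarrow> P x) \<Longrightarrow> AE x in S. P x"
  by (intro AE_I2) (auto simp: frontier_def)

lemma AE_domain_closure: "(\<And>x. x \<in> closure \<Omega> \<Longrightarrow> P x) \<Longrightarrow> AE x in M. P x"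
  using closure_subset by (intro AE_I2) (auto simp: space_restrict_space)

definition mean :: "(real^'n \<Rightarrow> real) \<Rightarrow> real" where
  "mean u = (LINT x|S. \<gamma> u x) / measure S (frontier \<Omega>)"

lemma sub_mean_in_V:
  assumes u: "u \<in> P1_space \<Omega> \<T>" shows "(\<lambda>x. u x - mean u) \<in> V"
proof -
  have w: "(\<lambda>x. u x - mean u) \<in> P1_space \<Omega> \<T>" by (rule P1_space_add_const[OF u])
  have "(LINT x|S. \<gamma> (\<lambda>x. u x - mean u) x) = (LINT x|S. \<gamma> u x - mean u)"
  proof (rule integral_cong_AE)
    show "AE x in S. \<gamma> (\<lambda>x. u x - mean u) x = \<gamma> u x - mean u"
      using trace_P1[OF u] trace_P1[OF w] by eventually_elim simp
  qed (use trace_P1_measurable[OF u] trace_P1_measurable[OF w] in auto)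
  also have "\<dots> = (LINT x|S. \<gamma> u x) - mean u * measure S (frontier \<Omega>)"
    using trace_P1_integrable[OF u] finite_measure.integrable_const[OF finite_measure_surface, of "mean u"]
    by (simp add: mult.commute)
  also have "\<dots> = 0" using surface_area_pos by (simp add: mean_def)
  finally show ?thesis using w P1_space_subset_H1[OF w] by (simp add: V1_def H1_diamond_def)
qed

lemma V_P1: "u \<in> V \<Longrightarrow> u \<in> P1_space \<Omega> \<T>" and V_H1: "u \<in> V \<Longrightarrow> u \<in> H1 \<Omega>"
  and V_mean: "u \<in> V \<Longrightarrow> (LINT x|S. \<gamma> u x) = 0"
  by (auto simp: V1_def H1_diamond_def)


lemma V_lincomb:
  assumes u: "u \<in> V" and v: "v \<in> V" shows "(\<lambda>x. a * u x + b * v x) \<in> V"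
proof -
  have w: "(\<lambda>x. a * u x + b * v x) \<in> P1_space \<Omega> \<T>" by (rule P1_space_lincomb[OF V_P1[OF u] V_P1[OF v]])
  have "(LINT x|S. \<gamma> (\<lambda>x. a * u x + b * v x) x) = (LINT x|S. a * \<gamma> u x + b * \<gamma> v x)"
  proof (rule integral_cong_AE)
    show "AE x in S. \<gamma> (\<lambda>x. a * u x + b * v x) x = a * \<gamma> u x + b * \<gamma> v x"
      using trace_P1[OF V_P1[OF u]] trace_P1[OF V_P1[OF v]] trace_P1[OF w] by eventually_elim simp
  qed (use trace_P1_measurable[OF V_P1[OF u]] trace_P1_measurable[OF V_P1[OF v]] trace_P1_measurable[OF w] in auto)
  also have "\<dots> = 0"
    using trace_P1_integrable[OF V_P1[OF u]] trace_P1_integrable[OF V_P1[OF v]] V_mean[OF u] V_mean[OF v] by simp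
  finally show ?thesis using w P1_space_subset_H1[OF w] by (simp add: V1_def H1_diamond_def)
qed

lemma grad_measurable: "u \<in> P1_space \<Omega> \<T> \<Longrightarrow> grad \<Omega> u \<in> borel_measurable M"
  using grad_weak_gradient(1)[OF P1_space_subset_H1] by (auto simp: L2_def)

lemma grad_inner_integrable:
  assumes "u \<in> P1_space \<Omega> \<T>" "v \<in> P1_space \<Omega> \<T>"
  shows "integrable M (\<lambda>x. grad \<Omega> u x \<bullet> grad \<Omega> v x)"
proof -
  obtain C D where CD: "AE x in M. norm (grad \<Omega> u x) \<le> C" "AE x in M. norm (grad \<Omega> v x) \<le> D"
    using P1_space_grad_bounded assms by metis
  have "AE x in M. norm (grad \<Omega> u x \<bullet> grad \<Omega> v x) \<le> C * D"
    using CD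
  proof eventually_elim
    case (elim x)
    have "norm (grad \<Omega> u x \<bullet> grad \<Omega> v x) \<le> norm (grad \<Omega> u x) * norm (grad \<Omega> v x)"
      using Cauchy_Schwarz_ineq2 by simp
    also have "\<dots> \<le> C * D" using elim order_trans[OF norm_ge_zero elim(1)] by (intro mult_mono) auto
    finally show ?case .
  qed
  then show ?thesis
    by (rule finite_measure.integrable_const_bound[OF finite_measure_domain])
      (intro borel_measurable_inner grad_measurable assms)
qed

lemma energy_semi_inner_product:
  "semi_inner_product_on V (\<lambda>u v. LINT x|M. grad \<Omega> u x \<bullet> grad \<Omega> v x)"
proof
  show "(\<lambda>x. 0) \<in> V"
    using sub_mean_in_V[OF P1_space_const[of 0]] V_lincomb[of "\<lambda>x. 0 - mean (\<lambda>x. 0)" "\<lambda>x. 0 - mean (\<lambda>x. 0)" 0 0] by simp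
  show "(\<lambda>x. a * u x + b * v x) \<in> V" if "u \<in> V" "v \<in> V" for u v a b by (rule V_lincomb[OF that])
  fix u v assume u: "u \<in> V" and v: "v \<in> V"
  show "(LINT x|M. grad \<Omega> u x \<bullet> grad \<Omega> v x) = (LINT x|M. grad \<Omega> v x \<bullet> grad \<Omega> u x)"
    by (simp add: inner_commute)
  show "0 \<le> (LINT x|M. grad \<Omega> u x \<bullet> grad \<Omega> u x)"
    by (rule Bochner_Integration.integral_nonneg) simp
  fix w a b assume w: "w \<in> V"
  note P = V_P1[OF u] V_P1[OF v] V_P1[OF w]
  have "(LINT x|M. grad \<Omega> (\<lambda>x. a * u x + b * v x) x \<bullet> grad \<Omega> w x)
      = (LINT x|M. a * (grad \<Omega> u x \<bullet> grad \<Omega> w x) + b * (grad \<Omega> v x \<bullet> grad \<Omega> w x))"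
  proof (rule integral_cong_AE)
    show "AE x in M. grad \<Omega> (\<lambda>x. a * u x + b * v x) x \<bullet> grad \<Omega> w x
        = a * (grad \<Omega> u x \<bullet> grad \<Omega> w x) + b * (grad \<Omega> v x \<bullet> grad \<Omega> w x)"
      using H1_lincomb(2)[OF open_domain bounded_domain V_H1[OF u] V_H1[OF v], of a b]
      by eventually_elim (simp add: inner_add_left)
  qed (intro borel_measurable_inner borel_measurable_add borel_measurable_times borel_measurable_const
      grad_measurable P P1_space_lincomb)+
  then show "(LINT x|M. grad \<Omega> (\<lambda>x. a * u x + b * v x) x \<bullet> grad \<Omega> w x)
      = a * (LINT x|M. grad \<Omega> u x \<bullet> grad \<Omega> w x) + b * (LINT x|M. grad \<Omega> v x \<bullet> grad \<Omega> w x)"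
    using grad_inner_integrable[OF P(1,3)] grad_inner_integrable[OF P(2,3)] by simp
qed

sublocale energy: semi_inner_product_on V "\<lambda>u v. LINT x|M. grad \<Omega> u x \<bullet> grad \<Omega> v x"
  by (rule energy_semi_inner_product)

lemma energy_definite:
  assumes u: "u \<in> V" and z: "(LINT x|M. grad \<Omega> u x \<bullet> grad \<Omega> u x) = 0"
  shows "\<forall>x\<in>closure \<Omega>. u x = 0"
proof -
  have "AE x in M. grad \<Omega> u x \<bullet> grad \<Omega> u x = 0"
    using integral_nonneg_eq_0_iff_AE[OF grad_inner_integrable[OF V_P1[OF u] V_P1[OF u]]] z by simp
  then have "AE x in M. grad \<Omega> u x = 0" by simp
  then obtain c where c: "\<forall>x\<in>closure \<Omega>. u x = c" using P1_space_grad_zero_imp_const[OF V_P1[OF u]] by blast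
  have "(LINT x|S. \<gamma> u x) = (LINT x|S. c)"
  proof (rule integral_cong_AE)
    have "AE x in S. u x = c" using c by (intro AE_surface_closure) auto
    then show "AE x in S. \<gamma> u x = c" using trace_P1[OF V_P1[OF u]] by eventually_elim simp
  qed (use trace_P1_measurable[OF V_P1[OF u]] in auto)
  then have "c * measure S (frontier \<Omega>) = 0" using V_mean[OF u] by (simp add: mult.commute)
  then show ?thesis using c surface_area_pos by simp
qed

text \<open>
  The functions \<open>h z\<close> are the nodal hat functions shifted to mean zero. A combination with the nodal
  values of a mean-free \<open>v\<close> reproduces \<open>v\<close>, since the shifts add up to the mean of \<open>v\<close>,
  which is zero.
\<close>

lemma V_spanned:
  "\<exists>h. (\<forall>z\<in>nodes \<T>. h z \<in> V) \<and> (\<forall>v\<in>V. \<forall>x\<in>closure \<Omega>. v x = (\<Sum>z\<in>nodes \<T>. v z * h z x))"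
proof -
  let ?N = "nodes \<T>"
  have "\<forall>z. \<exists>w. w \<in> P1_space \<Omega> \<T> \<and> (\<forall>y\<in>?N. w y = (if y = z then 1 else 0))"
    using P1_space_interpolation[of "\<lambda>y. if y = _ then 1 else 0"] by blast
  then obtain hat where hat: "\<And>z. hat z \<in> P1_space \<Omega> \<T>" "\<And>z y. y \<in> ?N \<Longrightarrow> hat z y = (if y = z then 1 else 0)"
    by metis
  define h where "h z x = hat z x - mean (hat z)" for z x
  have hV: "h z \<in> V" for z unfolding h_def by (rule sub_mean_in_V[OF hat(1)])
  have P1_sum: "(\<lambda>x. \<Sum>z\<in>I. c z * hat z x) \<in> P1_space \<Omega> \<T>" if "finite I" for I c
    using that
  proof (induction rule: finite_induct)
    case (insert z I)
    then show ?case using P1_space_lincomb[OF hat(1)[of z] insert.IH, of "c z" 1] by simp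
  qed (simp add: P1_space_const)
  have "v x = (\<Sum>z\<in>?N. v z * h z x)" if v: "v \<in> V" and x: "x \<in> closure \<Omega>" for v x
  proof -
    have rep: "v y = (\<Sum>z\<in>?N. v z * hat z y)" if y: "y \<in> closure \<Omega>" for y
    proof (rule P1_space_eq_if_nodes_eq[OF V_P1[OF v] P1_sum[OF finite_nodes] _ y])
      fix y assume y: "y \<in> ?N"
      have "(\<Sum>z\<in>?N. v z * hat z y) = (\<Sum>z\<in>?N. if z = y then v y else 0)"
        by (rule sum.cong) (auto simp: hat(2)[OF y])
      then show "v y = (\<Sum>z\<in>?N. v z * hat z y)" using y finite_nodes by simp
    qed
    have "(LINT y|S. \<gamma> v y) = (LINT y|S. (\<Sum>z\<in>?N. v z * \<gamma> (hat z) y))"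
    proof (rule integral_cong_AE)
      have "AE y in S. \<forall>z\<in>?N. \<gamma> (hat z) y = hat z y"
        using finite_nodes trace_P1[OF hat(1)] by (intro AE_finite_allI) auto
      moreover have "AE y in S. v y = (\<Sum>z\<in>?N. v z * hat z y)" by (rule AE_surface_closure[OF rep])
      ultimately show "AE y in S. \<gamma> v y = (\<Sum>z\<in>?N. v z * \<gamma> (hat z) y)"
        using trace_P1[OF V_P1[OF v]] by eventually_elim simp
    qed (use trace_P1_measurable[OF V_P1[OF v]] trace_P1_measurable[OF hat(1)] in auto)
    also have "\<dots> = (\<Sum>z\<in>?N. v z * (LINT y|S. \<gamma> (hat z) y))"
      using trace_P1_integrable[OF hat(1)] by (subst Bochner_Integration.integral_sum) auto
    also have "\<dots> = measure S (frontier \<Omega>) * (\<Sum>z\<in>?N. v z * mean (hat z))"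
      using surface_area_pos by (simp add: mean_def sum_distrib_left)
    finally have "(\<Sum>z\<in>?N. v z * mean (hat z)) = 0"
      using V_mean[OF v] surface_area_pos by simp
    then show ?thesis using rep[OF x] by (simp add: h_def right_diff_distrib sum_subtractf)
  qed
  then show ?thesis using hV by blast
qed

lemma V_orthonormal_basis:
  "\<exists>(m::nat) e. (\<forall>k<m. e k \<in> V) \<and>
    (\<forall>j<m. \<forall>k<m. (LINT x|M. grad \<Omega> (e j) x \<bullet> grad \<Omega> (e k) x) = (if j = k then 1 else 0)) \<and>
    (\<forall>v\<in>V. \<exists>c. \<forall>x\<in>closure \<Omega>. v x = (\<Sum>k<m. c k * e k x))"
proof -
  let ?N = "nodes \<T>"
  obtain h where h: "\<And>z. z \<in> ?N \<Longrightarrow> h z \<in> V"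
      "\<And>v x. v \<in> V \<Longrightarrow> x \<in> closure \<Omega> \<Longrightarrow> v x = (\<Sum>z\<in>?N. v z * h z x)"
    using V_spanned by blast
  have F: "finite (h ` ?N)" "h ` ?N \<subseteq> V" using finite_nodes h(1) by auto
  obtain m :: nat and e where e: "\<forall>k<m. e k \<in> V"
      "\<forall>j<m. \<forall>k<m. (LINT x|M. grad \<Omega> (e j) x \<bullet> grad \<Omega> (e k) x) = (if j = k then 1 else 0)"
      "\<forall>u\<in>h ` ?N. \<exists>c. \<forall>x\<in>closure \<Omega>. u x = (\<Sum>k<m. c k * e k x)"
    using energy.orthonormal_basis[where X = "closure \<Omega>", OF energy_definite F] by blast
  from e(3) have "\<forall>z\<in>?N. \<exists>c. \<forall>x\<in>closure \<Omega>. h z x = (\<Sum>k<m. c k * e k x)" by simp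
  from bchoice[OF this] obtain C where C: "\<And>z x. z \<in> ?N \<Longrightarrow> x \<in> closure \<Omega> \<Longrightarrow> h z x = (\<Sum>k<m. C z k * e k x)"
    by blast
  have "\<exists>c. \<forall>x\<in>closure \<Omega>. v x = (\<Sum>k<m. c k * e k x)" if v: "v \<in> V" for v
  proof -
    have "v x = (\<Sum>k<m. (\<Sum>z\<in>?N. v z * C z k) * e k x)" if x: "x \<in> closure \<Omega>" for x
    proof -
      have "v x = (\<Sum>z\<in>?N. \<Sum>k<m. v z * C z k * e k x)"
        unfolding h(2)[OF v x] using C x by (simp add: sum_distrib_left mult.assoc)
      also have "\<dots> = (\<Sum>k<m. \<Sum>z\<in>?N. v z * C z k * e k x)" by (rule sum.swap)
      finally show ?thesis by (simp add: sum_distrib_right)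
    qed
    then show ?thesis by (intro exI[of _ "\<lambda>k. \<Sum>z\<in>?N. v z * C z k"]) simp
  qed
  then show ?thesis using e by blast
qed


lemma clement_bar_in_V:
  assumes "z \<in> L2 M" shows "clement_bar \<Omega> \<gamma> \<T> z \<in> V"
  using sub_mean_in_V[OF clement_in_P1_space[OF assms]] by (simp add: clement_bar_def[abs_def] mean_def)

lemma grad_clement_bar:
  assumes z: "z \<in> L2 M"
  shows "AE x in M. grad \<Omega> (clement_bar \<Omega> \<gamma> \<T> z) x = grad \<Omega> (clement \<Omega> \<T> z) x"
proof -
  define \<mu> where "\<mu> = mean (clement \<Omega> \<T> z)"
  note w = clement_in_P1_space[OF z]
  obtain a b where pieces: "\<And>T x. T \<in> \<T> \<Longrightarrow> x \<in> T \<Longrightarrow> clement \<Omega> \<T> z x = a T \<bullet> x + b T"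
    using P1_space_affine_pieces[OF w] by blast
  have "AE x in M. grad \<Omega> (clement \<Omega> \<T> z) x = pw_grad a x"
    by (rule P1_space_grad(2)[OF w]) (rule pieces)
  moreover have "AE x in M. grad \<Omega> (\<lambda>x. clement \<Omega> \<T> z x - \<mu>) x = pw_grad a x"
    by (rule P1_space_grad(2)[where b = "\<lambda>T. b T - \<mu>", OF P1_space_add_const[OF w]]) (simp add: pieces)
  ultimately have "AE x in M. grad \<Omega> (\<lambda>x. clement \<Omega> \<T> z x - \<mu>) x = grad \<Omega> (clement \<Omega> \<T> z) x"
    by eventually_elim simp
  then show ?thesis by (simp add: clement_bar_def[abs_def] \<mu>_def mean_def)
qed

lemma grad_cong_closure:
  assumes u: "u \<in> P1_space \<Omega> \<T>" and v: "v \<in> P1_space \<Omega> \<T>" and eq: "\<And>x. x \<in> closure \<Omega> \<Longrightarrow> u x = v x"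
  shows "AE x in M. grad \<Omega> u x = grad \<Omega> v x"
proof -
  obtain a b where pieces: "\<And>T x. T \<in> \<T> \<Longrightarrow> x \<in> T \<Longrightarrow> u x = a T \<bullet> x + b T"
    using P1_space_affine_pieces[OF u] by blast
  have "AE x in M. grad \<Omega> u x = pw_grad a x"
    by (rule P1_space_grad(2)[OF u]) (rule pieces)
  moreover have "AE x in M. grad \<Omega> v x = pw_grad a x"
  proof (rule P1_space_grad(2)[OF v])
    fix T x assume T: "T \<in> \<T>" "x \<in> T"
    then have "x \<in> closure \<Omega>" using Union_mesh by blast
    then show "v x = a T \<bullet> x + b T" using pieces[OF T] eq by simp
  qed
  ultimately show ?thesis by eventually_elim simp
qed

lemma grad_sum:
  assumes "finite I" "\<And>i. i \<in> I \<Longrightarrow> f i \<in> V"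
  shows "AE x in M. grad \<Omega> (\<lambda>x. \<Sum>i\<in>I. c i * f i x) x = (\<Sum>i\<in>I. c i *\<^sub>R grad \<Omega> (f i) x)"
  using assms
proof (induction rule: finite_induct)
  case empty
  have "AE x in M. grad \<Omega> (\<lambda>x. 0) x = pw_grad (\<lambda>_. 0) x"
    by (rule P1_space_grad(2)[where b = "\<lambda>_. 0", OF P1_space_const]) simp
  then show ?case by (simp add: pw_grad_def)
next
  case (insert i I)
  have "AE x in M. grad \<Omega> (\<lambda>x. c i * f i x + 1 * (\<Sum>i\<in>I. c i * f i x)) x
      = c i *\<^sub>R grad \<Omega> (f i) x + 1 *\<^sub>R grad \<Omega> (\<lambda>x. \<Sum>i\<in>I. c i * f i x) x"
    using insert.prems insert.hyps
    by (intro H1_lincomb(2)[OF open_domain bounded_domain] V_H1 energy.V_sum) auto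
  moreover have "AE x in M. grad \<Omega> (\<lambda>x. \<Sum>i\<in>I. c i * f i x) x = (\<Sum>i\<in>I. c i *\<^sub>R grad \<Omega> (f i) x)"
    using insert by auto
  ultimately show ?case
    by eventually_elim (use insert.hyps in simp)
qed

end

section \<open>The minimization problem\<close>

text \<open>
  The locale fixes an energy orthonormal basis of the discrete space and the coefficients of the
  interpolated data, so that it becomes an instance of the problem in coefficient vectors.
\<close>

locale fe_minimization = traced_domain \<Omega> \<T> \<gamma> for \<Omega> :: "(real^'n) set" and \<T> \<gamma> +
  fixes z :: "real^'n \<Rightarrow> real" and \<rho> ql qu :: real
    and m :: nat and e :: "nat \<Rightarrow> real^'n \<Rightarrow> real" and p :: "nat \<Rightarrow> real"
  assumes z: "z \<in> L2 (lebesgue_on \<Omega>)" and pos: "0 < \<rho>" "0 < ql" "ql \<le> qu"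
    and basis_in_V: "k < m \<Longrightarrow> e k \<in> V1 \<Omega> \<gamma> \<T>"
    and basis_orthonormal: "j < m \<Longrightarrow> k < m \<Longrightarrow>
      (LINT x|lebesgue_on \<Omega>. grad \<Omega> (e j) x \<bullet> grad \<Omega> (e k) x) = (if j = k then 1 else 0)"
    and basis_spans: "v \<in> V1 \<Omega> \<gamma> \<T> \<Longrightarrow> \<exists>c. \<forall>x\<in>closure \<Omega>. v x = (\<Sum>k<m. c k * e k x)"
    and clement_coefficients: "x \<in> closure \<Omega> \<Longrightarrow> clement_bar \<Omega> \<gamma> \<T> z x = (\<Sum>k<m. p k * e k x)"
begin

sublocale saddle_problem M S m e "\<lambda>k. grad \<Omega> (e k)" "\<lambda>k. \<gamma> (e k)" p \<rho> ql qu
proof (rule saddle_problem.intro)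
  fix k assume k: "k < m"
  note P = V_P1[OF basis_in_V[OF k]]
  show "e k \<in> borel_measurable M" by (rule P1_space_measurable[OF P])
  obtain C where "\<forall>x\<in>closure \<Omega>. \<bar>e k x\<bar> \<le> C" using P1_space_bounded[OF P] by blast
  then show "\<exists>C. AE x in M. \<bar>e k x\<bar> \<le> C" by (intro exI[of _ C] AE_domain_closure) auto
  show "grad \<Omega> (e k) \<in> borel_measurable M" by (rule grad_measurable[OF P])
  show "\<exists>C. AE x in M. norm (grad \<Omega> (e k) x) \<le> C" by (rule P1_space_grad_bounded[OF P])
  show "\<gamma> (e k) \<in> borel_measurable S" by (rule trace_P1_measurable[OF P])
  show "\<exists>C. AE x in S. \<bar>\<gamma> (e k) x\<bar> \<le> C" by (rule trace_P1_bounded[OF P])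
next
  show "finite_measure M" by (rule finite_measure_domain)
  show "finite_measure S" by (rule finite_measure_surface)
qed (use basis_orthonormal pos in auto)

definition rep :: "(real^'n \<Rightarrow> real) \<Rightarrow> (nat \<Rightarrow> real) \<Rightarrow> bool" where
  "rep v c \<longleftrightarrow> v \<in> V \<and> (\<forall>x\<in>closure \<Omega>. v x = (\<Sum>k<m. c k * e k x))"

lemma rep_exists: "v \<in> V \<Longrightarrow> \<exists>c. rep v c"
  using basis_spans by (simp add: rep_def)

lemma rep_sum: "rep (\<lambda>x. \<Sum>k<m. c k * e k x) c"
  using energy.V_sum[of "{..<m}" e c] basis_in_V by (simp add: rep_def)

lemma rep_clement: "rep (clement_bar \<Omega> \<gamma> \<T> z) p"
  using clement_bar_in_V[OF z] clement_coefficients by (simp add: rep_def)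

lemma rep_AE:
  assumes "rep v c"
  shows "AE x in M. v x = ev c x" "AE x in M. grad \<Omega> v x = gv c x" "AE x in S. \<gamma> v x = tv c x"
proof -
  have v: "v \<in> V" and eq: "\<And>x. x \<in> closure \<Omega> \<Longrightarrow> v x = (\<Sum>k<m. c k * e k x)"
    using assms by (auto simp: rep_def)
  have s: "(\<lambda>x. \<Sum>k<m. c k * e k x) \<in> V" using rep_sum by (simp add: rep_def)
  show "AE x in M. v x = ev c x" using eq by (intro AE_domain_closure) (simp add: ev_def)
  have "AE x in M. grad \<Omega> v x = grad \<Omega> (\<lambda>x. \<Sum>k<m. c k * e k x) x"
    by (rule grad_cong_closure[OF V_P1[OF v] V_P1[OF s] eq])
  moreover have "AE x in M. grad \<Omega> (\<lambda>x. \<Sum>k<m. c k * e k x) x = (\<Sum>k<m. c k *\<^sub>R grad \<Omega> (e k) x)"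
    by (rule grad_sum) (use basis_in_V in auto)
  ultimately show "AE x in M. grad \<Omega> v x = gv c x" by eventually_elim (simp add: gv_def)
  have "AE x in S. \<forall>k\<in>{..<m}. \<gamma> (e k) x = e k x"
    using trace_P1[OF V_P1[OF basis_in_V]] by (intro AE_finite_allI) auto
  moreover have "AE x in S. v x = (\<Sum>k<m. c k * e k x)" by (rule AE_surface_closure[OF eq])
  ultimately show "AE x in S. \<gamma> v x = tv c x"
    using trace_P1[OF V_P1[OF v]] by eventually_elim (simp add: tv_def)
qed

lemma H_ad_eq_adm: "H_ad \<Omega> ql qu = adm"
proof -
  have "Q \<in> Q_ad \<Omega> ql qu \<longleftrightarrow> Q \<in> borel_measurable M \<and> (AE x in M. Q x \<in> K_set ql qu)" for Q :: "real^'n \<Rightarrow> real^'n^'n"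
  proof
    assume Q: "Q \<in> Q_ad \<Omega> ql qu"
    then have "\<And>i j. (\<lambda>x. Q x $ i $ j) \<in> borel_measurable M"
      by (auto simp: Q_ad_def Linf_sym_def Linf_def)
    then have "Q \<in> borel_measurable M"
      by (subst borel_measurable_euclidean_space) (auto simp: Basis_vec_def inner_axis)
    moreover have "AE x in M. Q x \<in> sym_matrices" "AE x in M. spectral_bounds ql qu (Q x)"
      using Q by (auto simp: Q_ad_def Linf_sym_def)
    then have "AE x in M. Q x \<in> K_set ql qu" by eventually_elim (simp add: K_set_def)
    ultimately show "Q \<in> borel_measurable M \<and> (AE x in M. Q x \<in> K_set ql qu)" by blast
  next
    assume Q: "Q \<in> borel_measurable M \<and> (AE x in M. Q x \<in> K_set ql qu)"
    have "AE x in M. norm (Q x $ i $ j) \<le> qu" for i j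
      using conjunct2[OF Q] by eventually_elim (use K_set_entry_le[OF _ less_imp_le[OF pos(2)]] in auto)
    moreover have "AE x in M. Q x \<in> sym_matrices" "AE x in M. spectral_bounds ql qu (Q x)"
      using conjunct2[OF Q] by (eventually_elim, simp add: K_set_def)+
    ultimately show "Q \<in> Q_ad \<Omega> ql qu"
      using measurable_entry[OF conjunct1[OF Q]] by (auto simp: Q_ad_def Linf_sym_def Linf_def)
  qed
  then show ?thesis by (auto simp: H_ad_def adm_def)
qed

lemma ae_equal_eq_aeq: "ae_equal \<Omega> = aeq"
  by (simp add: ae_equal_def aeq_def)

lemma convex_comb_eq_comb: "convex_comb = comb"
  by (simp add: convex_comb_def comb_def fun_eq_iff)

lemma weak_form_rep:
  assumes adm: "(Q, f, g) \<in> adm" and u: "rep u c" and v: "rep v d"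
  shows "(LINT x|M. (Q x *v grad \<Omega> u x) \<bullet> grad \<Omega> v x) = form (Q, f, g) c d"
    "(LINT x|M. f x * v x) + (LINT x|S. g x * \<gamma> v x) = load (Q, f, g) d"
proof -
  have P: "u \<in> P1_space \<Omega> \<T>" "v \<in> P1_space \<Omega> \<T>" using u v V_P1 by (auto simp: rep_def)
  have me: "Q \<in> borel_measurable M" "f \<in> borel_measurable M" "g \<in> borel_measurable S"
    using adm by (auto simp: adm_def L2_def)
  have "(LINT x|M. (Q x *v grad \<Omega> u x) \<bullet> grad \<Omega> v x) = (LINT x|M. (Q x *v gv c x) \<bullet> gv d x)"
  proof (rule integral_cong_AE)
    show "AE x in M. (Q x *v grad \<Omega> u x) \<bullet> grad \<Omega> v x = (Q x *v gv c x) \<bullet> gv d x"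
      using rep_AE(2)[OF u] rep_AE(2)[OF v] by eventually_elim simp
  qed (intro borel_measurable_quadratic_form me grad_measurable gv_measurable P)+
  then show "(LINT x|M. (Q x *v grad \<Omega> u x) \<bullet> grad \<Omega> v x) = form (Q, f, g) c d" by (simp add: form_def)
  have "(LINT x|M. f x * v x) = (LINT x|M. f x * ev d x)"
  proof (rule integral_cong_AE)
    show "AE x in M. f x * v x = f x * ev d x" using rep_AE(1)[OF v] by eventually_elim simp
  qed (intro borel_measurable_times me P1_space_measurable P ev_measurable)+
  moreover have "(LINT x|S. g x * \<gamma> v x) = (LINT x|S. g x * tv d x)"
  proof (rule integral_cong_AE)
    show "AE x in S. g x * \<gamma> v x = g x * tv d x" using rep_AE(3)[OF v] by eventually_elim simp
  qed (intro borel_measurable_times me trace_P1_measurable P tv_measurable)+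
  ultimately show "(LINT x|M. f x * v x) + (LINT x|S. g x * \<gamma> v x) = load (Q, f, g) d" by (simp add: load_def)
qed

text \<open>
  The coefficient problem has a solution, so the property behind the choice operator can be satisfied
  and hence holds for the chosen function; testing with the basis functions shows that the coefficients
  of the chosen function solve the coefficient problem.
\<close>

lemma fe_solution_rep:
  assumes adm: "(Q, f, g) \<in> adm"
  shows "\<exists>c. rep (fe_solution \<Omega> \<gamma> \<T> (Q, f, g)) c \<and> solves (Q, f, g) c"
proof -
  let ?P = "\<lambda>u. u \<in> V \<and> (\<forall>\<phi>\<in>V. (LINT x|M. (Q x *v grad \<Omega> u x) \<bullet> grad \<Omega> \<phi> x)
      = (LINT x|M. f x * \<phi> x) + (LINT x|S. g x * \<gamma> \<phi> x))"
  let ?U = "fe_solution \<Omega> \<gamma> \<T> (Q, f, g)"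
  obtain c where c: "solves (Q, f, g) c" using solution_exists[OF adm] by blast
  have "?P (\<lambda>x. \<Sum>k<m. c k * e k x)"
  proof (intro conjI ballI)
    show "(\<lambda>x. \<Sum>k<m. c k * e k x) \<in> V" using rep_sum by (simp add: rep_def)
    fix \<phi> assume "\<phi> \<in> V"
    then obtain d where d: "rep \<phi> d" using rep_exists by blast
    show "(LINT x|M. (Q x *v grad \<Omega> (\<lambda>x. \<Sum>k<m. c k * e k x) x) \<bullet> grad \<Omega> \<phi> x)
        = (LINT x|M. f x * \<phi> x) + (LINT x|S. g x * \<gamma> \<phi> x)"
      unfolding weak_form_rep[OF adm rep_sum d] using c by (simp add: solves_def)
  qed
  then have "?P (SOME u. ?P u)" by (rule someI[of ?P])
  then have U: "?P ?U" by (simp add: fe_solution_def)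
  then obtain cU where cU: "rep ?U cU" using rep_exists by blast
  have "form (Q, f, g) cU d = load (Q, f, g) d" for d
  proof -
    have "(\<lambda>x. \<Sum>k<m. d k * e k x) \<in> V" using rep_sum by (simp add: rep_def)
    then have "(LINT x|M. (Q x *v grad \<Omega> ?U x) \<bullet> grad \<Omega> (\<lambda>x. \<Sum>k<m. d k * e k x) x)
        = (LINT x|M. f x * (\<Sum>k<m. d k * e k x)) + (LINT x|S. g x * \<gamma> (\<lambda>x. \<Sum>k<m. d k * e k x) x)"
      using U by blast
    then show ?thesis using weak_form_rep[OF adm cU rep_sum] by simp
  qed
  then show ?thesis using cU by (auto simp: solves_def)
qed

lemma penalty_eq_pen:
  assumes adm: "(Q, f, g) \<in> adm" shows "penalty \<Omega> (Q, f, g) = pen (Q, f, g)"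
proof -
  have Q: "Q \<in> borel_measurable M" "AE x in M. Q x \<in> K_set ql qu" using adm by (auto simp: adm_def)
  have int: "integrable M (\<lambda>x. (Q x $ i $ j)\<^sup>2)" for i j
  proof -
    have "AE x in M. norm (Q x $ i $ j) \<le> qu"
      using Q(2) by eventually_elim (use K_set_entry_le[OF _ less_imp_le[OF pos(2)]] in auto)
    then have "(\<lambda>x. Q x $ i $ j) \<in> L2 M"
      by (rule L2_bounded[OF finite_measure_domain measurable_entry[OF Q(1)]])
    then show ?thesis by (simp add: L2_def)
  qed
  have "(norm (A :: real^'n^'n))\<^sup>2 = (\<Sum>i\<in>UNIV. \<Sum>j\<in>UNIV. (A $ i $ j)\<^sup>2)" for A
    unfolding power2_norm_eq_inner by (simp add: inner_vec_def power2_eq_square)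
  then have "(LINT x|M. (norm (Q x))\<^sup>2) = (\<Sum>i\<in>UNIV. \<Sum>j\<in>UNIV. LINT x|M. (Q x $ i $ j)\<^sup>2)"
    using int by (simp add: Bochner_Integration.integral_sum Bochner_Integration.integrable_sum)
  then show ?thesis by (simp add: penalty_def pen_def L2_normsq_def)
qed

text \<open>
  The interpolant and its mean-free version differ by a constant and have the same gradient, so the
  error in the cost has the gradient of the discrete function with coefficients \<open>cU - p\<close>.
\<close>

lemma Upsilon_eq_Lag:
  assumes adm: "\<Gamma> \<in> adm" and s: "solves \<Gamma> c"
  shows "Upsilon \<Omega> \<gamma> \<T> \<rho> z \<Gamma> = Lag \<Gamma> c"
proof -
  obtain Q f g where \<Gamma>: "\<Gamma> = (Q, f, g)" by (cases \<Gamma>) auto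
  note a = adm[unfolded \<Gamma>]
  let ?U = "fe_solution \<Omega> \<gamma> \<T> (Q, f, g)"
  obtain cU where cU: "rep ?U cU" "solves (Q, f, g) cU" using fe_solution_rep[OF a] by blast
  have Q: "Q \<in> borel_measurable M" using a by (simp add: adm_def)
  have P: "?U \<in> P1_space \<Omega> \<T>" using cU(1) V_P1 by (simp add: rep_def)
  note C = clement_in_P1_space[OF z]
  define w where "w = (\<lambda>x. 1 * ?U x + (-1) * clement \<Omega> \<T> z x)"
  have w: "w \<in> P1_space \<Omega> \<T>" unfolding w_def by (rule P1_space_lincomb[OF P C])
  have "AE x in M. grad \<Omega> w x = gv (\<lambda>k. 1 * cU k + (-1) * p k) x"
    using H1_lincomb(2)[OF open_domain bounded_domain P1_space_subset_H1[OF P] P1_space_subset_H1[OF C], of 1 "-1"]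
      rep_AE(2)[OF cU(1)] rep_AE(2)[OF rep_clement] grad_clement_bar[OF z]
    unfolding gv_lincomb w_def by eventually_elim simp
  then have gw: "AE x in M. grad \<Omega> w x = gv (\<lambda>k. cU k - p k) x" by simp
  have "cost \<Omega> \<gamma> \<T> z (Q, f, g) = (LINT x|M. (Q x *v grad \<Omega> w x) \<bullet> grad \<Omega> w x)"
    by (simp add: cost_def w_def Let_def)
  also have "\<dots> = (LINT x|M. (Q x *v gv (\<lambda>k. cU k - p k) x) \<bullet> gv (\<lambda>k. cU k - p k) x)"
  proof (rule integral_cong_AE)
    show "AE x in M. (Q x *v grad \<Omega> w x) \<bullet> grad \<Omega> w x = (Q x *v gv (\<lambda>k. cU k - p k) x) \<bullet> gv (\<lambda>k. cU k - p k) x"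
      using gw by eventually_elim simp
  qed (intro borel_measurable_quadratic_form Q grad_measurable gv_measurable w)+
  finally have "Upsilon \<Omega> \<gamma> \<T> \<rho> z \<Gamma> = Lag \<Gamma> cU"
    using Lag_solution[OF adm, of cU] cU(2)
    by (simp add: Upsilon_def \<Gamma> penalty_eq_pen[OF a] form_def)
  also have "Lag \<Gamma> cU = Lag \<Gamma> c"
    using Lag_le_solution[OF adm s] Lag_le_solution[OF adm cU(2)[folded \<Gamma>]] by (intro order_antisym)
  finally show ?thesis .
qed

lemma optimality_system_iff:
  assumes adm: "(Q, f, g) \<in> adm" and c: "rep U c"
  shows "aeq (Q, f, g) (opt c) \<longleftrightarrow>
    (let Pz = clement_bar \<Omega> \<gamma> \<T> z in
      (AE x in M. Q x = P_K ql qu ((1 / (2 * \<rho>)) *\<^sub>R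
          (sym_tensor (grad \<Omega> U x) (grad \<Omega> U x) - sym_tensor (grad \<Omega> Pz x) (grad \<Omega> Pz x)))) \<and>
      (AE x in M. f x = (1 / \<rho>) * (Pz x - U x)) \<and>
      (AE x in S. g x = (1 / \<rho>) * \<gamma> (\<lambda>y. Pz y - U y) x))"
proof -
  let ?Pz = "clement_bar \<Omega> \<gamma> \<T> z"
  have V: "?Pz \<in> V" "U \<in> V" using rep_clement c by (auto simp: rep_def)
  have "(\<lambda>y. 1 * ?Pz y + (-1) * U y) \<in> V" by (rule V_lincomb[OF V])
  then have "(\<lambda>y. ?Pz y - U y) \<in> V" by simp
  from trace_P1[OF V_P1[OF this]] have tr: "AE x in S. \<gamma> (\<lambda>y. ?Pz y - U y) x = tv p x - tv c x"
    using rep_AE(3)[OF rep_clement] rep_AE(3)[OF c] trace_P1[OF V_P1[OF V(1)]] trace_P1[OF V_P1[OF V(2)]]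
    by eventually_elim simp
  have "(AE x in M. Q x = P_K ql qu ((1 / (2 * \<rho>)) *\<^sub>R
          (sym_tensor (grad \<Omega> U x) (grad \<Omega> U x) - sym_tensor (grad \<Omega> ?Pz x) (grad \<Omega> ?Pz x))))
      \<longleftrightarrow> (AE x in M. Q x = P_K ql qu ((1 / (2 * \<rho>)) *\<^sub>R
          (sym_tensor (gv c x) (gv c x) - sym_tensor (gv p x) (gv p x))))"
    by (rule eventually_subst) (use rep_AE(2)[OF rep_clement] rep_AE(2)[OF c] in \<open>eventually_elim, simp\<close>)
  moreover have "(AE x in M. f x = (1 / \<rho>) * (?Pz x - U x)) \<longleftrightarrow> (AE x in M. f x = (1 / \<rho>) * (ev p x - ev c x))"
    by (rule eventually_subst) (use rep_AE(1)[OF rep_clement] rep_AE(1)[OF c] in \<open>eventually_elim, simp\<close>)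
  moreover have "(AE x in S. g x = (1 / \<rho>) * \<gamma> (\<lambda>y. ?Pz y - U y) x) \<longleftrightarrow> (AE x in S. g x = (1 / \<rho>) * (tv p x - tv c x))"
    by (rule eventually_subst) (use tr in \<open>eventually_elim, simp\<close>)
  ultimately show ?thesis by (simp add: aeq_def opt_def Let_def)
qed

lemma Upsilon_strictly_convex:
  "strictly_convex_problem \<Omega> (H_ad \<Omega> ql qu) (Upsilon \<Omega> \<gamma> \<T> \<rho> z)"
  unfolding strictly_convex_problem_def H_ad_eq_adm ae_equal_eq_aeq convex_comb_eq_comb
proof (intro ballI conjI impI)
  fix \<Gamma> \<Gamma>' and t :: real assume adm: "\<Gamma> \<in> adm" "\<Gamma>' \<in> adm" and t: "t \<in> {0<..<1}"
  then show cA: "comb t \<Gamma> \<Gamma>' \<in> adm" by (intro comb_adm) auto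
  assume ne: "\<not> aeq \<Gamma> \<Gamma>'"
  obtain c c' c'' where s: "solves \<Gamma> c" "solves \<Gamma>' c'" "solves (comb t \<Gamma> \<Gamma>') c''"
    using solution_exists adm cA by metis
  show "Upsilon \<Omega> \<gamma> \<T> \<rho> z (comb t \<Gamma> \<Gamma>') < (1 - t) * Upsilon \<Omega> \<gamma> \<T> \<rho> z \<Gamma> + t * Upsilon \<Omega> \<gamma> \<T> \<rho> z \<Gamma>'"
    using strict_convexity[OF adm _ _ s ne] t
    by (simp add: Upsilon_eq_Lag[OF adm(1) s(1)] Upsilon_eq_Lag[OF adm(2) s(2)] Upsilon_eq_Lag[OF cA s(3)])
qed

lemma minimizer_unique:
  assumes adm: "\<Gamma> \<in> adm" and min: "\<And>\<Gamma>'. \<Gamma>' \<in> adm \<Longrightarrow> Upsilon \<Omega> \<gamma> \<T> \<rho> z \<Gamma> \<le> Upsilon \<Omega> \<gamma> \<T> \<rho> z \<Gamma>'"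
  shows "unique_minimizer \<Omega> (H_ad \<Omega> ql qu) (Upsilon \<Omega> \<gamma> \<T> \<rho> z) \<Gamma>"
  unfolding unique_minimizer_def H_ad_eq_adm ae_equal_eq_aeq
proof (intro conjI ballI impI)
  fix \<Gamma>' assume adm': "\<Gamma>' \<in> adm" and min': "\<forall>\<Gamma>''\<in>adm. Upsilon \<Omega> \<gamma> \<T> \<rho> z \<Gamma>' \<le> Upsilon \<Omega> \<gamma> \<T> \<rho> z \<Gamma>''"
  show "aeq \<Gamma>' \<Gamma>"
  proof (rule ccontr)
    let ?F = "Upsilon \<Omega> \<gamma> \<T> \<rho> z" and ?m = "comb (1/2) \<Gamma>' \<Gamma>"
    assume "\<not> aeq \<Gamma>' \<Gamma>"
    moreover have "(1/2 :: real) \<in> {0<..<1}" by simp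
    ultimately have "?m \<in> adm \<and> ?F ?m < (1 - 1/2) * ?F \<Gamma>' + 1/2 * ?F \<Gamma>"
      using Upsilon_strictly_convex adm adm'
      unfolding strictly_convex_problem_def H_ad_eq_adm ae_equal_eq_aeq convex_comb_eq_comb by blast
    then show False using min[of ?m] min'[rule_format, of \<Gamma>, OF adm] by simp
  qed
qed (use adm min in auto)

lemma opt_minimizer:
  assumes adm: "\<Gamma> \<in> adm" "solves \<Gamma> c" and opt: "aeq \<Gamma> (opt c)"
  shows "unique_minimizer \<Omega> (H_ad \<Omega> ql qu) (Upsilon \<Omega> \<gamma> \<T> \<rho> z) \<Gamma>"
proof (rule minimizer_unique[OF adm(1)])
  fix \<Gamma>' assume adm': "\<Gamma>' \<in> adm"
  then obtain c' where "solves \<Gamma>' c'" using solution_exists by blast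
  then show "Upsilon \<Omega> \<gamma> \<T> \<rho> z \<Gamma> \<le> Upsilon \<Omega> \<gamma> \<T> \<rho> z \<Gamma>'"
    using optimality_sufficient[OF adm opt adm'] by (simp add: Upsilon_eq_Lag[OF adm] Upsilon_eq_Lag[OF adm'])
qed

lemma unique_minimizer_exists:
  "\<exists>c. opt c \<in> adm \<and> solves (opt c) c \<and> unique_minimizer \<Omega> (H_ad \<Omega> ql qu) (Upsilon \<Omega> \<gamma> \<T> \<rho> z) (opt c)"
proof -
  obtain c where c: "solves (opt c) c" using saddle_point_exists by blast
  have "aeq (opt c) (opt c)" by (cases "opt c") (simp add: aeq_def)
  then show ?thesis using opt_minimizer[OF opt_adm c] opt_adm c by blast
qed

text \<open>
  A minimizer coincides almost everywhere with the control of the saddle point; then both have the same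
  state, so the control belonging to that state is the one of the saddle point.
\<close>

lemma unique_minimizer_iff:
  assumes adm: "(Q, f, g) \<in> adm" and s: "solves (Q, f, g) c"
  shows "unique_minimizer \<Omega> (H_ad \<Omega> ql qu) (Upsilon \<Omega> \<gamma> \<T> \<rho> z) (Q, f, g) \<longleftrightarrow> aeq (Q, f, g) (opt c)"
proof
  assume "aeq (Q, f, g) (opt c)"
  then show "unique_minimizer \<Omega> (H_ad \<Omega> ql qu) (Upsilon \<Omega> \<gamma> \<T> \<rho> z) (Q, f, g)"
    by (rule opt_minimizer[OF adm s])
next
  assume u: "unique_minimizer \<Omega> (H_ad \<Omega> ql qu) (Upsilon \<Omega> \<gamma> \<T> \<rho> z) (Q, f, g)"
  obtain d where d: "opt d \<in> adm" "solves (opt d) d"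
      "unique_minimizer \<Omega> (H_ad \<Omega> ql qu) (Upsilon \<Omega> \<gamma> \<T> \<rho> z) (opt d)"
    using unique_minimizer_exists by blast
  have ae: "aeq (Q, f, g) (opt d)"
    using u d(3) unfolding unique_minimizer_def H_ad_eq_adm ae_equal_eq_aeq by blast
  have "solves (Q, f, g) d" using aeq_cong(4)[OF adm d(1) ae] d(2) by simp
  then have "opt d = opt c" using solution_unique[OF adm _ s] by (intro opt_cong)
  then show "aeq (Q, f, g) (opt c)" using ae by simp
qed

end

theorem theorem2p5:
  fixes \<Omega> :: "(real^'n) set"
    and \<gamma> :: "(real^'n \<Rightarrow> real) \<Rightarrow> real^'n \<Rightarrow> real"
    and Th :: "real \<Rightarrow> (real^'n) set set"
    and z :: "real \<Rightarrow> real^'n \<Rightarrow> real"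
    and ql qu h \<rho> \<delta> :: real
  assumes "CARD('n) \<le> 3"
    and "polygonal_domain \<Omega>"
    and "trace_operator \<Omega> \<gamma>"
    and "triangulation_family \<Omega> Th"
    and "0 < ql" and "ql \<le> qu"
    and "0 < h" and "h < 1"
    and "\<rho> > 0" and "\<delta> > 0"
    and "z \<delta> \<in> L2 (lebesgue_on \<Omega>)"
  shows "strictly_convex_problem \<Omega> (H_ad \<Omega> ql qu) (Upsilon \<Omega> \<gamma> (Th h) \<rho> (z \<delta>)) \<and>
    (\<exists>\<Gamma>. unique_minimizer \<Omega> (H_ad \<Omega> ql qu) (Upsilon \<Omega> \<gamma> (Th h) \<rho> (z \<delta>)) \<Gamma>) \<and>
    (\<forall>Q f g. (Q, f, g) \<in> H_ad \<Omega> ql qu \<longrightarrow>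
      (let U = fe_solution \<Omega> \<gamma> (Th h) (Q, f, g);
           Pz = clement_bar \<Omega> \<gamma> (Th h) (z \<delta>)
       in unique_minimizer \<Omega> (H_ad \<Omega> ql qu) (Upsilon \<Omega> \<gamma> (Th h) \<rho> (z \<delta>)) (Q, f, g) \<longleftrightarrow>
          (AE x in lebesgue_on \<Omega>. Q x = P_K ql qu ((1 / (2 * \<rho>)) *\<^sub>R
              (sym_tensor (grad \<Omega> U x) (grad \<Omega> U x) - sym_tensor (grad \<Omega> Pz x) (grad \<Omega> Pz x)))) \<and>
          (AE x in lebesgue_on \<Omega>. f x = (1 / \<rho>) * (Pz x - U x)) \<and>
          (AE x in surface_measure \<Omega>. g x = (1 / \<rho>) * \<gamma> (\<lambda>y. Pz y - U y) x)))"
proof -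
  interpret traced_domain \<Omega> "Th h" \<gamma>
    using assms(2-4,7,8)
    by unfold_locales (auto simp: polygonal_domain_def triangulation_family_def)
  obtain m :: nat and e where e: "\<forall>k<m. e k \<in> V1 \<Omega> \<gamma> (Th h)"
      "\<forall>j<m. \<forall>k<m. (LINT x|lebesgue_on \<Omega>. grad \<Omega> (e j) x \<bullet> grad \<Omega> (e k) x) = (if j = k then 1 else 0)"
      "\<forall>v\<in>V1 \<Omega> \<gamma> (Th h). \<exists>c. \<forall>x\<in>closure \<Omega>. v x = (\<Sum>k<m. c k * e k x)"
    using V_orthonormal_basis by blast
  obtain p where p: "\<forall>x\<in>closure \<Omega>. clement_bar \<Omega> \<gamma> (Th h) (z \<delta>) x = (\<Sum>k<m. p k * e k x)"
    using e(3) clement_bar_in_V[OF assms(11)] by blast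
  interpret fe_minimization \<Omega> "Th h" \<gamma> "z \<delta>" \<rho> ql qu m e p
    using e p assms(5,6,9,11) by unfold_locales auto
  show ?thesis
  proof (intro conjI allI impI)
    show "strictly_convex_problem \<Omega> (H_ad \<Omega> ql qu) (Upsilon \<Omega> \<gamma> (Th h) \<rho> (z \<delta>))"
      by (rule Upsilon_strictly_convex)
    show "\<exists>\<Gamma>. unique_minimizer \<Omega> (H_ad \<Omega> ql qu) (Upsilon \<Omega> \<gamma> (Th h) \<rho> (z \<delta>)) \<Gamma>"
      using unique_minimizer_exists by blast
    fix Q f g assume "(Q, f, g) \<in> H_ad \<Omega> ql qu"
    then have adm: "(Q, f, g) \<in> adm" by (simp add: H_ad_eq_adm)
    obtain c where c: "rep (fe_solution \<Omega> \<gamma> (Th h) (Q, f, g)) c" "solves (Q, f, g) c"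
      using fe_solution_rep[OF adm] by blast
    show "let U = fe_solution \<Omega> \<gamma> (Th h) (Q, f, g);
           Pz = clement_bar \<Omega> \<gamma> (Th h) (z \<delta>)
       in unique_minimizer \<Omega> (H_ad \<Omega> ql qu) (Upsilon \<Omega> \<gamma> (Th h) \<rho> (z \<delta>)) (Q, f, g) \<longleftrightarrow>
          (AE x in lebesgue_on \<Omega>. Q x = P_K ql qu ((1 / (2 * \<rho>)) *\<^sub>R
              (sym_tensor (grad \<Omega> U x) (grad \<Omega> U x) - sym_tensor (grad \<Omega> Pz x) (grad \<Omega> Pz x)))) \<and>
          (AE x in lebesgue_on \<Omega>. f x = (1 / \<rho>) * (Pz x - U x)) \<and>
          (AE x in surface_measure \<Omega>. g x = (1 / \<rho>) * \<gamma> (\<lambda>y. Pz y - U y) x)"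
      using unique_minimizer_iff[OF adm c(2)] optimality_system_iff[OF adm c(1)] by (simp only: Let_def)
  qed
qed

end
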